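(* Let $d\ge2$, $s\in(0,d)$, and let $\Omega:\mathbb{R}^d\to\mathbb{R}^N$ be Lipschitz continuous, odd, and one-homogeneous. Let $\mu$ be a measure on $\mathbb{R}^d$ with $\overline{D}_{\mu,s}(x)<\infty$ for $\mu$-almost every $x\in\mathbb{R}^d$. Then $\Omega$ has small local $s$-action with respect to $\mu$ if and only if $\lim_{r\to0}\alpha_{\mu,\Omega,s}(B(x,r))=0$ for $\mu$-almost every $x\in\mathbb{R}^d$.
   Context: Measures are non-negative, locally finite Borel measures on $\mathbb{R}^d$; $B(x,r)$ is the open ball; $\overline{D}_{\mu,s}(x)=\limsup_{r\to0}\mu(B(x,r))/r^s$; $\operatorname{supp}(\nu)$ is the closed support. One-homogeneous means $\Omega(\lambda x)=\lambda\Omega(x)$ for all $\lambda>0$. $N\ge1$ is an arbitrary integer. Small local action: fix a family of Lipschitz functions $\eta^\tau:[0,\infty)\to\mathbb{R}$, $\tau\in(0,1)$, with $\eta^\tau(t)=1$ for $0\le t\le 1-\tau$, $\eta^\tau(t)=0$ for $t\ge1$, and Lipschitz constant at most $1/\tau$. The kernel $\Omega$ has small local $s$-action with respect to $\mu$ if for every $\tau\in(0,1)$, $$\lim_{r\to0}\frac{1}{r^{s+1}}\int_{\mathbb{R}^d}\Omega(x-y)\,\eta^\tau\Bigl(\frac{|x-y|}{r}\Bigr)\,d\mu(y)=0\quad\text{for }\mu\text{-almost every }x\in\mathbb{R}^d.$$ Symmetric measures: a point $x$ is an $\Omega$-symmetric point of a measure $\nu$ if $\int_{B(x,r)}\Omega(x-y)\,d\nu(y)=0$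 for all $r>0$; $S(\Omega,\nu)$ is the set of such points; $\nu$ is $\Omega$-symmetric if $\operatorname{supp}(\nu)\subset S(\Omega,\nu)$. Let $\mathcal{M}_s$ be the set of measures $\nu$ with $\nu(B(x,r))\le r^s$ for all $x\in\mathbb{R}^d$, $r>0$. Let $\mathcal{S}_{s,\Omega}=\{\nu\in\mathcal{M}_s:\nu\text{ is }\Omega\text{-symmetric}\}$ and $\mathcal{S}^x_{s,\Omega}=\{\nu\in\mathcal{S}_{s,\Omega}: x\in S(\Omega,\nu)\}$. Transportation numbers: fix a smooth function $\varphi:[0,\infty)\to[0,1]$ with $\varphi\equiv1$ on $[0,3]$ and $\operatorname{supp}\varphi$ a compact subset of $[0,4)$. Let $\mathrm{Lip}_0(B(x,4r))$ be the real-valued Lipschitz functions supported in a compact subset of $B(x,4r)$, with $\|f\|_{\mathrm{Lip}}$ the Lipschitz constant on $\mathbb{R}^d$. Then $$\alpha_{\mu,\Omega,s}(B(x,r))=\inf_{\nu\in\mathcal{S}^x_{s,\Omega}}\ \sup_{\substack{f\in\mathrm{Lip}_0(B(x,4r))\\ \|f\|_{\mathrm{Lip}}\le1/r}}\Bigl|\frac1{r^s}\int_{\mathbb{R}^d}\varphi\Bigl(\frac{|\cdot-x|}{r}\Bigr)f\,d(\mu-c_{\mu,\nu}\nu)\Bigr|,$$ where $c_{\mu,\nu}=\int\varphi(\frac{|\cdot-x|}{r})\,d\mu\,\bigl[\int\varphi(\frac{|\cdot-x|}{r})\,d\nu\bigr]^{-1}$ if $\int\varphi(\frac{|\cdot-x|}{r})\,d\nu\ne0$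 and $c_{\mu,\nu}=0$ otherwise. *)

theory Defs
  imports "HOL-Analysis.Analysis"
begin

definition locally_finite_borel :: "'a::topological_space measure \<Rightarrow> bool" where
  "locally_finite_borel \<mu> \<longleftrightarrow>
     sets \<mu> = sets borel \<and> (\<forall>x. \<exists>U. open U \<and> x \<in> U \<and> emeasure \<mu> U < \<infinity>)"

definition upper_density :: "'a::metric_space measure \<Rightarrow> real \<Rightarrow> 'a \<Rightarrow> ennreal" where
  "upper_density \<mu> s x =
     Limsup (at_right 0) (\<lambda>r. emeasure \<mu> (ball x r) / ennreal (r powr s))"

definition closed_support :: "'a::topological_space measure \<Rightarrow> 'a set" where
  "closed_support \<nu> = {x. \<forall>U. open U \<and> x \<in> U \<longrightarrow> emeasure \<nu> U > 0}"

definition one_homogeneous :: "('a::real_vector \<Rightarrow> 'b::real_vector) \<Rightarrow> bool" where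
  "one_homogeneous \<Omega> \<longleftrightarrow> (\<forall>c>0. \<forall>x. \<Omega> (c *\<^sub>R x) = c *\<^sub>R \<Omega> x)"

(* Functions on the half-line [0, oo) are represented by total functions on the reals whose
   values at negative arguments are unconstrained and never used. *)

definition cutoff_family :: "(real \<Rightarrow> real \<Rightarrow> real) \<Rightarrow> bool" where
  "cutoff_family \<eta> \<longleftrightarrow>
     (\<forall>\<tau>\<in>{0<..<1}. (1 / \<tau>)-lipschitz_on {0..} (\<eta> \<tau>) \<and>
        (\<forall>t\<in>{0..1 - \<tau>}. \<eta> \<tau> t = 1) \<and> (\<forall>t\<ge>1. \<eta> \<tau> t = 0))"

definition small_local_action ::
    "(real \<Rightarrow> real \<Rightarrow> real) \<Rightarrow> real \<Rightarrow> ('a::euclidean_space \<Rightarrow> 'b::euclidean_space) \<Rightarrow> 'a measure \<Rightarrow> bool"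
  where
  "small_local_action \<eta> s \<Omega> \<mu> \<longleftrightarrow>
     (\<forall>\<tau>\<in>{0<..<1}. AE x in \<mu>.
        ((\<lambda>r. (1 / r powr (s + 1)) *\<^sub>R
           (\<integral>y. \<eta> \<tau> (norm (x - y) / r) *\<^sub>R \<Omega> (x - y) \<partial>\<mu>)) \<longlongrightarrow> 0) (at_right 0))"

definition symmetric_points ::
    "('a::euclidean_space \<Rightarrow> 'b::euclidean_space) \<Rightarrow> 'a measure \<Rightarrow> 'a set" where
  "symmetric_points \<Omega> \<nu> = {x. \<forall>r>0. (LINT y:ball x r|\<nu>. \<Omega> (x - y)) = 0}"

definition symmetric_measure ::
    "('a::euclidean_space \<Rightarrow> 'b::euclidean_space) \<Rightarrow> 'a measure \<Rightarrow> bool" where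
  "symmetric_measure \<Omega> \<nu> \<longleftrightarrow> closed_support \<nu> \<subseteq> symmetric_points \<Omega> \<nu>"

definition growth_measures :: "real \<Rightarrow> 'a::euclidean_space measure set" where
  "growth_measures s =
     {\<nu>. locally_finite_borel \<nu> \<and> (\<forall>x. \<forall>r>0. emeasure \<nu> (ball x r) \<le> ennreal (r powr s))}"

definition symmetric_measures ::
    "real \<Rightarrow> ('a::euclidean_space \<Rightarrow> 'b::euclidean_space) \<Rightarrow> 'a measure set" where
  "symmetric_measures s \<Omega> = {\<nu> \<in> growth_measures s. symmetric_measure \<Omega> \<nu>}"

definition symmetric_measures_at ::
    "real \<Rightarrow> ('a::euclidean_space \<Rightarrow> 'b::euclidean_space) \<Rightarrow> 'a \<Rightarrow> 'a measure set" where
  "symmetric_measures_at s \<Omega> x = {\<nu> \<in> symmetric_measures s \<Omega>. x \<in> symmetric_points \<Omega> \<nu>}"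

(* Infinitely differentiable on [0, oo), with the one-sided derivative at 0:
   D k is the k-th derivative. *)
definition smooth_on_half_line :: "(real \<Rightarrow> real) \<Rightarrow> bool" where
  "smooth_on_half_line f \<longleftrightarrow>
     (\<exists>D :: nat \<Rightarrow> real \<Rightarrow> real. (\<forall>t\<ge>0. D 0 t = f t) \<and>
        (\<forall>k. \<forall>t\<ge>0. (D k has_real_derivative D (Suc k) t) (at t within {0..})))"

definition smooth_cutoff :: "(real \<Rightarrow> real) \<Rightarrow> bool" where
  "smooth_cutoff \<phi> \<longleftrightarrow>
     smooth_on_half_line \<phi> \<and> (\<forall>t\<ge>0. \<phi> t \<in> {0..1}) \<and> (\<forall>t\<in>{0..3}. \<phi> t = 1) \<and>
     compact (closure {t\<in>{0..}. \<phi> t \<noteq> 0}) \<and> closure {t\<in>{0..}. \<phi> t \<noteq> 0} \<subseteq> {0..<4}"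

definition Lip0 :: "'a::metric_space set \<Rightarrow> ('a \<Rightarrow> real) set" where
  "Lip0 B = {f. (\<exists>L. L-lipschitz_on UNIV f) \<and>
                (\<exists>K. compact K \<and> K \<subseteq> B \<and> (\<forall>y. y \<notin> K \<longrightarrow> f y = 0))}"

definition cutoff_mass :: "(real \<Rightarrow> real) \<Rightarrow> 'a::euclidean_space measure \<Rightarrow> 'a \<Rightarrow> real \<Rightarrow> real" where
  "cutoff_mass \<phi> \<mu> x r = (\<integral>y. \<phi> (norm (y - x) / r) \<partial>\<mu>)"

definition normalizing_const ::
    "(real \<Rightarrow> real) \<Rightarrow> 'a::euclidean_space measure \<Rightarrow> 'a measure \<Rightarrow> 'a \<Rightarrow> real \<Rightarrow> real" where
  "normalizing_const \<phi> \<mu> \<nu> x r =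
     (if cutoff_mass \<phi> \<nu> x r \<noteq> 0 then cutoff_mass \<phi> \<mu> x r / cutoff_mass \<phi> \<nu> x r else 0)"

(* The integral against the signed measure mu - c nu is the difference of the two integrals.
   Infimum and supremum are taken in ennreal, so they need no boundedness side conditions. *)
definition transport_number ::
    "(real \<Rightarrow> real) \<Rightarrow> 'a::euclidean_space measure \<Rightarrow> ('a \<Rightarrow> 'b::euclidean_space) \<Rightarrow> real \<Rightarrow> 'a \<Rightarrow> real \<Rightarrow> ennreal"
  where
  "transport_number \<phi> \<mu> \<Omega> s x r =
     (INF \<nu>\<in>symmetric_measures_at s \<Omega> x.
        SUP f\<in>{f \<in> Lip0 (ball x (4 * r)). (1 / r)-lipschitz_on UNIV f}.
          ennreal \<bar>1 / r powr s *
            ((\<integral>y. \<phi> (norm (y - x) / r) * f y \<partial>\<mu>)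
             - normalizing_const \<phi> \<mu> \<nu> x r * (\<integral>y. \<phi> (norm (y - x) / r) * f y \<partial>\<nu>))\<bar>)"

end

theory Submission
  imports Defs "HOL-Probability.Helly_Selection" "HOL-Complex_Analysis.Great_Picard"
begin

text \<open>
  Small action and small transport numbers both say that, seen at small scales around a
  typical point, \<open>\<mu>\<close> looks like a measure that \<open>\<Omega>\<close> cannot detect. The two implications are of
  very different depth.

  Transport numbers control the action at every single scale. For fixed \<open>x\<close> and \<open>r\<close> the truncated
  kernel \<open>\<eta> \<tau> (\<bar>x - y\<bar> / r) \<Omega> (x - y)\<close>, divided by a constant multiple of \<open>r\<close>, is an admissible test
  function, and every competitor \<open>\<nu>\<close> for which \<open>x\<close> is a symmetric point integrates it to zero,
  because the truncation is radial. Hence the action of \<open>\<mu>\<close> is at most a constant times the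
  transport number (\<open>transport_number_ge_action\<close>).

  The converse is a compactness argument. By Egorov's theorem \<open>\<mu>\<close> is exhausted by compact sets \<open>F\<close>
  on which both the growth bound \<open>\<mu> (ball x r) \<le> C r\<^sup>s\<close> and the smallness of the action are uniform
  (\<open>AE_exhaust_by_compact\<close>), and at almost every point of \<open>F\<close> the complement of \<open>F\<close> has
  \<open>s\<close>-density zero (\<open>complement_density_zero\<close>). Fix such a point \<open>x\<close> and suppose that the
  transport numbers stay away from zero along radii \<open>r\<^sub>n\<close> tending to zero. The restriction of \<open>\<mu>\<close> to
  \<open>F\<close> has growth of order \<open>s\<close> around every point and at every scale, so its blow-ups at \<open>x\<close> with
  factors \<open>1 / r\<^sub>n\<close> have a vaguely convergent subsequence (\<open>vague_sequential_compactness\<close>). The limit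
  \<open>\<nu>\<close> inherits the growth, and it is symmetric: a point of its support is a limit of rescaled points
  of \<open>F\<close>, and there the action at any fixed multiple of the scale \<open>r\<^sub>n\<close> tends to zero uniformly
  (\<open>blowup_limit_symmetric\<close>). Rescaling \<open>\<nu>\<close> back to scale \<open>r\<^sub>n\<close> gives a competitor in the definition
  of the transport number. Vague convergence is uniform over the test functions, since these form a
  compact family by Arzela and Ascoli (\<open>lipschitz_family_uniform_convergence\<close>), so this competitor
  makes the transport numbers tend to zero along the subsequence: a contradiction.

  A vague limit of measures is obtained from Helly's selection theorem on the real line. A compact
  set is coded by real numbers in a Borel way with a continuous decoding map (\<open>compact_real_code\<close>),
  which settles the case of probability measures on a ball; measures of polynomial growth are made
  finite by a weight and moved into the ball by a homeomorphism.
\<close>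

section \<open>Radial truncations of the kernel\<close>

text \<open>
  Written as a function of the displacement \<open>z = x - y\<close>, so that its Lipschitz bound and its
  scaling law are statements about a single function, for all base points at once.
\<close>
definition radial_cut ::
    "(real \<Rightarrow> real) \<Rightarrow> ('a::euclidean_space \<Rightarrow> 'b::euclidean_space) \<Rightarrow> real \<Rightarrow> 'a \<Rightarrow> 'b" where
  "radial_cut h \<Omega> r z = h (norm z / r) *\<^sub>R \<Omega> z"

lemma radial_cut_eq_0:
  assumes "\<forall>t\<ge>1. h t = 0" "0 < r" "r \<le> norm z"
  shows "radial_cut h \<Omega> r z = 0"
  using assms by (simp add: radial_cut_def)

lemma cutoff_bound:
  fixes h :: "real \<Rightarrow> real"
  assumes h: "H-lipschitz_on {0..} h" and h1: "\<forall>t\<ge>1. h t = 0" and t: "0 \<le> t"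
  shows "\<bar>h t\<bar> \<le> H"
proof (cases "t \<le> 1")
  case True
  have "\<bar>h t\<bar> \<le> H * \<bar>t - 1\<bar>"
    using lipschitz_onD[OF h, of t 1] t h1 by (simp add: dist_real_def)
  also have "\<dots> \<le> H * 1"
    using True t lipschitz_on_nonneg[OF h] by (intro mult_left_mono) auto
  finally show ?thesis by simp
next
  case False
  then show ?thesis using h1 lipschitz_on_nonneg[OF h] by simp
qed

lemma kernel_norm_le:
  assumes "L-lipschitz_on UNIV \<Omega>" "\<Omega> 0 = 0"
  shows "norm (\<Omega> z) \<le> L * norm z"
  using lipschitz_onD[OF assms(1), of z 0] assms(2) by (simp add: dist_norm)

lemma odd_kernel_0:
  fixes \<Omega> :: "'a::real_vector \<Rightarrow> 'b::real_vector"
  assumes "\<And>x. \<Omega> (- x) = - \<Omega> x"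
  shows "\<Omega> 0 = 0"
proof -
  have "2 *\<^sub>R \<Omega> 0 = \<Omega> 0 + \<Omega> 0" by (simp add: scaleR_2)
  also have "\<dots> = 0" using assms[of 0] by (metis add.right_inverse minus_zero)
  finally show ?thesis by simp
qed

lemma radial_cut_norm_le:
  assumes h: "H-lipschitz_on {0..} h" and h1: "\<forall>t\<ge>1. h t = 0"
    and \<Omega>: "L-lipschitz_on UNIV \<Omega>" "\<Omega> 0 = 0" and r: "0 < r"
  shows "norm (radial_cut h \<Omega> r z) \<le> H * L * r"
proof (cases "norm z \<le> r")
  case True
  have "norm (radial_cut h \<Omega> r z) = \<bar>h (norm z / r)\<bar> * norm (\<Omega> z)"
    by (simp add: radial_cut_def)
  also have "\<dots> \<le> H * (L * norm z)"
    using cutoff_bound[OF h h1] kernel_norm_le[OF \<Omega>] r lipschitz_on_nonneg[OF h]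
    by (intro mult_mono) auto
  also have "\<dots> \<le> H * (L * r)"
    using True lipschitz_on_nonneg[OF h] lipschitz_on_nonneg[OF \<Omega>(1)] by (intro mult_left_mono) auto
  finally show ?thesis by (simp add: mult_ac)
next
  case False
  then show ?thesis
    using radial_cut_eq_0[where h=h and z=z and \<Omega>=\<Omega>, OF h1 r] lipschitz_on_nonneg[OF h] lipschitz_on_nonneg[OF \<Omega>(1)] r
    by simp
qed

text \<open>
  The profile varies at rate \<open>H / r\<close> but multiplies a kernel of size at most \<open>L r\<close> on the ball where
  the product lives. The scale cancels, and the two terms of the product rule contribute \<open>H L\<close> each.
\<close>
lemma radial_cut_lipschitz:
  assumes h: "H-lipschitz_on {0..} h" and h1: "\<forall>t\<ge>1. h t = 0"
    and \<Omega>: "L-lipschitz_on UNIV \<Omega>" "\<Omega> 0 = 0" and r: "0 < r"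
  shows "(2 * H * L)-lipschitz_on UNIV (radial_cut h \<Omega> r)"
proof (rule lipschitz_onI)
  have H0: "0 \<le> H" and L0: "0 \<le> L"
    using lipschitz_on_nonneg[OF h] lipschitz_on_nonneg[OF \<Omega>(1)] by auto
  have main: "dist (radial_cut h \<Omega> r y) (radial_cut h \<Omega> r z) \<le> 2 * H * L * dist y z"
    if yz: "norm y \<le> norm z" for y z
  proof (cases "r \<le> norm y")
    case True
    then show ?thesis
      using radial_cut_eq_0[where h=h and \<Omega>=\<Omega>, OF h1 r] yz H0 L0 by simp
  next
    case False
    then have y: "norm y \<le> r" by simp
    have hd: "\<bar>h (norm y / r) - h (norm z / r)\<bar> \<le> H * (norm (y - z) / r)"
    proof -
      have "\<bar>h (norm y / r) - h (norm z / r)\<bar> \<le> H * \<bar>norm y / r - norm z / r\<bar>"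
        using lipschitz_onD[OF h, of "norm y / r" "norm z / r"] r by (simp add: dist_real_def)
      also have "\<dots> = H * (\<bar>norm y - norm z\<bar> / r)"
        using r by (simp add: diff_divide_distrib[symmetric] abs_divide)
      also have "\<dots> \<le> H * (norm (y - z) / r)"
        using r H0 norm_triangle_ineq3[of y z] by (intro mult_left_mono divide_right_mono) auto
      finally show ?thesis .
    qed
    have "norm (radial_cut h \<Omega> r y - radial_cut h \<Omega> r z)
        = norm ((h (norm y / r) - h (norm z / r)) *\<^sub>R \<Omega> y + h (norm z / r) *\<^sub>R (\<Omega> y - \<Omega> z))"
      by (simp add: radial_cut_def algebra_simps)
    also have "\<dots> \<le> \<bar>h (norm y / r) - h (norm z / r)\<bar> * norm (\<Omega> y) + \<bar>h (norm z / r)\<bar> * norm (\<Omega> y - \<Omega> z)"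
      by (metis norm_scaleR norm_triangle_ineq)
    also have "\<dots> \<le> (H * (norm (y - z) / r)) * (L * r) + H * (L * norm (y - z))"
    proof (intro add_mono mult_mono hd)
      show "norm (\<Omega> y) \<le> L * r"
        using kernel_norm_le[OF \<Omega>, of y] mult_left_mono[OF y L0] by linarith
      show "\<bar>h (norm z / r)\<bar> \<le> H"
        using cutoff_bound[OF h h1] r by simp
      show "norm (\<Omega> y - \<Omega> z) \<le> L * norm (y - z)"
        using lipschitz_onD[OF \<Omega>(1), of y z] by (simp add: dist_norm)
    qed (use H0 L0 r in auto)
    also have "\<dots> = 2 * H * L * norm (y - z)"
      using r by (simp add: field_simps)
    finally show ?thesis by (simp add: dist_norm)
  qed
  fix y z :: 'a
  show "dist (radial_cut h \<Omega> r y) (radial_cut h \<Omega> r z) \<le> 2 * H * L * dist y z"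
    using main[of y z] main[of z y] by (cases "norm y \<le> norm z") (auto simp: dist_commute)
qed (use lipschitz_on_nonneg[OF h] lipschitz_on_nonneg[OF \<Omega>(1)] in auto)

lemma radial_cut_continuous:
  assumes "H-lipschitz_on {0..} h" "\<forall>t\<ge>1. h t = 0"
    "L-lipschitz_on UNIV \<Omega>" "\<Omega> 0 = 0" "0 < r"
  shows "continuous_on UNIV (radial_cut h \<Omega> r)"
  using radial_cut_lipschitz[OF assms] lipschitz_on_continuous_on by blast

lemma cutoff_familyD:
  assumes "cutoff_family \<eta>" "0 < \<tau>" "\<tau> < 1"
  shows "(1 / \<tau>)-lipschitz_on {0..} (\<eta> \<tau>)" "\<And>t. 0 \<le> t \<Longrightarrow> t \<le> 1 - \<tau> \<Longrightarrow> \<eta> \<tau> t = 1"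
    "\<forall>t\<ge>1. \<eta> \<tau> t = 0" "\<And>t. 0 \<le> t \<Longrightarrow> \<bar>\<eta> \<tau> t\<bar> \<le> 1"
proof -
  show lip: "(1 / \<tau>)-lipschitz_on {0..} (\<eta> \<tau>)" and one: "\<And>t. 0 \<le> t \<Longrightarrow> t \<le> 1 - \<tau> \<Longrightarrow> \<eta> \<tau> t = 1"
    and zero: "\<forall>t\<ge>1. \<eta> \<tau> t = 0"
    using assms by (auto simp: cutoff_family_def)
  fix t :: real assume t: "0 \<le> t"
  consider "t \<le> 1 - \<tau>" | "1 - \<tau> < t" "t < 1" | "1 \<le> t" by linarith
  then show "\<bar>\<eta> \<tau> t\<bar> \<le> 1"
  proof cases
    case 2
    have "\<bar>\<eta> \<tau> t\<bar> \<le> 1 / \<tau> * \<bar>t - 1\<bar>"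
      using lipschitz_onD[OF lip, of t 1] zero t by (simp add: dist_real_def)
    also have "\<dots> \<le> 1 / \<tau> * \<tau>" using 2 assms by (intro mult_left_mono) auto
    finally show ?thesis using assms by simp
  qed (use one[OF t] zero in auto)
qed

section \<open>Locally finite Borel measures\<close>

lemma locally_finite_borelD:
  assumes "locally_finite_borel \<mu>"
  shows "sets \<mu> = sets borel" "space \<mu> = UNIV"
  using assms by (auto simp: locally_finite_borel_def dest: sets_eq_imp_space_eq)

lemma locally_finite_borel_compact:
  assumes "locally_finite_borel \<mu>" "compact K"
  shows "emeasure \<mu> K < \<infinity>"
proof -
  have "\<forall>x. \<exists>U. open U \<and> x \<in> U \<and> emeasure \<mu> U < \<infinity>"
    using assms(1) by (auto simp: locally_finite_borel_def)
  then obtain U where U: "\<And>x. open (U x)" "\<And>x. x \<in> U x" "\<And>x. emeasure \<mu> (U x) < \<infinity>"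
    by metis
  from assms(2) obtain T where T: "finite T" "K \<subseteq> (\<Union>x\<in>T. U x)"
    by (rule compactE_image[of K UNIV U]) (use U in blast)+
  have "emeasure \<mu> K \<le> emeasure \<mu> (\<Union>x\<in>T. U x)"
    using T U by (intro emeasure_mono) (auto simp: locally_finite_borelD[OF assms(1)])
  also have "\<dots> \<le> (\<Sum>x\<in>T. emeasure \<mu> (U x))"
    using T U by (intro emeasure_subadditive_finite) (auto simp: locally_finite_borelD[OF assms(1)])
  also have "\<dots> < \<infinity>"
    using T U by (auto simp: less_top)
  finally show ?thesis .
qed

lemma locally_finite_borel_ball:
  fixes x :: "'a::{heine_borel}"
  assumes "locally_finite_borel \<mu>"
  shows "emeasure \<mu> (ball x r) < \<infinity>"
proof -
  have "emeasure \<mu> (ball x r) \<le> emeasure \<mu> (cball x r)"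
    by (rule emeasure_mono) (auto simp: locally_finite_borelD[OF assms])
  also have "\<dots> < \<infinity>"
    using locally_finite_borel_compact[OF assms compact_cball] .
  finally show ?thesis .
qed

lemma integrable_continuous_compact_support:
  fixes f :: "'a::heine_borel \<Rightarrow> 'b::{banach, second_countable_topology}"
  assumes \<mu>: "locally_finite_borel \<mu>" and f: "continuous_on UNIV f" and K: "compact K"
    and f0: "\<And>y. y \<notin> K \<Longrightarrow> f y = 0"
  shows "integrable \<mu> f"
proof -
  have sets: "sets \<mu> = sets borel" and space: "space \<mu> = UNIV"
    using locally_finite_borelD[OF \<mu>] by auto
  have KS: "K \<in> sets \<mu>" using K by (simp add: sets borel_compact)
  have "bounded (f ` K)"
    by (intro compact_imp_bounded compact_continuous_image continuous_on_subset[OF f] K) auto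
  then obtain B where B: "\<And>y. y \<in> K \<Longrightarrow> norm (f y) \<le> B"
    by (auto simp: bounded_iff)
  have meas: "f \<in> borel_measurable \<mu>"
    using borel_measurable_continuous_onI[OF f] sets measurable_cong_sets by blast
  have "integrable \<mu> (\<lambda>y. indicator K y *\<^sub>R f y)"
    using B by (intro integrableI_bounded_set_indicator[where B=B] KS meas)
       (use locally_finite_borel_compact[OF \<mu> K] in auto)
  also have "(\<lambda>y. indicator K y *\<^sub>R f y) = f"
    using f0 by (auto simp: fun_eq_iff indicator_def)
  finally show ?thesis .
qed

lemma radial_cut_integrable:
  assumes \<mu>: "locally_finite_borel \<mu>"
    and "H-lipschitz_on {0..} h" "\<forall>t\<ge>1. h t = 0"
    "L-lipschitz_on UNIV \<Omega>" "\<Omega> 0 = 0" "0 < r"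
  shows "integrable \<mu> (\<lambda>y. radial_cut h \<Omega> r (x - y))"
proof (rule integrable_continuous_compact_support[OF \<mu> _ compact_cball])
  show "continuous_on UNIV (\<lambda>y. radial_cut h \<Omega> r (x - y))"
    by (intro continuous_on_compose2[OF radial_cut_continuous[OF assms(2-)]] continuous_intros) auto
  show "radial_cut h \<Omega> r (x - y) = 0" if "y \<notin> cball x r" for y
    using that assms by (intro radial_cut_eq_0) (auto simp: dist_norm)
qed

section \<open>Small transport numbers force small action\<close>

text \<open>
  Balls about \<open>x\<close> have vanishing \<open>\<Omega>\<close>-integral, hence so have annuli, which are differences of balls.
  Cutting \<open>ball x r\<close> into \<open>n\<close> annuli of equal width and replacing the profile by a constant on each of
  them costs at most \<open>H / n\<close> times \<open>L r\<close> times the mass of the ball.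
\<close>
lemma symmetric_point_radial_integral:
  assumes \<nu>: "locally_finite_borel \<nu>" and x: "x \<in> symmetric_points \<Omega> \<nu>"
    and h: "H-lipschitz_on {0..} h" and h1: "\<forall>t\<ge>1. h t = 0"
    and \<Omega>: "L-lipschitz_on UNIV \<Omega>" "\<Omega> 0 = 0" and r: "0 < r"
  shows "(\<integral>y. radial_cut h \<Omega> r (x - y) \<partial>\<nu>) = 0"
proof -
  have sets [simp]: "sets \<nu> = sets borel" and space [simp]: "space \<nu> = UNIV"
    using locally_finite_borelD[OF \<nu>] by auto
  have H0: "0 \<le> H" and L0: "0 \<le> L"
    using lipschitz_on_nonneg[OF h] lipschitz_on_nonneg[OF \<Omega>(1)] by auto
  let ?g = "\<lambda>y. radial_cut h \<Omega> r (x - y)"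
  have gi: "integrable \<nu> ?g"
    by (rule radial_cut_integrable[OF \<nu> h h1 \<Omega> r])
  have \<Omega>c: "continuous_on UNIV (\<lambda>y. \<Omega> (x - y))"
    by (intro continuous_on_compose2[OF lipschitz_on_continuous_on[OF \<Omega>(1)]] continuous_intros) auto
  have \<Omega>m: "(\<lambda>y. \<Omega> (x - y)) \<in> borel_measurable \<nu>"
    using borel_measurable_continuous_onI[OF \<Omega>c] sets measurable_cong_sets by blast
  have bfin: "emeasure \<nu> (ball x t) < \<infinity>" for t
    by (rule locally_finite_borel_ball[OF \<nu>])
  have \<Omega>i: "set_integrable \<nu> (ball x t) (\<lambda>y. \<Omega> (x - y))" for t
    unfolding set_integrable_def
  proof (rule integrableI_bounded_set_indicator[where B="L * t"])
    show "AE y in \<nu>. y \<in> ball x t \<longrightarrow> norm (\<Omega> (x - y)) \<le> L * t"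
    proof (intro AE_I2 impI)
      fix y assume "y \<in> ball x t"
      then have "norm (x - y) \<le> t" by (simp add: dist_norm)
      then show "norm (\<Omega> (x - y)) \<le> L * t"
        using kernel_norm_le[OF \<Omega>, of "x - y"] mult_left_mono[OF _ L0, of "norm (x - y)" t] by linarith
    qed
  qed (use \<Omega>m bfin in auto)
  have \<Omega>0: "(LINT y:ball x t|\<nu>. \<Omega> (x - y)) = 0" for t
    using x by (cases "0 < t") (auto simp: symmetric_points_def set_lebesgue_integral_def ball_empty not_less)
  \<comment> \<open>The error collected by the first \<open>i\<close> annuli is proportional to the mass they carry, so the
    bounds add up by induction on \<open>i\<close>.\<close>
  have step: "norm (LINT y:ball x (real i * r / real n)|\<nu>. ?g y)
      \<le> H / n * (L * r) * measure \<nu> (ball x (real i * r / real n))" if i: "i \<le> n" and n: "0 < n" for i n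
    using i
  proof (induction i)
    case 0
    then show ?case by (simp add: set_lebesgue_integral_def)
  next
    case (Suc i)
    let ?b = "ball x (real i * r / real n)" and ?B = "ball x (real (Suc i) * r / real n)"
    let ?c = "h (real i / real n)"
    have bB: "?b \<subseteq> ?B"
      using r n by (intro subset_ball divide_right_mono mult_right_mono) auto
    have split: "(LINT y:?B|\<nu>. f y) = (LINT y:?b|\<nu>. f y) + (LINT y:?B - ?b|\<nu>. f y)"
      if "set_integrable \<nu> ?B f" for f :: "'a \<Rightarrow> 'b"
    proof -
      have "?B = ?b \<union> (?B - ?b)" using bB by auto
      then have "(LINT y:?B|\<nu>. f y) = (LINT y:?b \<union> (?B - ?b)|\<nu>. f y)" by simp
      also have "\<dots> = (LINT y:?b|\<nu>. f y) + (LINT y:?B - ?b|\<nu>. f y)"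
        by (rule set_integral_Un) (use bB in \<open>auto intro!: set_integrable_subset[OF that]\<close>)
      finally show ?thesis .
    qed
    have gB: "set_integrable \<nu> A ?g" if "A \<in> sets borel" for A
      using gi that unfolding set_integrable_def by (intro integrable_mult_indicator) auto
    have \<Omega>d: "set_integrable \<nu> (?B - ?b) (\<lambda>y. \<Omega> (x - y))"
      by (rule set_integrable_subset[OF \<Omega>i[of "real (Suc i) * r / real n"]]) auto
    have z: "(LINT y:?B - ?b|\<nu>. \<Omega> (x - y)) = 0"
      using split[OF \<Omega>i] \<Omega>0 by simp
    have "norm (LINT y:?B - ?b|\<nu>. ?g y) = norm (LINT y:?B - ?b|\<nu>. ?g y - ?c *\<^sub>R \<Omega> (x - y))"
      using z \<Omega>d gB[of "?B - ?b"] by (subst set_integral_diff) auto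
    also have "\<dots> \<le> (LINT y|\<nu>. H / n * (L * r) * indicator (?B - ?b) y)"
      unfolding set_lebesgue_integral_def
    proof (rule Bochner_Integration.integral_norm_bound_integral)
      show "integrable \<nu> (\<lambda>y. indicator (?B - ?b) y *\<^sub>R (?g y - ?c *\<^sub>R \<Omega> (x - y)))"
        using set_integral_diff(1)[OF gB[of "?B - ?b"] set_integrable_scaleR_right[of ?c, OF \<Omega>d]]
        unfolding set_integrable_def by simp
      show "integrable \<nu> (\<lambda>y. H / n * (L * r) * indicator (?B - ?b) y)"
      proof (intro integrable_mult_right integrable_real_indicator)
        have "emeasure \<nu> (?B - ?b) \<le> emeasure \<nu> ?B" by (rule emeasure_mono) auto
        then show "emeasure \<nu> (?B - ?b) < \<infinity>" using bfin by (rule le_less_trans)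
      qed simp
      fix y
      show "norm (indicator (?B - ?b) y *\<^sub>R (?g y - ?c *\<^sub>R \<Omega> (x - y))) \<le> H / n * (L * r) * indicator (?B - ?b) y"
      proof (cases "y \<in> ?B - ?b")
        case True
        then have t: "real i * r / real n \<le> norm (x - y)" "norm (x - y) < real (Suc i) * r / real n"
          by (auto simp: dist_norm)
        have "real (Suc i) * r / real n \<le> real n * r / real n"
          using Suc.prems r n by (intro divide_right_mono mult_right_mono) auto
        then have tr: "norm (x - y) \<le> r" using t n by simp
        have "\<bar>h (norm (x - y) / r) - ?c\<bar> \<le> H * \<bar>norm (x - y) / r - real i / real n\<bar>"
          using lipschitz_onD[OF h, of "norm (x - y) / r" "real i / real n"] r by (simp add: dist_real_def)
        also have "\<dots> \<le> H * (1 / n)"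
        proof (rule mult_left_mono[OF _ H0])
          have "real i / real n \<le> norm (x - y) / r" "norm (x - y) / r < real (Suc i) / real n"
            using t r n by (simp_all add: field_simps)
          moreover have "real (Suc i) / real n = real i / real n + 1 / real n"
            by (simp add: add_divide_distrib)
          ultimately show "\<bar>norm (x - y) / r - real i / real n\<bar> \<le> 1 / n" by linarith
        qed
        finally have a: "\<bar>h (norm (x - y) / r) - ?c\<bar> \<le> H / n" by simp
        have b: "norm (\<Omega> (x - y)) \<le> L * r"
          using kernel_norm_le[OF \<Omega>, of "x - y"] mult_left_mono[OF tr L0] by linarith
        have "norm (?g y - ?c *\<^sub>R \<Omega> (x - y)) = \<bar>h (norm (x - y) / r) - ?c\<bar> * norm (\<Omega> (x - y))"
          by (simp add: radial_cut_def scaleR_diff_left[symmetric])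
        also have "\<dots> \<le> H / n * (L * r)"
          using a b H0 by (intro mult_mono) auto
        finally show ?thesis using True by simp
      qed simp
    qed
    also have "\<dots> = H / n * (L * r) * measure \<nu> (?B - ?b)"
      by simp
    also have "measure \<nu> (?B - ?b) = measure \<nu> ?B - measure \<nu> ?b"
      using bfin[of "real (Suc i) * r / real n"] bB by (intro measure_Diff) (auto simp: less_top)
    finally have "norm (LINT y:?B - ?b|\<nu>. ?g y) \<le> H / n * (L * r) * (measure \<nu> ?B - measure \<nu> ?b)" .
    moreover have "norm (LINT y:?b|\<nu>. ?g y) \<le> H / n * (L * r) * measure \<nu> ?b"
      using Suc by simp
    ultimately have "norm (LINT y:?b|\<nu>. ?g y) + norm (LINT y:?B - ?b|\<nu>. ?g y) \<le> H / n * (L * r) * measure \<nu> ?B"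
      by (simp add: algebra_simps)
    then show ?case
      using split[OF gB[of ?B]] norm_triangle_ineq[of "LINT y:?b|\<nu>. ?g y" "LINT y:?B - ?b|\<nu>. ?g y"]
      by auto
  qed
  have whole: "(LINT y:ball x r|\<nu>. ?g y) = (\<integral>y. ?g y \<partial>\<nu>)"
    unfolding set_lebesgue_integral_def
    using radial_cut_eq_0[where h=h and r=r and \<Omega>=\<Omega>, OF h1 r]
    by (intro Bochner_Integration.integral_cong) (auto simp: indicator_def dist_norm not_less)
  have "norm (\<integral>y. ?g y \<partial>\<nu>) \<le> H * (L * r) * measure \<nu> (ball x r) * inverse (real (Suc n))" for n
  proof -
    have "real (Suc n) * r / real (Suc n) = r" by (simp del: of_nat_Suc)
    then have "norm (LINT y:ball x r|\<nu>. ?g y) \<le> H / Suc n * (L * r) * measure \<nu> (ball x r)"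
      using step[of "Suc n" "Suc n"] by (simp only:)
    also have "H / Suc n * (L * r) * measure \<nu> (ball x r)
        = H * (L * r) * measure \<nu> (ball x r) * inverse (real (Suc n))"
      by (simp only: divide_inverse mult_ac)
    finally show ?thesis using whole by (simp only:)
  qed
  moreover have "(\<lambda>n. H * (L * r) * measure \<nu> (ball x r) * inverse (real (Suc n))) \<longlonglongrightarrow> H * (L * r) * measure \<nu> (ball x r) * 0"
    by (intro tendsto_intros LIMSEQ_inverse_real_of_nat)
  ultimately have "norm (\<integral>y. ?g y \<partial>\<nu>) \<le> 0"
    by (intro LIMSEQ_le_const[where X="\<lambda>n. H * (L * r) * measure \<nu> (ball x r) * inverse (real (Suc n))"]) auto
  then show ?thesis by simp
qed

text \<open>
  A component of the truncated kernel, divided by \<open>(2 H L + 1) r\<close>, is an admissible test function: it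
  is Lipschitz with constant \<open>1 / r\<close> and vanishes outside the closed \<open>r\<close>-ball, on which \<open>\<phi> = 1\<close>. Every
  competitor integrates it to zero, so only the integral against \<open>\<mu>\<close> survives, and it bounds the
  supremum from below for each competitor. The summand \<open>1\<close> keeps the
  divisor positive when \<open>H L = 0\<close>.
\<close>
lemma transport_number_ge_action:
  assumes \<mu>: "locally_finite_borel \<mu>" and \<phi>: "\<forall>t\<in>{0..3}. \<phi> t = 1"
    and h: "H-lipschitz_on {0..} h" and h1: "\<forall>t\<ge>1. h t = 0"
    and \<Omega>: "L-lipschitz_on UNIV \<Omega>" "\<Omega> 0 = 0" and r: "0 < r" and b: "b \<in> Basis"
  shows "ennreal (\<bar>(\<integral>y. radial_cut h \<Omega> r (x - y) \<partial>\<mu>) \<bullet> b\<bar> / ((2 * H * L + 1) * r powr (s + 1)))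
    \<le> transport_number \<phi> \<mu> \<Omega> s x r"
  unfolding transport_number_def
proof (rule INF_greatest)
  fix \<nu> assume \<nu>: "\<nu> \<in> symmetric_measures_at s \<Omega> x"
  then have \<nu>': "locally_finite_borel \<nu>" "x \<in> symmetric_points \<Omega> \<nu>"
    by (auto simp: symmetric_measures_at_def symmetric_measures_def growth_measures_def)
  have H0: "0 \<le> H" and L0: "0 \<le> L"
    using lipschitz_on_nonneg[OF h] lipschitz_on_nonneg[OF \<Omega>(1)] by auto
  define K where "K = 2 * H * L + 1"
  have K: "0 < K" "2 * H * L \<le> K" using H0 L0 by (auto simp: K_def intro: add_nonneg_pos)
  define f where "f = (\<lambda>y. (radial_cut h \<Omega> r (x - y) \<bullet> b) / (K * r))"
  have f0: "f y = 0" if "y \<notin> cball x r" for y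
    using that radial_cut_eq_0[where h=h and \<Omega>=\<Omega> and z="x - y", OF h1 r] by (simp add: f_def dist_norm)
  have flip: "(1 / r)-lipschitz_on UNIV f"
  proof (rule lipschitz_onI)
    fix y z :: 'a
    have "\<bar>radial_cut h \<Omega> r (x - y) \<bullet> b - radial_cut h \<Omega> r (x - z) \<bullet> b\<bar>
        \<le> norm (radial_cut h \<Omega> r (x - y) - radial_cut h \<Omega> r (x - z))"
      using Basis_le_norm[OF b] by (simp add: inner_diff_left[symmetric])
    also have "\<dots> \<le> 2 * H * L * dist y z"
      using lipschitz_onD[OF radial_cut_lipschitz[OF h h1 \<Omega> r], of "x - y" "x - z"]
      by (simp add: dist_norm norm_minus_commute)
    also have "\<dots> \<le> K * dist y z"
      by (rule mult_right_mono[OF K(2)]) simp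
    finally have "\<bar>radial_cut h \<Omega> r (x - y) \<bullet> b - radial_cut h \<Omega> r (x - z) \<bullet> b\<bar> / (K * r)
        \<le> K * dist y z / (K * r)"
      by (rule divide_right_mono) (use K r in simp)
    moreover have "\<bar>f y - f z\<bar> = \<bar>radial_cut h \<Omega> r (x - y) \<bullet> b - radial_cut h \<Omega> r (x - z) \<bullet> b\<bar> / (K * r)"
      using K r by (simp add: f_def diff_divide_distrib[symmetric] abs_mult)
    ultimately have "\<bar>f y - f z\<bar> \<le> K * dist y z / (K * r)" by (simp only:)
    also have "\<dots> = 1 / r * dist y z"
      using K r by simp
    finally show "dist (f y) (f z) \<le> 1 / r * dist y z"
      by (simp only: dist_real_def)
  qed (use r in simp)
  have fL: "f \<in> {f \<in> Lip0 (ball x (4 * r)). (1 / r)-lipschitz_on UNIV f}"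
  proof -
    have "cball x r \<subseteq> ball x (4 * r)" using r by auto
    then show ?thesis
      using flip f0 by (auto simp: Lip0_def intro!: exI[of _ "cball x r"])
  qed
  have \<phi>f: "\<phi> (norm (y - x) / r) * f y = f y" for y
  proof (cases "y \<in> cball x r")
    case True
    then have "norm (y - x) \<le> r" by (simp add: dist_norm norm_minus_commute)
    then have "\<phi> (norm (y - x) / r) = 1" using r by (intro bspec[OF \<phi>]) (simp add: pos_divide_le_eq)
    then show ?thesis by simp
  qed (simp add: f0)
  have int: "(\<integral>y. \<phi> (norm (y - x) / r) * f y \<partial>M) = ((\<integral>y. radial_cut h \<Omega> r (x - y) \<partial>M) \<bullet> b) / (K * r)"
    if "locally_finite_borel M" for M
  proof -
    have "(\<integral>y. \<phi> (norm (y - x) / r) * f y \<partial>M) = (\<integral>y. radial_cut h \<Omega> r (x - y) \<bullet> b \<partial>M) / (K * r)"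
      by (simp add: \<phi>f) (simp add: f_def)
    also have "(\<integral>y. radial_cut h \<Omega> r (x - y) \<bullet> b \<partial>M) = (\<integral>y. radial_cut h \<Omega> r (x - y) \<partial>M) \<bullet> b"
      by (rule integral_inner_left) (rule radial_cut_integrable[OF that h h1 \<Omega> r])
    finally show ?thesis .
  qed
  have zero: "(\<integral>y. radial_cut h \<Omega> r (x - y) \<partial>\<nu>) = 0"
    by (rule symmetric_point_radial_integral[OF \<nu>' h h1 \<Omega> r])
  have "ennreal (\<bar>(\<integral>y. radial_cut h \<Omega> r (x - y) \<partial>\<mu>) \<bullet> b\<bar> / (K * r powr (s + 1)))
      = ennreal \<bar>1 / r powr s *
            ((\<integral>y. \<phi> (norm (y - x) / r) * f y \<partial>\<mu>)
             - normalizing_const \<phi> \<mu> \<nu> x r * (\<integral>y. \<phi> (norm (y - x) / r) * f y \<partial>\<nu>))\<bar>"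
    unfolding int[OF \<mu>] int[OF \<nu>'(1)] zero
    using K r by (simp add: powr_add abs_mult mult_ac)
  also have "\<dots> \<le> (SUP f\<in>{f \<in> Lip0 (ball x (4 * r)). (1 / r)-lipschitz_on UNIV f}.
      ennreal \<bar>1 / r powr s *
            ((\<integral>y. \<phi> (norm (y - x) / r) * f y \<partial>\<mu>)
             - normalizing_const \<phi> \<mu> \<nu> x r * (\<integral>y. \<phi> (norm (y - x) / r) * f y \<partial>\<nu>))\<bar>)"
    by (rule SUP_upper[OF fL])
  finally show "ennreal (\<bar>(\<integral>y. radial_cut h \<Omega> r (x - y) \<partial>\<mu>) \<bullet> b\<bar> / ((2 * H * L + 1) * r powr (s + 1)))
    \<le> \<dots>" by (simp add: K_def)
qed

lemma transport_vanishing_imp_action_vanishing: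
  assumes \<mu>: "locally_finite_borel \<mu>" and \<phi>: "\<forall>t\<in>{0..3}. \<phi> t = 1"
    and h: "H-lipschitz_on {0..} h" and h1: "\<forall>t\<ge>1. h t = 0"
    and \<Omega>: "L-lipschitz_on UNIV \<Omega>" "\<Omega> 0 = 0"
    and lim: "((\<lambda>r. transport_number \<phi> \<mu> \<Omega> s x r) \<longlongrightarrow> 0) (at_right 0)"
  shows "((\<lambda>r. (1 / r powr (s + 1)) *\<^sub>R (\<integral>y. radial_cut h \<Omega> r (x - y) \<partial>\<mu>)) \<longlongrightarrow> 0) (at_right 0)"
proof (subst tendsto_componentwise_iff, rule ballI)
  fix b :: 'b assume b: "b \<in> Basis"
  define K where "K = 2 * H * L + 1"
  have K: "0 < K"
    using lipschitz_on_nonneg[OF h] lipschitz_on_nonneg[OF \<Omega>(1)] by (auto simp: K_def intro: add_nonneg_pos)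
  let ?I = "\<lambda>r. (\<integral>y. radial_cut h \<Omega> r (x - y) \<partial>\<mu>)"
  have "((\<lambda>r. ((1 / r powr (s + 1)) *\<^sub>R ?I r) \<bullet> b) \<longlongrightarrow> 0) (at_right 0)"
  proof (rule tendstoI)
    fix e :: real assume e: "0 < e"
    have "\<forall>\<^sub>F r in at_right 0. transport_number \<phi> \<mu> \<Omega> s x r < ennreal (e / K)"
      by (rule order_tendstoD(2)[OF lim]) (use e K in simp)
    moreover have "\<forall>\<^sub>F r in at_right 0. 0 < (r::real)"
      by (rule eventually_at_right_less)
    ultimately show "\<forall>\<^sub>F r in at_right 0. dist (((1 / r powr (s + 1)) *\<^sub>R ?I r) \<bullet> b) 0 < e"
    proof eventually_elim
      case (elim r)
      have "ennreal (\<bar>?I r \<bullet> b\<bar> / (K * r powr (s + 1))) < ennreal (e / K)"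
        using transport_number_ge_action[where \<phi>=\<phi> and x=x and s=s, OF \<mu> \<phi> h h1 \<Omega> elim(2) b] elim(1)
        unfolding K_def by (rule le_less_trans)
      then have "\<bar>?I r \<bullet> b\<bar> / (K * r powr (s + 1)) < e / K"
        using e K by (subst (asm) ennreal_less_iff) auto
      then show ?case using K elim(2) by (simp add: field_simps abs_mult)
    qed
  qed
  then show "((\<lambda>r. ((1 / r powr (s + 1)) *\<^sub>R ?I r) \<bullet> b) \<longlongrightarrow> 0 \<bullet> b) (at_right 0)" by simp
qed

section \<open>Compact sets on which growth and action are uniform\<close>

text \<open>
  Continuity from below along concentric balls. It makes growth conditions closed, and it passes
  growth bounds on to vague limits.
\<close>
lemma ball_lower_semicontinuous:
  fixes x :: "'a::metric_space"
  assumes "sets \<mu> = sets borel" "a < emeasure \<mu> (ball x r)"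
  shows "\<exists>t<r. a < emeasure \<mu> (ball x t)"
proof -
  let ?B = "\<lambda>n. ball x (r - inverse (real (Suc n)))"
  have "(\<Union>n. ?B n) = ball x r"
  proof
    show "ball x r \<subseteq> (\<Union>n. ?B n)"
    proof
      fix y assume "y \<in> ball x r"
      then obtain n where "inverse (real (Suc n)) < r - dist x y"
        using reals_Archimedean[of "r - dist x y"] by auto
      then show "y \<in> (\<Union>n. ?B n)" by (auto intro!: exI[of _ n])
    qed
    have "?B n \<subseteq> ball x r" for n by (rule subset_ball) simp
    then show "(\<Union>n. ?B n) \<subseteq> ball x r" by auto
  qed
  moreover have "(SUP n. emeasure \<mu> (?B n)) = emeasure \<mu> (\<Union>n. ?B n)"
  proof (rule SUP_emeasure_incseq)
    show "range ?B \<subseteq> sets \<mu>" unfolding assms(1) by (intro image_subsetI borel_open open_ball)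
    have "inverse (real (Suc (Suc n))) \<le> inverse (real (Suc n))" for n
      by (rule le_imp_inverse_le) simp_all
    then show "incseq ?B"
      by (intro incseq_SucI subset_ball diff_left_mono)
  qed
  ultimately have "a < (SUP n. emeasure \<mu> (?B n))"
    using assms(2) by (simp only:)
  then obtain n where "a < emeasure \<mu> (?B n)"
    unfolding less_SUP_iff by blast
  then show ?thesis by (intro exI[of _ "r - inverse (real (Suc n))"]) auto
qed

text \<open>
  The uncountably many radii cause no measurability problem: the condition is closed for each radius.
  Closedness also makes the sets produced by Egorov's argument compact.
\<close>
lemma closed_ball_measure_le:
  fixes \<mu> :: "'a::metric_space measure"
  assumes "sets \<mu> = sets borel"
  shows "closed {x. \<forall>r\<in>I. emeasure \<mu> (ball x r) \<le> a r}"
proof -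
  have "open {x. a r < emeasure \<mu> (ball x r)}" for r
  proof (rule openI)
    fix x assume "x \<in> {x. a r < emeasure \<mu> (ball x r)}"
    then obtain t where t: "t < r" "a r < emeasure \<mu> (ball x t)"
      using ball_lower_semicontinuous[OF assms] by blast
    have "a r < emeasure \<mu> (ball y r)" if "y \<in> ball x (r - t)" for y
    proof -
      have "dist x y + t < r" using that by simp
      then have "ball x t \<subseteq> ball y r"
        by (smt (verit) dist_commute dist_triangle mem_ball subsetI)
      then show ?thesis
        using t(2) emeasure_mono[of "ball x t" "ball y r" \<mu>] assms by auto
    qed
    then show "\<exists>T>0. ball x T \<subseteq> {x. a r < emeasure \<mu> (ball x r)}"
      using t(1) by (intro exI[of _ "r - t"]) auto
  qed
  then have "closed (\<Inter>r\<in>I. - {x. a r < emeasure \<mu> (ball x r)})"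
    by (intro closed_INT) (auto simp: closed_def)
  also have "(\<Inter>r\<in>I. - {x. a r < emeasure \<mu> (ball x r)}) = {x. \<forall>r\<in>I. emeasure \<mu> (ball x r) \<le> a r}"
    by (auto simp: not_less)
  finally show ?thesis .
qed

text \<open>
  Both integrands vanish outside \<open>ball x (r + \<rho>)\<close> and differ by the Lipschitz constant times the
  distance of the centres. This gives continuity of the action in the base point, and it lets the
  base points move along a vaguely convergent sequence of measures.
\<close>
lemma radial_integral_diff_le:
  assumes \<mu>: "locally_finite_borel \<mu>"
    and h: "H-lipschitz_on {0..} h" and h1: "\<forall>t\<ge>1. h t = 0"
    and \<Omega>: "L-lipschitz_on UNIV \<Omega>" "\<Omega> 0 = 0" and r: "0 < r" and xx: "dist x x' < \<rho>"
  shows "norm ((\<integral>y. radial_cut h \<Omega> r (x - y) \<partial>\<mu>) - (\<integral>y. radial_cut h \<Omega> r (x' - y) \<partial>\<mu>))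
    \<le> 2 * H * L * dist x x' * measure \<mu> (ball x (r + \<rho>))"
proof -
  have [simp]: "sets \<mu> = sets borel" using locally_finite_borelD[OF \<mu>] by auto
  have i: "integrable \<mu> (\<lambda>y. radial_cut h \<Omega> r (x - y))" for x
    by (rule radial_cut_integrable[OF \<mu> h h1 \<Omega> r])
  have "norm ((\<integral>y. radial_cut h \<Omega> r (x - y) \<partial>\<mu>) - (\<integral>y. radial_cut h \<Omega> r (x' - y) \<partial>\<mu>))
      = norm (\<integral>y. radial_cut h \<Omega> r (x - y) - radial_cut h \<Omega> r (x' - y) \<partial>\<mu>)"
    using i by simp
  also have "\<dots> \<le> (\<integral>y. 2 * H * L * dist x x' * indicator (ball x (r + \<rho>)) y \<partial>\<mu>)"
  proof (rule Bochner_Integration.integral_norm_bound_integral)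
    show "integrable \<mu> (\<lambda>y. 2 * H * L * dist x x' * indicator (ball x (r + \<rho>)) y)"
      using locally_finite_borel_ball[OF \<mu>]
      by (intro integrable_mult_right integrable_real_indicator) auto
    fix y
    show "norm (radial_cut h \<Omega> r (x - y) - radial_cut h \<Omega> r (x' - y))
        \<le> 2 * H * L * dist x x' * indicator (ball x (r + \<rho>)) y"
    proof (cases "y \<in> ball x (r + \<rho>)")
      case True
      then show ?thesis
        using lipschitz_onD[OF radial_cut_lipschitz[OF h h1 \<Omega> r], of "x - y" "x' - y"]
        by (simp add: dist_norm)
    next
      case False
      then have "r + \<rho> \<le> dist x y" by simp
      then have "r \<le> norm (x - y)" "r \<le> norm (x' - y)"
        using xx dist_triangle[of x y x'] zero_le_dist[of x x'] unfolding dist_norm by linarith+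
      then show ?thesis
        using False radial_cut_eq_0[where h=h and \<Omega>=\<Omega>, OF h1 r] by simp
    qed
  qed (use i in simp)
  finally show ?thesis by simp
qed

lemma radial_integral_continuous:
  assumes \<mu>: "locally_finite_borel \<mu>"
    and h: "H-lipschitz_on {0..} h" and h1: "\<forall>t\<ge>1. h t = 0"
    and \<Omega>: "L-lipschitz_on UNIV \<Omega>" "\<Omega> 0 = 0" and r: "0 < r"
  shows "continuous_on UNIV (\<lambda>x. \<integral>y. radial_cut h \<Omega> r (x - y) \<partial>\<mu>)"
proof (rule continuous_at_imp_continuous_on, rule ballI)
  fix x :: 'a
  let ?I = "\<lambda>x. \<integral>y. radial_cut h \<Omega> r (x - y) \<partial>\<mu>"
  let ?c = "2 * H * L * measure \<mu> (ball x (r + 1))"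
  have "((\<lambda>x'. ?I x' - ?I x) \<longlongrightarrow> 0) (at x)"
  proof (rule Lim_null_comparison[where g="\<lambda>x'. ?c * dist x x'"])
    have "\<forall>\<^sub>F x' in at x. dist x' x < 1"
      by (auto simp: eventually_at intro: exI[of _ 1])
    then show "\<forall>\<^sub>F x' in at x. norm (?I x' - ?I x) \<le> ?c * dist x x'"
    proof eventually_elim
      case (elim x')
      then show ?case
        using radial_integral_diff_le[OF \<mu> h h1 \<Omega> r, of x x' 1]
        by (simp add: dist_commute norm_minus_commute mult_ac)
    qed
    have "((\<lambda>x'. ?c * dist x x') \<longlongrightarrow> ?c * dist x x) (at x)"
      by (intro tendsto_intros)
    then show "((\<lambda>x'. ?c * dist x x') \<longlongrightarrow> 0) (at x)" by simp
  qed
  then show "isCont ?I x"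
    unfolding isCont_def by (rule LIM_zero_cancel)
qed

lemma closed_radial_integral_le:
  assumes \<mu>: "locally_finite_borel \<mu>"
    and h: "H-lipschitz_on {0..} h" and h1: "\<forall>t\<ge>1. h t = 0"
    and \<Omega>: "L-lipschitz_on UNIV \<Omega>" "\<Omega> 0 = 0" and I: "I \<subseteq> {0<..}"
  shows "closed {x. \<forall>r\<in>I. norm (\<integral>y. radial_cut h \<Omega> r (x - y) \<partial>\<mu>) \<le> c r}"
proof -
  have "closed {x. norm (\<integral>y. radial_cut h \<Omega> r (x - y) \<partial>\<mu>) \<le> c r}" if "r \<in> I" for r
    using that I
    by (intro closed_Collect_le continuous_intros radial_integral_continuous[OF \<mu> h h1 \<Omega>]) auto
  then have "closed (\<Inter>r\<in>I. {x. norm (\<integral>y. radial_cut h \<Omega> r (x - y) \<partial>\<mu>) \<le> c r})"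
    by blast
  also have "(\<Inter>r\<in>I. {x. norm (\<integral>y. radial_cut h \<Omega> r (x - y) \<partial>\<mu>) \<le> c r})
      = {x. \<forall>r\<in>I. norm (\<integral>y. radial_cut h \<Omega> r (x - y) \<partial>\<mu>) \<le> c r}" by auto
  finally show ?thesis .
qed

text \<open>
  Egorov's argument for countably many conditions at once: condition \<open>p\<close> is allowed to fail on a set
  of measure \<open>\<kappa> / 2 ^ (p + 1)\<close>.
\<close>
lemma egorov_family:
  fixes A :: "nat \<Rightarrow> nat \<Rightarrow> 'a set" and \<kappa> :: real
  assumes A: "\<And>p i. A p i \<in> sets M" and inc: "\<And>p. incseq (A p)"
    and B: "B \<in> sets M" "emeasure M B < \<infinity>"
    and ae: "AE x in M. \<forall>p. \<exists>i. x \<in> A p i" and \<kappa>: "0 < \<kappa>"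
  shows "\<exists>i. emeasure M (B - (\<Inter>p. A p (i p))) \<le> ennreal \<kappa>"
proof -
  have "\<exists>i. emeasure M (B - A p i) \<le> ennreal (\<kappa> * (1/2) ^ Suc p)" for p
  proof -
    have "(\<lambda>i. emeasure M (B - A p i)) \<longlonglongrightarrow> emeasure M (\<Inter>i. B - A p i)"
    proof (rule Lim_emeasure_decseq)
      show "decseq (\<lambda>i. B - A p i)"
        using inc[of p] by (auto simp: decseq_def incseq_def)
      show "emeasure M (B - A p i) \<noteq> \<infinity>" for i
        using le_less_trans[OF emeasure_mono[of "B - A p i" B M] B(2)] B(1) by auto
    qed (use A B in auto)
    moreover have "emeasure M (\<Inter>i. B - A p i) = 0"
    proof -
      have "AE x in M. x \<notin> (\<Inter>i. B - A p i)" using ae by eventually_elim auto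
      then show ?thesis
        using A B by (subst (asm) AE_iff_null_sets[symmetric]) (auto intro!: sets.countable_INT)
    qed
    ultimately have "(\<lambda>i. emeasure M (B - A p i)) \<longlonglongrightarrow> 0" by simp
    from order_tendstoD(2)[OF this, of "ennreal (\<kappa> * (1/2) ^ Suc p)"]
    have "\<forall>\<^sub>F i in sequentially. emeasure M (B - A p i) < ennreal (\<kappa> * (1/2) ^ Suc p)"
      using \<kappa> by simp
    then show ?thesis
      by (meson eventually_happens less_imp_le sequentially_bot)
  qed
  then obtain i where i: "\<And>p. emeasure M (B - A p (i p)) \<le> ennreal (\<kappa> * (1/2) ^ Suc p)"
    by metis
  have "emeasure M (B - (\<Inter>p. A p (i p))) = emeasure M (\<Union>p. B - A p (i p))"
    by (rule arg_cong[where f="emeasure M"]) auto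
  also have "\<dots> \<le> (\<Sum>p. emeasure M (B - A p (i p)))"
    by (rule emeasure_subadditive_countably) (use A B in auto)
  also have "\<dots> \<le> (\<Sum>p. ennreal (\<kappa> * (1/2) ^ Suc p))"
    by (intro suminf_le i) auto
  also have "\<dots> = ennreal (\<kappa> * 1)"
    using sums_mult[OF power_half_series, of \<kappa>] \<kappa> by (intro suminf_ennreal_eq) auto
  finally show ?thesis by auto
qed

text \<open>
  Conditions that hold from some index on, depending on the point, may be assumed to hold uniformly
  on a compact set. Balls of integer radius \<open>m\<close> with exceptional sets of measure \<open>1 / (q + 1)\<close> produce
  countably many compact sets that carry the whole measure.
\<close>
lemma AE_exhaust_by_compact:
  fixes A :: "nat \<Rightarrow> nat \<Rightarrow> 'a::euclidean_space set"
  assumes \<mu>: "locally_finite_borel \<mu>" and A: "\<And>p i. closed (A p i)" and inc: "\<And>p. incseq (A p)"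
    and ae: "AE x in \<mu>. \<forall>p. \<exists>i. x \<in> A p i"
    and Q: "\<And>F i. compact F \<Longrightarrow> F \<subseteq> (\<Inter>p. A p (i p)) \<Longrightarrow> AE x in \<mu>. x \<in> F \<longrightarrow> Q x"
  shows "AE x in \<mu>. Q x"
proof -
  have sets [simp]: "sets \<mu> = sets borel" and space [simp]: "space \<mu> = UNIV"
    using locally_finite_borelD[OF \<mu>] by auto
  let ?B = "\<lambda>m. cball (0::'a) (real m)"
  have "\<exists>i. emeasure \<mu> (?B m - (\<Inter>p. A p (i p))) \<le> ennreal (inverse (real (Suc q)))" for m q
    using locally_finite_borel_compact[OF \<mu> compact_cball]
    by (intro egorov_family inc ae) (auto simp: A)
  then obtain i where i: "\<And>m q. emeasure \<mu> (?B m - (\<Inter>p. A p (i m q p))) \<le> ennreal (inverse (real (Suc q)))"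
    by metis
  define F where "F m q = ?B m \<inter> (\<Inter>p. A p (i m q p))" for m q
  have Fc: "compact (F m q)" for m q
    unfolding F_def using A by (intro compact_Int_closed closed_INT) auto
  have "AE x in \<mu>. x \<in> F m q \<longrightarrow> Q x" for m q
    by (rule Q[OF Fc, of _ _ "i m q"]) (auto simp: F_def)
  then have 1: "AE x in \<mu>. \<forall>m q. x \<in> F m q \<longrightarrow> Q x"
    unfolding AE_all_countable by blast
  have "AE x in \<mu>. x \<notin> (\<Inter>q. ?B m - F m q)" for m
  proof -
    have Fb: "F m q \<in> sets borel" for q using Fc by (simp add: borel_compact)
    have le: "emeasure \<mu> (\<Inter>q. ?B m - F m q) \<le> ennreal (inverse (real (Suc q)))" for q
    proof -
      have "emeasure \<mu> (\<Inter>q. ?B m - F m q) \<le> emeasure \<mu> (?B m - (\<Inter>p. A p (i m q p)))"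
        using A by (intro emeasure_mono) (auto simp: F_def intro!: sets.Diff sets.countable_INT)
      also note i
      finally show ?thesis .
    qed
    have lim0: "(\<lambda>q. ennreal (inverse (real (Suc q)))) \<longlonglongrightarrow> ennreal 0"
      by (intro tendsto_ennrealI LIMSEQ_inverse_real_of_nat)
    have "emeasure \<mu> (\<Inter>q. ?B m - F m q) \<le> ennreal 0"
      by (rule LIMSEQ_le_const[OF lim0]) (use le in blast)
    then show ?thesis
      using Fb by (intro AE_not_in) (auto simp: null_sets_def intro!: sets.countable_INT)
  qed
  then have 2: "AE x in \<mu>. \<forall>m. x \<notin> (\<Inter>q. ?B m - F m q)"
    by (simp add: AE_all_countable)
  show ?thesis
    using 1 2
  proof eventually_elim
    case (elim x)
    obtain m :: nat where "norm x \<le> m" using real_arch_simple by blast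
    then have "x \<in> ?B m" by simp
    then show ?case using elim by blast
  qed
qed


section \<open>Density of the complement of a compact set\<close>

text \<open>
  As \<open>\<mu>\<close> need not be doubling, the mass outside \<open>F\<close> is compared with \<open>r\<^sup>s\<close> instead of
  \<open>\<mu> (ball x r)\<close>. A point of \<open>F\<close> at which the complement has upper density above \<open>t\<close> is the centre of
  arbitrarily small balls that carry mass at least \<open>t r\<^sup>s\<close> outside \<open>F\<close>. By Vitali's lemma, disjoint
  balls of this kind can be chosen whose fivefold enlargements cover all such points. The growth bound
  estimates the enlargements by multiples of \<open>r\<^sup>s\<close>, hence by the mass that the disjoint balls carry
  outside \<open>F\<close>, and that mass lies in a shrinking neighbourhood of \<open>F\<close> with \<open>F\<close> removed.
\<close>
lemma complement_density_zero:
  fixes F :: "'a::euclidean_space set"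
  assumes \<mu>: "locally_finite_borel \<mu>" and F: "compact F" and \<delta>: "0 < \<delta>" and C: "0 \<le> C"
    and growth: "\<And>x r. x \<in> F \<Longrightarrow> 0 < r \<Longrightarrow> r < \<delta> \<Longrightarrow> emeasure \<mu> (ball x r) \<le> ennreal (C * r powr s)"
  shows "AE x in \<mu>. x \<in> F \<longrightarrow>
    (\<forall>\<epsilon>>0. \<forall>\<^sub>F r in at_right 0. emeasure \<mu> (ball x r - F) \<le> ennreal (\<epsilon> * r powr s))"
proof (cases "F = {}")
  case True
  then show ?thesis by simp
next
  case False
  have sets [simp]: "sets \<mu> = sets borel" and space [simp]: "space \<mu> = UNIV"
    using locally_finite_borelD[OF \<mu>] by auto
  have Fb [simp]: "F \<in> sets borel" using F by (simp add: borel_compact)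
  define A where "A t = {x\<in>F. \<forall>d>0. \<exists>r\<in>{0<..<d}. ennreal (t * r powr s) < emeasure \<mu> (ball x r - F)}" for t
  define U where "U j = {y. infdist y F < inverse (real (Suc j))}" for j
  have Uo: "open (U j)" for j
    unfolding U_def by (intro open_Collect_less continuous_intros)
  have Ub [simp]: "U j \<in> sets borel" for j using Uo by simp
  have "(\<lambda>j. emeasure \<mu> (U j - F)) \<longlonglongrightarrow> emeasure \<mu> (\<Inter>j. U j - F)"
  proof (rule Lim_emeasure_decseq)
    have "inverse (real (Suc (Suc n))) \<le> inverse (real (Suc n))" for n
      by (rule le_imp_inverse_le) simp_all
    then have "U (Suc j) - F \<subseteq> U j - F" for j
      unfolding U_def by (auto intro: less_le_trans)
    then show "decseq (\<lambda>j. U j - F)" by (rule decseq_SucI)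
    show "emeasure \<mu> (U j - F) \<noteq> \<infinity>" for j
    proof -
      have "emeasure \<mu> (U j - F) \<le> emeasure \<mu> {x. infdist x F \<le> 1}"
      proof (rule emeasure_mono)
        have "inverse (real (Suc j)) \<le> 1" by (simp add: field_simps)
        then show "U j - F \<subseteq> {x. infdist x F \<le> 1}" by (auto simp: U_def)
      qed (auto intro!: borel_closed closed_Collect_le continuous_intros)
      also have "\<dots> < \<infinity>"
        by (rule locally_finite_borel_compact[OF \<mu> compact_infdist_le[OF False F]]) simp
      finally show ?thesis by simp
    qed
  qed auto
  moreover have "(\<Inter>j. U j - F) = {}"
  proof -
    have "y \<in> F" if y: "\<And>j. y \<in> U j" for y
    proof (rule ccontr)
      assume "y \<notin> F"
      then have "0 < infdist y F"
        using False F by (simp add: compact_imp_closed infdist_pos_not_in_closed)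
      then obtain j where "inverse (real (Suc j)) < infdist y F" using reals_Archimedean by blast
      then show False using y[of j] by (simp add: U_def)
    qed
    then show ?thesis by auto
  qed
  ultimately have \<sigma>: "(\<lambda>j. emeasure \<mu> (U j - F)) \<longlonglongrightarrow> 0"
    by (simp only: emeasure_empty)
  \<comment> \<open>\<open>A t\<close> itself need not be measurable, so it is enclosed in open sets of small measure.\<close>
  have cover: "\<exists>W. open W \<and> A t \<subseteq> W \<and> emeasure \<mu> W \<le> ennreal (C * 5 powr s / t) * emeasure \<mu> (U j - F)"
    if t: "0 < t" for t j
  proof -
    have "\<exists>r. 0 < r \<and> r < min (inverse (real (Suc j))) (\<delta> / 5) \<and> ennreal (t * r powr s) < emeasure \<mu> (ball x r - F)"
      if x: "x \<in> A t" for x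
    proof -
      have "0 < min (inverse (real (Suc j))) (\<delta> / 5)" using \<delta> by simp
      then obtain r where "r \<in> {0<..<min (inverse (real (Suc j))) (\<delta> / 5)}"
        "ennreal (t * r powr s) < emeasure \<mu> (ball x r - F)"
        using x unfolding A_def by blast
      then show ?thesis by auto
    qed
    then obtain \<rho> where \<rho>: "\<And>x. x \<in> A t \<Longrightarrow> 0 < \<rho> x" "\<And>x. x \<in> A t \<Longrightarrow> \<rho> x < inverse (real (Suc j))"
        "\<And>x. x \<in> A t \<Longrightarrow> \<rho> x < \<delta> / 5"
        "\<And>x. x \<in> A t \<Longrightarrow> ennreal (t * \<rho> x powr s) < emeasure \<mu> (ball x (\<rho> x) - F)"
      by (metis min_less_iff_conj)
    have "A t \<subseteq> (\<Union>x\<in>A t. ball x (\<rho> x))" using \<rho>(1) by force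
    then obtain I where I: "countable I" "I \<subseteq> A t"
       "pairwise (\<lambda>i j. disjnt (ball i (\<rho> i)) (ball j (\<rho> j))) I" "A t \<subseteq> (\<Union>i\<in>I. ball i (5 * \<rho> i))"
      by (rule Vitali_covering_lemma_balls[where a="\<lambda>x. x" and r=\<rho> and K="A t" and B="\<delta> / 5"])
        (use \<rho> in \<open>auto intro: less_imp_le\<close>)
    let ?W = "\<Union>i\<in>I. ball i (5 * \<rho> i)"
    have Wb [simp]: "?W \<in> sets borel" by (intro borel_open open_UN) auto
    have single: "emeasure \<mu> (ball i (5 * \<rho> i)) \<le> ennreal (C * 5 powr s / t) * emeasure \<mu> (ball i (\<rho> i) - F)"
      if i: "i \<in> I" for i
    proof -
      have iA: "i \<in> A t" "i \<in> F" using i I(2) by (auto simp: A_def)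
      have "emeasure \<mu> (ball i (5 * \<rho> i)) \<le> ennreal (C * (5 * \<rho> i) powr s)"
        using \<rho>[OF iA(1)] by (intro growth[OF iA(2)]) auto
      also have "C * (5 * \<rho> i) powr s = (C * 5 powr s / t) * (t * \<rho> i powr s)"
        using t \<rho>(1)[OF iA(1)] by (simp add: powr_mult)
      also have "ennreal \<dots> = ennreal (C * 5 powr s / t) * ennreal (t * \<rho> i powr s)"
        using t C by (intro ennreal_mult) auto
      also have "\<dots> \<le> ennreal (C * 5 powr s / t) * emeasure \<mu> (ball i (\<rho> i) - F)"
        using \<rho>(4)[OF iA(1)] by (intro mult_left_mono) auto
      finally show ?thesis .
    qed
    have "emeasure \<mu> ?W \<le> (\<integral>\<^sup>+i. emeasure \<mu> (ball i (5 * \<rho> i)) \<partial>count_space I)"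
    proof -
      have "emeasure \<mu> ?W = (\<integral>\<^sup>+x. indicator ?W x \<partial>\<mu>)"
        by (subst nn_integral_indicator) auto
      also have "\<dots> \<le> (\<integral>\<^sup>+x. (\<integral>\<^sup>+i. indicator (ball i (5 * \<rho> i)) x \<partial>count_space I) \<partial>\<mu>)"
      proof (rule nn_integral_mono)
        fix x
        show "indicator ?W x \<le> (\<integral>\<^sup>+i. indicator (ball i (5 * \<rho> i)) x \<partial>count_space I :: ennreal)"
        proof (cases "x \<in> ?W")
          case True
          then obtain k where k: "k \<in> I" "x \<in> ball k (5 * \<rho> k)" by auto
          have "(1::ennreal) = (\<integral>\<^sup>+i. indicator {k} i \<partial>count_space I)"
            using k by (subst nn_integral_indicator) (auto simp: emeasure_count_space_finite)
          also have "\<dots> \<le> (\<integral>\<^sup>+i. indicator (ball i (5 * \<rho> i)) x \<partial>count_space I)"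
            using k by (intro nn_integral_mono) (auto simp: indicator_def)
          finally show ?thesis using True by simp
        qed simp
      qed
      also have "\<dots> = (\<integral>\<^sup>+i. (\<integral>\<^sup>+x. indicator (ball i (5 * \<rho> i)) x \<partial>\<mu>) \<partial>count_space I)"
        by (rule nn_integral_count_space_nn_integral[OF I(1)], rule borel_measurable_indicator) simp
      finally show ?thesis by simp
    qed
    also have "\<dots> \<le> (\<integral>\<^sup>+i. ennreal (C * 5 powr s / t) * emeasure \<mu> (ball i (\<rho> i) - F) \<partial>count_space I)"
      by (rule nn_integral_mono) (use single in auto)
    also have "\<dots> = ennreal (C * 5 powr s / t) * (\<integral>\<^sup>+i. emeasure \<mu> (ball i (\<rho> i) - F) \<partial>count_space I)"
      by (rule nn_integral_cmult) simp
    also have "(\<integral>\<^sup>+i. emeasure \<mu> (ball i (\<rho> i) - F) \<partial>count_space I) = emeasure \<mu> (\<Union>i\<in>I. ball i (\<rho> i) - F)"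
      using I(1,3) by (intro emeasure_UN_countable[symmetric])
         (auto simp: disjoint_family_on_def pairwise_def disjnt_def)
    also have "\<dots> \<le> emeasure \<mu> (U j - F)"
    proof (rule emeasure_mono)
      have "y \<in> U j" if "i \<in> I" "y \<in> ball i (\<rho> i)" for i y
      proof -
        have "i \<in> A t" "i \<in> F" using that I(2) by (auto simp: A_def)
        then have "infdist y F \<le> dist y i" "dist i y < inverse (real (Suc j))"
          using that \<rho>(2)[of i] infdist_le[of i F y] by auto
        then show ?thesis by (simp add: U_def dist_commute)
      qed
      then show "(\<Union>i\<in>I. ball i (\<rho> i) - F) \<subseteq> U j - F" by blast
    qed auto
    finally have "emeasure \<mu> ?W \<le> ennreal (C * 5 powr s / t) * emeasure \<mu> (U j - F)"
      by (simp add: mult_left_mono)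
    then show ?thesis using I(4) by (intro exI[of _ ?W]) auto
  qed
  have null: "\<exists>N\<in>null_sets \<mu>. A t \<subseteq> N" if t: "0 < t" for t
  proof -
    obtain W where W: "\<And>j. open (W j)" "\<And>j. A t \<subseteq> W j"
      "\<And>j. emeasure \<mu> (W j) \<le> ennreal (C * 5 powr s / t) * emeasure \<mu> (U j - F)"
      using cover[OF t] by metis
    have Wb: "(\<Inter>j. W j) \<in> sets borel" using W(1) by (auto intro!: sets.countable_INT)
    have "emeasure \<mu> (\<Inter>j. W j) \<le> ennreal (C * 5 powr s / t) * emeasure \<mu> (U j - F)" for j
      using W(1,3)[of j] by (intro order_trans[OF emeasure_mono W(3)]) auto
    moreover have "(\<lambda>j. ennreal (C * 5 powr s / t) * emeasure \<mu> (U j - F)) \<longlonglongrightarrow> ennreal (C * 5 powr s / t) * 0"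
      by (intro ennreal_tendsto_cmult \<sigma>) simp
    ultimately have "emeasure \<mu> (\<Inter>j. W j) \<le> ennreal (C * 5 powr s / t) * 0"
      by (intro LIMSEQ_le_const) auto
    then show ?thesis using W(2) Wb by (intro bexI[of _ "\<Inter>j. W j"]) (auto simp: null_sets_def)
  qed
  have "AE x in \<mu>. x \<notin> A (inverse (real (Suc n)))" for n
  proof -
    have "0 < inverse (real (Suc n))" by simp
    from null[OF this] obtain N where "N \<in> null_sets \<mu>" "A (inverse (real (Suc n))) \<subseteq> N" by blast
    then show ?thesis by (intro AE_I'[of N]) auto
  qed
  then have "AE x in \<mu>. \<forall>n. x \<notin> A (inverse (real (Suc n)))" by (simp add: AE_all_countable)
  then show ?thesis
  proof eventually_elim
    case (elim x)
    show ?case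
    proof (intro impI allI)
      fix \<epsilon> :: real assume x: "x \<in> F" and \<epsilon>: "0 < \<epsilon>"
      obtain n where n: "inverse (real (Suc n)) < \<epsilon>" using reals_Archimedean[OF \<epsilon>] by blast
      obtain d where d: "0 < d"
        "\<And>r. 0 < r \<Longrightarrow> r < d \<Longrightarrow> emeasure \<mu> (ball x r - F) \<le> ennreal (inverse (real (Suc n)) * r powr s)"
        using elim[rule_format, of n] x unfolding A_def by (auto simp: not_less)
      have "emeasure \<mu> (ball x r - F) \<le> ennreal (\<epsilon> * r powr s)" if "0 < r" "r < d" for r
      proof -
        have "inverse (real (Suc n)) * r powr s \<le> \<epsilon> * r powr s"
          using n by (intro mult_right_mono) auto
        then show ?thesis using d(2)[OF that] by (meson ennreal_leI order_trans)
      qed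
      then show "\<forall>\<^sub>F r in at_right 0. emeasure \<mu> (ball x r - F) \<le> ennreal (\<epsilon> * r powr s)"
        unfolding eventually_at_right_field using d(1) by blast
    qed
  qed
qed

section \<open>Weak compactness on a compact convex set\<close>

text \<open>
  At the first index \<open>k\<close> where the memberships differ the sums differ by \<open>(1/3) ^ k\<close>, and all later
  terms together amount to at most half of that.
\<close>
lemma ternary_code_separates:
  fixes B :: "nat \<Rightarrow> 'a set"
  defines "e \<equiv> \<lambda>x. \<Sum>i. (1/3) ^ i * indicat_real (B i) x"
  assumes "\<bar>e x - e y\<bar> < 1/2 * (1/3) ^ n" "i \<le> n"
  shows "x \<in> B i \<longleftrightarrow> y \<in> B i"
proof (rule ccontr)
  assume ne: "\<not> (x \<in> B i \<longleftrightarrow> y \<in> B i)"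
  define k where "k = (LEAST i. \<not> (x \<in> B i \<longleftrightarrow> y \<in> B i))"
  have k: "\<not> (x \<in> B k \<longleftrightarrow> y \<in> B k)" unfolding k_def using ne by (rule LeastI)
  have kn: "k \<le> n" using Least_le[of "\<lambda>i. \<not> (x \<in> B i \<longleftrightarrow> y \<in> B i)", OF ne] assms(3) by (simp add: k_def)
  have less: "x \<in> B j \<longleftrightarrow> y \<in> B j" if "j < k" for j
    using not_less_Least[of j "\<lambda>i. \<not> (x \<in> B i \<longleftrightarrow> y \<in> B i)"] that by (simp add: k_def)
  define d :: "nat \<Rightarrow> real" where "d j = (1/3) ^ j * indicator (B j) x - (1/3) ^ j * indicator (B j) y" for j
  have geo: "summable (\<lambda>j. (1/3::real) ^ j)" by (rule summable_geometric) simp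
  have sm: "summable (\<lambda>i. (1/3) ^ i * indicat_real (B i) z)" for z
    by (rule summable_comparison_test'[OF geo, of 0]) (auto simp: indicator_def)
  have dle: "\<bar>d j\<bar> \<le> (1/3) ^ j" for j by (auto simp: d_def indicator_def)
  have ds: "summable d" unfolding d_def by (intro summable_diff sm)
  have "e x - e y = (\<Sum>j. d j)"
    unfolding e_def d_def by (rule suminf_diff[OF sm sm])
  also have "\<dots> = (\<Sum>j. d (j + Suc k)) + (\<Sum>j<Suc k. d j)"
    by (rule suminf_split_initial_segment[OF ds])
  also have "(\<Sum>j<Suc k. d j) = d k"
    using less by (simp add: d_def indicator_def sum.neutral)
  finally have e: "e x - e y = (\<Sum>j. d (j + Suc k)) + d k" .
  have gs: "(\<lambda>j. (1/3::real) ^ (j + Suc k)) sums ((1/3) ^ Suc k * (1 / (1 - 1/3)))"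
    using sums_mult[OF geometric_sums[of "1/3::real"], of "(1/3) ^ Suc k"]
    by (simp add: power_add mult_ac)
  have "\<bar>\<Sum>j. d (j + Suc k)\<bar> \<le> (\<Sum>j. (1/3) ^ (j + Suc k))"
  proof (rule order_trans[OF summable_rabs suminf_le])
    show "summable (\<lambda>j. \<bar>d (j + Suc k)\<bar>)"
      by (rule summable_comparison_test'[OF sums_summable[OF gs], of 0]) (use dle[of "_ + Suc k"] in auto)
    then show "summable (\<lambda>j. \<bar>d (j + Suc k)\<bar>)" .
    show "summable (\<lambda>j. (1/3::real) ^ (j + Suc k))" by (rule sums_summable[OF gs])
    show "\<bar>d (j + Suc k)\<bar> \<le> (1/3) ^ (j + Suc k)" for j by (rule dle)
  qed
  also have "\<dots> = 1/2 * (1/3) ^ k"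
    using sums_unique[OF gs] by simp
  finally have tail: "\<bar>\<Sum>j. d (j + Suc k)\<bar> \<le> 1/2 * (1/3) ^ k" .
  have "\<bar>d k\<bar> = (1/3) ^ k"
    using k by (auto simp: d_def indicator_def)
  then have "1/2 * (1/3) ^ k \<le> \<bar>e x - e y\<bar>"
    using tail e by linarith
  moreover have "(1/3::real) ^ n \<le> (1/3) ^ k"
    using kn by (intro power_decreasing) auto
  ultimately show False using assms(2) by simp
qed

text \<open>
  The code records which members of a countable base contain a point. It is Borel, though not
  continuous. Decoding is uniformly continuous: by compactness finitely many base sets of small
  diameter cover \<open>K\<close>, and points with sufficiently close codes belong to the same ones among these.
  Hence the decoding map extends to the closure of the range of the code, and from there to the whole
  line by Dugundji's theorem, which is where convexity of \<open>K\<close> enters.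
\<close>
lemma compact_real_code:
  fixes K :: "'a::euclidean_space set"
  assumes K: "compact K" "convex K" "K \<noteq> {}"
  obtains e :: "'a \<Rightarrow> real" and g :: "real \<Rightarrow> 'a"
  where "e \<in> borel_measurable borel" "\<And>z. e z \<in> {0..2}" "continuous_on UNIV g"
    "\<And>z. z \<in> K \<Longrightarrow> g (e z) = z"
proof -
  obtain \<B> :: "'a set set" where \<B>: "countable \<B>" "topological_basis \<B>"
    using ex_countable_basis by blast
  define B where "B = from_nat_into \<B>"
  have ne: "\<B> \<noteq> {}"
    using topological_basisE[OF \<B>(2) open_UNIV UNIV_I] by blast
  have Bo: "open (B i)" for i
    using from_nat_into[OF ne, of i] topological_basis_open[OF \<B>(2)] by (simp add: B_def)
  have Bb: "\<exists>i. x \<in> B i \<and> B i \<subseteq> S" if S: "open S" "x \<in> S" for x S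
  proof -
    obtain b where b: "b \<in> \<B>" "x \<in> b" "b \<subseteq> S" by (rule topological_basisE[OF \<B>(2) S])
    then show ?thesis
      using from_nat_into_surj[OF \<B>(1) b(1)] by (auto simp: B_def)
  qed
  define e where "e x = (\<Sum>i. (1/3) ^ i * indicat_real (B i) x)" for x
  have geo: "(\<lambda>j. (1/3::real) ^ j) sums (3/2)" using geometric_sums[of "1/3::real"] by simp
  have sm: "summable (\<lambda>i. (1/3) ^ i * indicat_real (B i) z)" for z
    by (rule summable_comparison_test'[OF sums_summable[OF geo], of 0]) (auto simp: indicator_def)
  have em: "e \<in> borel_measurable borel"
    unfolding e_def using Bo by (intro borel_measurable_suminf borel_measurable_times borel_measurable_const borel_measurable_indicator) auto
  have e02: "e z \<in> {0..2}" for z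
  proof -
    have "e z \<le> (\<Sum>j. (1/3::real) ^ j)"
      unfolding e_def by (intro suminf_le sm sums_summable[OF geo]) (auto simp: indicator_def)
    also have "\<dots> = 3/2" using sums_unique[OF geo] by simp
    finally show ?thesis
      using suminf_nonneg[OF sm] by (simp add: e_def)
  qed
  have sep: "x \<in> B i \<longleftrightarrow> y \<in> B i" if "\<bar>e x - e y\<bar> < 1/2 * (1/3) ^ n" "i \<le> n" for x y i n
    using ternary_code_separates[of B x y n i] that by (simp add: e_def)
  have unif: "\<exists>\<delta>>0. \<forall>x\<in>K. \<forall>y\<in>K. \<bar>e x - e y\<bar> < \<delta> \<longrightarrow> dist x y < \<epsilon>" if \<epsilon>: "0 < \<epsilon>" for \<epsilon>
  proof -
    have "\<exists>i. x \<in> B i \<and> B i \<subseteq> ball x (\<epsilon>/2)" for x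
      by (rule Bb) (use \<epsilon> in auto)
    then obtain i where i: "\<And>x. x \<in> B (i x)" "\<And>x. B (i x) \<subseteq> ball x (\<epsilon>/2)" by metis
    have "K \<subseteq> (\<Union>x\<in>K. B (i x))" using i(1) by auto
    from compactE_image[OF K(1) _ this] obtain T where T: "T \<subseteq> K" "finite T" "K \<subseteq> (\<Union>x\<in>T. B (i x))"
      using Bo by metis
    define n where "n = Max (insert 0 (i ` T))"
    have n: "i t \<le> n" if "t \<in> T" for t
      unfolding n_def using T(2) that by (intro Max_ge) auto
    have "dist x y < \<epsilon>" if xy: "x \<in> K" "y \<in> K" "\<bar>e x - e y\<bar> < 1/2 * (1/3) ^ n" for x y
    proof -
      obtain t where t: "t \<in> T" "x \<in> B (i t)" using T(3) xy(1) by auto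
      have "y \<in> B (i t)" using sep[OF xy(3) n[OF t(1)]] t(2) by simp
      then have "dist t x < \<epsilon>/2" "dist t y < \<epsilon>/2" using t(2) i(2)[of t] by auto
      then show ?thesis using dist_triangle3[of x y t] by linarith
    qed
    then show ?thesis by (intro exI[of _ "1/2 * (1/3) ^ n"]) auto
  qed
  have inj: "inj_on e K"
  proof (rule inj_onI)
    fix x y assume xy: "x \<in> K" "y \<in> K" "e x = e y"
    show "x = y"
    proof (rule ccontr)
      assume "x \<noteq> y"
      then have "0 < dist x y" by simp
      from unif[OF this] xy show False by force
    qed
  qed
  define \<psi> where "\<psi> = inv_into K e"
  have \<psi>: "\<psi> (e x) = x" if "x \<in> K" for x
    unfolding \<psi>_def using inv_into_f_f[OF inj that] .
  have uc: "uniformly_continuous_on (e ` K) \<psi>"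
    unfolding uniformly_continuous_on_def
  proof (intro allI impI)
    fix \<epsilon> :: real assume "0 < \<epsilon>"
    from unif[OF this] obtain \<delta> where "0 < \<delta>" "\<And>x y. x \<in> K \<Longrightarrow> y \<in> K \<Longrightarrow> \<bar>e x - e y\<bar> < \<delta> \<Longrightarrow> dist x y < \<epsilon>"
      by blast
    then show "\<exists>d>0. \<forall>x\<in>e ` K. \<forall>x'\<in>e ` K. dist x' x < d \<longrightarrow> dist (\<psi> x') (\<psi> x) < \<epsilon>"
      by (intro exI[of _ \<delta>]) (auto simp: \<psi> dist_real_def)
  qed
  obtain g1 where g1: "uniformly_continuous_on (closure (e ` K)) g1" "\<And>t. t \<in> e ` K \<Longrightarrow> \<psi> t = g1 t"
    by (rule uniformly_continuous_on_extension_on_closure[OF uc]) blast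
  have c1: "continuous_on (closure (e ` K)) g1"
    using g1(1) by (rule uniformly_continuous_imp_continuous)
  have im: "g1 ` closure (e ` K) \<subseteq> K"
  proof (rule image_closure_subset[OF c1])
    show "closed K" using K(1) by (rule compact_imp_closed)
    show "g1 ` (e ` K) \<subseteq> K" using g1(2) \<psi> by force
  qed
  obtain g where g: "continuous_on UNIV g" "\<And>t. t \<in> closure (e ` K) \<Longrightarrow> g t = g1 t"
    by (rule Dugundji[OF K(2,3) _ c1 im, of UNIV]) auto
  have ge: "g (e z) = z" if "z \<in> K" for z
  proof -
    have "e z \<in> e ` K" using that by (rule imageI)
    then have "g (e z) = \<psi> (e z)"
      using g(2)[of "e z"] g1(2)[of "e z"] closure_subset[of "e ` K"] by (metis subsetD)
    then show ?thesis using \<psi>[OF that] by (rule trans)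
  qed
  show ?thesis by (rule that[OF em e02 g(1) ge])
qed

text \<open>
  The codes transport the measures to a bounded interval of the real line, where they are tight and
  Helly's selection theorem applies; the limit is transported back by the continuous decoding map.
\<close>
lemma weak_sequential_compactness:
  fixes K :: "'a::euclidean_space set" and P :: "nat \<Rightarrow> 'a measure"
  assumes K: "compact K" "convex K" "K \<noteq> {}"
    and P: "\<And>n. prob_space (P n)" "\<And>n. sets (P n) = sets borel" "\<And>n. AE z in P n. z \<in> K"
  obtains r Q where "strict_mono (r :: nat \<Rightarrow> nat)" "prob_space Q" "sets Q = sets borel"
    "\<And>f :: 'a \<Rightarrow> real. continuous_on UNIV f \<Longrightarrow> bounded (range f) \<Longrightarrow>
      (\<lambda>n. \<integral>z. f z \<partial>P (r n)) \<longlonglongrightarrow> (\<integral>z. f z \<partial>Q)"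
proof -
  obtain e :: "'a \<Rightarrow> real" and g where e: "e \<in> borel_measurable borel" "\<And>z. e z \<in> {0..2}"
    and g: "continuous_on UNIV g" "\<And>z. z \<in> K \<Longrightarrow> g (e z) = z"
    using compact_real_code[OF K] by metis
  have gm: "g \<in> borel_measurable borel" using g(1) by (rule borel_measurable_continuous_onI)
  have eP: "e \<in> measurable (P n) borel" for n
    using e(1) P(2) measurable_cong_sets by blast
  define D where "D n = distr (P n) borel e" for n
  have D: "real_distribution (D n)" for n
    unfolding D_def real_distribution_def real_distribution_axioms_def
    using prob_space.prob_space_distr[OF P(1) eP] by simp
  have "tight D"
    unfolding tight_def
  proof (intro conjI allI impI D)
    fix \<epsilon> :: real assume "0 < \<epsilon>"
    have "measure (D n) {-1<..2} = 1" for n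
    proof -
      have "e -` {-1<..2} \<inter> space (P n) = space (P n)" using e(2) by (force intro: less_le_trans[of "-1" 0])
      then show ?thesis
        unfolding D_def using eP by (simp add: measure_distr prob_space.prob_space[OF P(1)])
    qed
    then show "\<exists>a b. a < b \<and> (\<forall>n. 1 - \<epsilon> < measure (D n) {a<..b})"
      using \<open>0 < \<epsilon>\<close> by (intro exI[of _ "-1"] exI[of _ 2]) auto
  qed
  from tight_imp_convergent_subsubsequence[OF this strict_mono_id] obtain r M where
    r: "strict_mono (r :: nat \<Rightarrow> nat)" and M: "real_distribution M" "weak_conv_m (\<lambda>n. D (r n)) M"
    by (auto simp: id_def comp_def)
  have Mp: "prob_space M" "sets M = sets borel"
    using M(1) by (auto simp: real_distribution_def real_distribution_axioms_def)
  have gM: "g \<in> measurable M borel" using gm Mp(2) measurable_cong_sets by blast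
  show ?thesis
  proof (rule that[OF r])
    show "prob_space (distr M borel g)" by (rule prob_space.prob_space_distr[OF Mp(1) gM])
    show "sets (distr M borel g) = sets borel" by simp
    fix f :: "'a \<Rightarrow> real" assume f: "continuous_on UNIV f" and "bounded (range f)"
    then obtain b where b: "\<And>z. \<bar>f z\<bar> \<le> b" by (auto simp: bounded_iff)
    have fm: "f \<in> borel_measurable borel" using f by (rule borel_measurable_continuous_onI)
    have fg: "continuous_on UNIV (\<lambda>t. f (g t))"
      by (rule continuous_on_compose2[OF f g(1)]) auto
    have "(\<lambda>n. \<integral>t. f (g t) \<partial>(D (r n))) \<longlonglongrightarrow> (\<integral>t. f (g t) \<partial>M)"
    proof (rule weak_conv_imp_integral_bdd_continuous_conv[where B=b])
      show "isCont (\<lambda>t. f (g t)) t" for t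
        using fg by (simp add: continuous_on_eq_continuous_at)
    qed (use D M b in auto)
    moreover have "(\<integral>t. f (g t) \<partial>(D (r n))) = (\<integral>z. f z \<partial>P (r n))" for n
    proof -
      have fgm: "(\<lambda>t. f (g t)) \<in> borel_measurable borel"
        using fg by (rule borel_measurable_continuous_onI)
      have "(\<integral>t. f (g t) \<partial>(D (r n))) = (\<integral>z. f (g (e z)) \<partial>P (r n))"
        unfolding D_def comp_def by (rule integral_distr[OF eP fgm])
      also have "\<dots> = (\<integral>z. f z \<partial>P (r n))"
      proof (rule Bochner_Integration.integral_cong_AE)
        show "(\<lambda>z. f (g (e z))) \<in> borel_measurable (P (r n))"
          using measurable_compose[OF eP fgm] .
        show "f \<in> borel_measurable (P (r n))" using fm P(2) measurable_cong_sets by blast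
        show "AE z in P (r n). f (g (e z)) = f z" using P(3) by eventually_elim (simp add: g(2))
      qed
      finally show ?thesis .
    qed
    ultimately show "(\<lambda>n. \<integral>z. f z \<partial>P (r n)) \<longlonglongrightarrow> (\<integral>z. f z \<partial>distr M borel g)"
      by (simp add: integral_distr[OF gM fm])
  qed
qed


section \<open>Vague compactness of measures of polynomial growth\<close>

definition vaguely_converges :: "(nat \<Rightarrow> 'a::euclidean_space measure) \<Rightarrow> 'a measure \<Rightarrow> bool" where
  "vaguely_converges \<mu> \<nu> \<longleftrightarrow>
     (\<forall>f :: 'a \<Rightarrow> real. continuous_on UNIV f \<longrightarrow> (\<exists>K. compact K \<and> (\<forall>y. y \<notin> K \<longrightarrow> f y = 0)) \<longrightarrow>
        (\<lambda>n. \<integral>y. f y \<partial>\<mu> n) \<longlonglongrightarrow> (\<integral>y. f y \<partial>\<nu>))"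

text \<open>
  On the shell \<open>k \<le> \<bar>y\<bar> < k + 1\<close> the weight is at most \<open>k + 1\<close> to the power \<open>- (s + 2)\<close>, while the mass
  of the shell is at most \<open>C\<close> times \<open>k + 1\<close> to the power \<open>s\<close>; the products are summable.
\<close>
lemma growth_weight_nn_integral:
  fixes \<mu> :: "'a::euclidean_space measure"
  assumes sets: "sets \<mu> = sets borel" and C: "0 \<le> C" and s: "0 \<le> s"
    and growth: "\<And>R. 0 < R \<Longrightarrow> emeasure \<mu> (ball 0 R) \<le> ennreal (C * R powr s)"
  shows "(\<integral>\<^sup>+y. ennreal ((1 + norm y) powr (- (s + 2))) \<partial>\<mu>) \<le> ennreal (\<Sum>k. C * inverse (real (Suc k) ^ 2))"
proof -
  let ?c = "\<lambda>k. ennreal (real (Suc k) powr (- (s + 2)))"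
  have "(\<integral>\<^sup>+y. ennreal ((1 + norm y) powr (- (s + 2))) \<partial>\<mu>)
      \<le> (\<integral>\<^sup>+y. (\<Sum>k. ?c k * indicator (ball 0 (real (Suc k))) y) \<partial>\<mu>)"
  proof (rule nn_integral_mono)
    fix y :: 'a
    define k where "k = nat \<lfloor>norm y\<rfloor>"
    have k: "real k \<le> norm y" "norm y < real (Suc k)"
      unfolding k_def using norm_ge_zero[of y] by linarith+
    have "ennreal ((1 + norm y) powr (- (s + 2))) \<le> ?c k"
      using k s by (intro ennreal_leI powr_mono2') auto
    also have "\<dots> = (\<Sum>j\<in>{k}. ?c j * indicator (ball 0 (real (Suc j))) y)"
      using k by simp
    also have "\<dots> \<le> (\<Sum>j. ?c j * indicator (ball 0 (real (Suc j))) y)"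
      by (rule sum_le_suminf) auto
    finally show "ennreal ((1 + norm y) powr (- (s + 2))) \<le> \<dots>" .
  qed
  also have "\<dots> = (\<Sum>k. \<integral>\<^sup>+y. ?c k * indicator (ball 0 (real (Suc k))) y \<partial>\<mu>)"
  proof (rule nn_integral_suminf)
    fix k
    have "ball (0::'a) (real (Suc k)) \<in> sets \<mu>" unfolding sets by (rule borel_open) (rule open_ball)
    then show "(\<lambda>y. ?c k * indicator (ball 0 (real (Suc k))) y) \<in> borel_measurable \<mu>"
      by (rule borel_measurable_times_ennreal[OF borel_measurable_const borel_measurable_indicator])
  qed
  also have "\<dots> = (\<Sum>k. ?c k * emeasure \<mu> (ball 0 (real (Suc k))))"
    by (subst nn_integral_cmult_indicator) (auto simp: sets)
  also have "\<dots> \<le> (\<Sum>k. ennreal (C * inverse (real (Suc k) ^ 2)))"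
  proof (rule suminf_le)
    fix k
    have "?c k * emeasure \<mu> (ball 0 (real (Suc k))) \<le> ?c k * ennreal (C * real (Suc k) powr s)"
      by (intro mult_left_mono growth) auto
    also have "\<dots> = ennreal (real (Suc k) powr (- (s + 2)) * (C * real (Suc k) powr s))"
      by (rule ennreal_mult'[symmetric]) simp
    also have "real (Suc k) powr (- (s + 2)) * (C * real (Suc k) powr s) = C * inverse (real (Suc k) ^ 2)"
    proof -
      have "real (Suc k) powr (- (s + 2)) * real (Suc k) powr s = real (Suc k) powr (- 2)"
        by (simp add: powr_add[symmetric] del: of_nat_Suc)
      also have "\<dots> = inverse (real (Suc k) ^ 2)"
        by (simp add: powr_minus del: of_nat_Suc)
      finally show ?thesis by (simp add: mult_ac del: of_nat_Suc)
    qed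
    finally show "?c k * emeasure \<mu> (ball 0 (real (Suc k))) \<le> ennreal (C * inverse (real (Suc k) ^ 2))" .
  qed auto
  also have "\<dots> = ennreal (\<Sum>k. C * inverse (real (Suc k) ^ 2))"
  proof (rule suminf_ennreal2)
    have "summable (\<lambda>k. inverse (real (Suc k) ^ 2))"
      using summable_Suc_iff[of "\<lambda>k. inverse (real k ^ 2)"] inverse_power_summable[of 2, where 'a=real] by simp
    then show "summable (\<lambda>k. C * inverse (real (Suc k) ^ 2))" by (rule summable_mult)
  qed (use C in auto)
  finally show ?thesis .
qed

lemma bounded_range_compact_support:
  fixes f :: "'a::topological_space \<Rightarrow> 'b::real_normed_vector"
  assumes "continuous_on UNIV f" "compact K" "\<And>y. y \<notin> K \<Longrightarrow> f y = 0"
  shows "bounded (range f)"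
proof -
  have "bounded (insert 0 (f ` K))"
    using compact_imp_bounded[OF compact_continuous_image[OF continuous_on_subset[OF assms(1) subset_UNIV] assms(2)]]
    by simp
  moreover have "range f \<subseteq> insert 0 (f ` K)" using assms(3) by auto
  ultimately show ?thesis by (rule bounded_subset)
qed

text \<open>
  The map \<open>z \<mapsto> z / (1 - \<bar>z\<bar>)\<close> inverts the homeomorphism \<open>y \<mapsto> y / (1 + \<bar>y\<bar>)\<close> from the whole space onto the
  open unit ball. A function that vanishes off a bounded set turns into one that vanishes near the
  unit sphere, so extending it by zero creates no discontinuity.
\<close>
lemma shrink_extend_continuous:
  fixes f :: "'a::euclidean_space \<Rightarrow> real"
  assumes f: "continuous_on UNIV f" and f0: "\<And>y. R \<le> norm y \<Longrightarrow> f y = 0" and R: "0 < R"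
  shows "continuous_on UNIV (\<lambda>z. indicator (ball 0 1) z * f (z /\<^sub>R (1 - norm z)))"
    (is "continuous_on UNIV ?F")
proof -
  define \<rho> where "\<rho> = R / (1 + R)"
  have \<rho>: "\<rho> < 1" "0 < \<rho>" using R by (auto simp: \<rho>_def)
  have out: "?F z = 0" if "\<rho> < norm z" for z
  proof (cases "norm z < 1")
    case True
    have "R < norm z * (1 + R)" using that R by (simp add: \<rho>_def pos_divide_less_eq)
    then have "R \<le> norm z / (1 - norm z)" using True by (simp add: pos_le_divide_eq algebra_simps)
    also have "\<dots> = norm (z /\<^sub>R (1 - norm z))" using True by (simp add: divide_inverse)
    finally show ?thesis using f0 by simp
  qed simp
  have "continuous_on (ball 0 1) (\<lambda>z. f (z /\<^sub>R (1 - norm z)))"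
    by (intro continuous_on_compose2[OF f] continuous_intros) auto
  then have a: "continuous_on (ball 0 1) ?F"
    by (rule continuous_on_eq) simp
  have "continuous_on (- cball 0 \<rho>) (\<lambda>z::'a. 0::real)" by (rule continuous_on_const)
  then have b: "continuous_on (- cball 0 \<rho>) ?F"
    by (rule continuous_on_eq) (use out in auto)
  have "continuous_on (ball 0 1 \<union> - cball 0 \<rho>) ?F"
    using a b by (intro continuous_on_open_Un) auto
  moreover have "ball 0 1 \<union> - cball 0 \<rho> = (UNIV :: 'a set)" using \<rho> by auto
  ultimately show ?thesis by simp
qed

text \<open>
  The weight \<open>(1 + \<bar>y\<bar>)\<close> to the power \<open>- (s + 2)\<close> makes all the measures finite with a common bound.
  After normalization and transport into the closed unit ball they are probability measures on a
  compact convex set, and a weak limit exists. Only the part of the limit in the open ball is carried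
  back; mass on the sphere has escaped to infinity, and it is invisible to compactly supported test
  functions.
\<close>
lemma vague_sequential_compactness:
  fixes \<mu> :: "nat \<Rightarrow> 'a::euclidean_space measure"
  assumes sets: "\<And>n. sets (\<mu> n) = sets borel" and C: "0 \<le> C" and s: "0 \<le> s"
    and growth: "\<And>n R. 0 < R \<Longrightarrow> emeasure (\<mu> n) (ball 0 R) \<le> ennreal (C * R powr s)"
  obtains r \<nu> where "strict_mono (r :: nat \<Rightarrow> nat)" "locally_finite_borel \<nu>"
    "vaguely_converges (\<lambda>n. \<mu> (r n)) \<nu>"
proof -
  define w :: "'a \<Rightarrow> real" where "w y = (1 + norm y) powr (- (s + 2))" for y
  have nz: "1 + norm y \<noteq> 0" for y :: 'a using norm_ge_zero[of y] by linarith
  have w0: "0 < w y" for y using nz by (simp add: w_def)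
  have wc: "continuous_on UNIV w"
    unfolding w_def using nz by (intro continuous_intros) auto
  have wm: "w \<in> borel_measurable borel" using wc by (rule borel_measurable_continuous_onI)
  have space: "space (\<mu> n) = UNIV" for n using sets_eq_imp_space_eq[OF sets[of n]] by simp
  have meas: "f \<in> borel_measurable (\<mu> n)" if "f \<in> borel_measurable borel" for f :: "'a \<Rightarrow> real" and n
    using that sets measurable_cong_sets by blast
  define D where "D = (\<Sum>k. C * inverse (real (Suc k) ^ 2))"
  have wD: "(\<integral>\<^sup>+y. ennreal (w y) \<partial>\<mu> n) \<le> ennreal D" for n
    unfolding w_def D_def by (rule growth_weight_nn_integral[OF sets C s growth])
  define M where "M n = (\<integral>y. w y \<partial>\<mu> n)" for n
  have wi: "integrable (\<mu> n) w" for n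
  proof (rule integrableI_nonneg)
    show "(\<integral>\<^sup>+y. ennreal (w y) \<partial>\<mu> n) < \<infinity>" using wD[of n] by (rule le_less_trans) simp
  qed (use w0 meas[OF wm] in \<open>auto intro: less_imp_le\<close>)
  have nM: "(\<integral>\<^sup>+y. ennreal (w y) \<partial>\<mu> n) = ennreal (M n)" for n
    unfolding M_def by (rule nn_integral_eq_integral[OF wi]) (use w0 in \<open>auto intro: less_imp_le\<close>)
  have M0: "0 \<le> M n" for n unfolding M_def using w0 by (intro Bochner_Integration.integral_nonneg less_imp_le)
  have MD: "M n \<le> max D 0" for n
    using wD[of n] nM[of n] by (metis ennreal_le_iff2 max.coboundedI1 max.coboundedI2)
  have "bounded (range M)"
    using M0 MD by (auto simp: bounded_iff intro!: exI[of _ "max D 0"])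
  then obtain m r0 where r0: "strict_mono (r0 :: nat \<Rightarrow> nat)" "(\<lambda>n. M (r0 n)) \<longlonglongrightarrow> m"
    using bounded_imp_convergent_subsequence[of M] by (auto simp: comp_def)
  have m0: "0 \<le> m" using M0 by (intro LIMSEQ_le_const[OF r0(2)]) auto
  show ?thesis
  \<comment> \<open>If the weighted masses tend to zero, the limit is the null measure; otherwise they can be
    divided out from some index on.\<close>
  proof (cases "m = 0")
    case True
    show ?thesis
    proof (rule that[OF r0(1)])
      show "locally_finite_borel (null_measure (borel :: 'a measure))"
        by (auto simp: locally_finite_borel_def intro: exI[of _ UNIV])
      show "vaguely_converges (\<lambda>n. \<mu> (r0 n)) (null_measure borel)"
        unfolding vaguely_converges_def
      proof (intro allI impI, elim exE conjE)
        fix f :: "'a \<Rightarrow> real" and K assume f: "continuous_on UNIV f" and K: "compact K" "\<forall>y. y \<notin> K \<longrightarrow> f y = 0"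
        have "bounded (range (\<lambda>y. f y / w y))"
          using K f wc w0 less_imp_neq[OF w0]
          by (intro bounded_range_compact_support[where K=K] continuous_on_divide) auto
        then obtain b where b: "\<And>y. \<bar>f y / w y\<bar> \<le> b" by (auto simp: bounded_iff)
        have fb: "\<bar>f y\<bar> \<le> b * w y" for y
          using b[of y] w0[of y] by (simp add: abs_divide pos_divide_le_eq)
        have le: "norm (\<integral>y. f y \<partial>\<mu> (r0 n)) \<le> b * M (r0 n)" for n
        proof -
          have fi: "integrable (\<mu> (r0 n)) f"
          proof (rule Bochner_Integration.integrable_bound[OF integrable_mult_right[of b, OF wi]])
            show "f \<in> borel_measurable (\<mu> (r0 n))"
              by (rule meas[OF borel_measurable_continuous_onI[OF f]])
            show "AE y in \<mu> (r0 n). norm (f y) \<le> norm (b * w y)"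
            proof (rule AE_I2)
              fix y show "norm (f y) \<le> norm (b * w y)" using fb[of y] by simp
            qed
          qed
          have "norm (\<integral>y. f y \<partial>\<mu> (r0 n)) \<le> (\<integral>y. b * w y \<partial>\<mu> (r0 n))"
          proof (rule Bochner_Integration.integral_norm_bound_integral[OF fi integrable_mult_right[OF wi]])
            fix y show "norm (f y) \<le> b * w y" using fb[of y] by simp
          qed
          then show ?thesis by (simp add: M_def)
        qed
        have "(\<lambda>n. b * M (r0 n)) \<longlonglongrightarrow> 0"
          using tendsto_mult_right_zero[of "\<lambda>n. M (r0 n)" sequentially b] r0(2) True by simp
        then have "(\<lambda>n. \<integral>y. f y \<partial>\<mu> (r0 n)) \<longlonglongrightarrow> 0"
          by (rule Lim_null_comparison[OF always_eventually[OF allI[OF le]]])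
        then show "(\<lambda>n. \<integral>y. f y \<partial>\<mu> (r0 n)) \<longlonglongrightarrow> (\<integral>y. f y \<partial>null_measure borel)"
          by simp
      qed
    qed
  next
    case False
    then have "0 < m" using m0 by simp
    then have "\<forall>\<^sub>F n in sequentially. 0 < M (r0 n)"
      using r0(2) by (rule order_tendstoD(1)[rotated])
    then obtain N where N: "\<And>n. N \<le> n \<Longrightarrow> 0 < M (r0 n)"
      by (auto simp: eventually_sequentially)
    define r1 where "r1 n = r0 (n + N)" for n
    have r1: "strict_mono r1" "(\<lambda>n. M (r1 n)) \<longlonglongrightarrow> m" "\<And>n. 0 < M (r1 n)"
      using r0 N LIMSEQ_ignore_initial_segment[OF r0(2), of N] by (auto simp: r1_def strict_mono_def)
    define h :: "'a \<Rightarrow> 'a" where "h y = y /\<^sub>R (1 + norm y)" for y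
    define k :: "'a \<Rightarrow> 'a" where "k z = z /\<^sub>R (1 - norm z)" for z
    have nh: "norm (h y) = norm y / (1 + norm y)" for y by (simp add: h_def divide_inverse)
    have h1: "norm (h y) < 1" for y
    proof -
      have "0 < 1 + norm y" using norm_ge_zero[of y] by linarith
      then show ?thesis by (simp add: nh)
    qed
    have kh: "k (h y) = y" for y
    proof -
      have "1 - norm (h y) = inverse (1 + norm y)"
        unfolding nh using nz[of y] by (simp add: field_simps)
      then have "k (h y) = (1 + norm y) *\<^sub>R h y" by (simp add: k_def)
      then show ?thesis using nz[of y] by (simp add: h_def)
    qed
    have "continuous_on UNIV h"
      unfolding h_def using nz by (intro continuous_intros) auto
    then have hm: "h \<in> borel_measurable borel" by (rule borel_measurable_continuous_onI)
    have km: "k \<in> borel_measurable borel" unfolding k_def by measurable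
    define \<mu>' where "\<mu>' n = density (\<mu> (r1 n)) (\<lambda>y. ennreal (w y / M (r1 n)))" for n
    have sets': "sets (\<mu>' n) = sets borel" for n by (simp add: \<mu>'_def sets)
    have hm': "h \<in> measurable (\<mu>' n) borel" for n
      using hm sets' measurable_cong_sets by blast
    define P where "P n = distr (\<mu>' n) borel h" for n
    have P: "prob_space (P n)" for n
      unfolding P_def
    proof (rule prob_space.prob_space_distr[OF prob_spaceI hm'])
      have "emeasure (\<mu>' n) (space (\<mu>' n)) = (\<integral>\<^sup>+y. ennreal (w y / M (r1 n)) \<partial>\<mu> (r1 n))"
      proof -
        have "(\<lambda>y. w y / M (r1 n)) \<in> borel_measurable (\<mu> (r1 n))"
          by (rule meas) (use wm in simp)
        then have m: "(\<lambda>y. ennreal (w y / M (r1 n))) \<in> borel_measurable (\<mu> (r1 n))"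
          by (rule measurable_compose[OF _ measurable_ennreal])
        show ?thesis
          unfolding \<mu>'_def by (subst emeasure_density[OF m]) (simp_all add: space sets)
      qed
      also have "\<dots> = ennreal (\<integral>y. w y / M (r1 n) \<partial>\<mu> (r1 n))"
        using wi by (intro nn_integral_eq_integral AE_I2 divide_nonneg_nonneg less_imp_le[OF w0] M0) simp
      also have "\<dots> = 1" using r1(3)[of n] by (simp add: M_def[symmetric])
      finally show "emeasure (\<mu>' n) (space (\<mu>' n)) = 1" .
    qed
    have Pae: "AE z in P n. z \<in> cball 0 1" for n
      unfolding P_def by (subst AE_distr_iff[OF hm']) (use h1 in \<open>auto intro: less_imp_le\<close>)
    obtain r2 Q where r2: "strict_mono (r2 :: nat \<Rightarrow> nat)" and Q: "prob_space Q" "sets Q = sets borel"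
      and conv: "\<And>f :: 'a \<Rightarrow> real. continuous_on UNIV f \<Longrightarrow> bounded (range f) \<Longrightarrow>
        (\<lambda>n. \<integral>z. f z \<partial>P (r2 n)) \<longlonglongrightarrow> (\<integral>z. f z \<partial>Q)"
      by (rule weak_sequential_compactness[of "cball 0 1" P]) (use P Pae in \<open>auto simp: P_def\<close>)
    define Q1 where "Q1 = density Q (\<lambda>z. ennreal (indicator (ball 0 1) z))"
    define Q2 where "Q2 = distr Q1 borel k"
    define \<nu> where "\<nu> = density Q2 (\<lambda>y. ennreal (m / w y))"
    have measQ: "f \<in> measurable Q N" if "f \<in> measurable borel N" for f :: "'a \<Rightarrow> 'c" and N
      using that Q(2) measurable_cong_sets by blast
    have measQ1: "f \<in> measurable Q1 N" if "f \<in> measurable borel N" for f :: "'a \<Rightarrow> 'c" and N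
      using measQ[OF that] by (simp add: Q1_def)
    have wm': "(\<lambda>y. m / w y) \<in> borel_measurable borel" using wm by simp
    have int\<nu>: "(\<integral>y. f y \<partial>\<nu>) = m * (\<integral>z. indicator (ball 0 1) z * (f (k z) / w (k z)) \<partial>Q)"
      if fm: "f \<in> borel_measurable borel" for f :: "'a \<Rightarrow> real"
    proof -
      have "(\<integral>y. f y \<partial>\<nu>) = (\<integral>y. (m / w y) *\<^sub>R f y \<partial>Q2)"
        unfolding \<nu>_def using fm wm' m0 w0
        by (intro integral_density) (auto simp: Q2_def intro!: AE_I2 divide_nonneg_pos)
      also have "\<dots> = (\<integral>z. (m / w (k z)) *\<^sub>R f (k z) \<partial>Q1)"
        unfolding Q2_def by (intro integral_distr measQ1 km borel_measurable_scaleR[OF wm' fm])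
      also have "\<dots> = (\<integral>z. indicator (ball 0 1) z *\<^sub>R ((m / w (k z)) *\<^sub>R f (k z)) \<partial>Q)"
        unfolding Q1_def
        by (intro integral_density measQ borel_measurable_scaleR measurable_compose[OF km fm] measurable_compose[OF km wm']
            borel_measurable_indicator) auto
      also have "\<dots> = (\<integral>z. m * (indicator (ball 0 1) z * (f (k z) / w (k z))) \<partial>Q)"
        by (rule Bochner_Integration.integral_cong) (auto simp: mult_ac)
      finally show ?thesis by (simp only: integral_mult_right_zero)
    qed
    show ?thesis
    proof (rule that)
      show "strict_mono (r1 \<circ> r2)" using r1(1) r2 by (rule strict_mono_o)
      have fin: "emeasure \<nu> (ball 0 R) < \<infinity>" for R
      proof -
        have "emeasure \<nu> (ball 0 R) = (\<integral>\<^sup>+y. ennreal (m / w y) * indicator (ball 0 R) y \<partial>Q2)"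
          unfolding \<nu>_def using wm' by (intro emeasure_density) (auto simp: Q2_def)
        also have "\<dots> \<le> (\<integral>\<^sup>+y. ennreal (m / (1 + R) powr (- (s + 2))) \<partial>Q2)"
        proof (rule nn_integral_mono)
          fix y :: 'a
          show "ennreal (m / w y) * indicator (ball 0 R) y \<le> ennreal (m / (1 + R) powr (- (s + 2)))"
          proof (cases "norm y < R")
            case True
            then have "(1 + R) powr (- (s + 2)) \<le> w y"
              unfolding w_def using s norm_ge_zero[of y] by (intro powr_mono2') linarith+
            moreover have "1 + R > 0" using True norm_ge_zero[of y] by linarith
            ultimately have "m / w y \<le> m / (1 + R) powr (- (s + 2))"
              using w0 m0 by (intro divide_left_mono) auto
            then show ?thesis using True by (simp add: ennreal_leI)
          qed simp
        qed
        also have "\<dots> = ennreal (m / (1 + R) powr (- (s + 2))) * emeasure Q2 (space Q2)"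
          by simp
        also have "emeasure Q2 (space Q2) = emeasure Q1 (space Q1)"
          unfolding Q2_def using measQ1[OF km] by (simp add: emeasure_distr)
        also have "ennreal (m / (1 + R) powr (- (s + 2))) * emeasure Q1 (space Q1)
            \<le> ennreal (m / (1 + R) powr (- (s + 2))) * 1"
        proof (rule mult_left_mono)
          have "emeasure Q1 (space Q1) = (\<integral>\<^sup>+z. ennreal (indicator (ball 0 1) z) * indicator (space Q) z \<partial>Q)"
            unfolding Q1_def space_density
            by (intro emeasure_density measQ sets.top measurable_compose[OF borel_measurable_indicator measurable_ennreal]) simp
          also have "\<dots> \<le> (\<integral>\<^sup>+z. 1 \<partial>Q)"
            by (intro nn_integral_mono) (auto simp: indicator_def)
          also have "\<dots> = 1" using Q(1) by (simp add: prob_space.emeasure_space_1)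
          finally show "emeasure Q1 (space Q1) \<le> 1" .
        qed simp
        also have "\<dots> < \<infinity>" by simp
        finally show ?thesis .
      qed
      show "locally_finite_borel \<nu>"
        unfolding locally_finite_borel_def
      proof (intro conjI allI)
        show "sets \<nu> = sets borel" by (simp add: \<nu>_def Q2_def)
        fix x :: 'a
        show "\<exists>U. open U \<and> x \<in> U \<and> emeasure \<nu> U < \<infinity>"
          using fin by (intro exI[of _ "ball 0 (norm x + 1)"]) auto
      qed
      show "vaguely_converges (\<lambda>n. \<mu> ((r1 \<circ> r2) n)) \<nu>"
        unfolding vaguely_converges_def
      proof (intro allI impI, elim exE conjE)
        fix f :: "'a \<Rightarrow> real" and K assume f: "continuous_on UNIV f" and K: "compact K" "\<forall>y. y \<notin> K \<longrightarrow> f y = 0"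
        have fm: "f \<in> borel_measurable borel" using f by (rule borel_measurable_continuous_onI)
        obtain R where R: "0 < R" "\<And>y. y \<in> K \<Longrightarrow> norm y < R"
          using compact_imp_bounded[OF K(1)] by (auto simp: bounded_pos_less)
        let ?F = "\<lambda>z. indicator (ball 0 1) z * (f (k z) / w (k z))"
        have Fc: "continuous_on UNIV ?F"
          unfolding k_def
        proof (rule shrink_extend_continuous[where f="\<lambda>y. f y / w y"])
          show "continuous_on UNIV (\<lambda>y. f y / w y)"
            using f wc less_imp_neq[OF w0] by (intro continuous_on_divide) auto
          show "f y / w y = 0" if "R \<le> norm y" for y using that R(2)[of y] K(2) by force
        qed (rule R(1))
        have Fb: "bounded (range ?F)"
          by (rule bounded_range_compact_support[OF Fc compact_cball[of 0 1]]) auto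
        have Fm: "?F \<in> borel_measurable borel" using Fc by (rule borel_measurable_continuous_onI)
        have *: "M (r1 n) * (\<integral>z. ?F z \<partial>P n) = (\<integral>y. f y \<partial>\<mu> (r1 n))" for n
        proof -
          have "(\<integral>z. ?F z \<partial>P n) = (\<integral>y. ?F (h y) \<partial>\<mu>' n)"
            unfolding P_def by (rule integral_distr[OF hm' Fm])
          also have "\<dots> = (\<integral>y. f y / w y \<partial>\<mu>' n)"
            using h1 by (simp add: kh)
          also have "\<dots> = (\<integral>y. (w y / M (r1 n)) *\<^sub>R (f y / w y) \<partial>\<mu> (r1 n))"
            unfolding \<mu>'_def using M0 w0 fm wm
            by (intro integral_density meas) (auto intro!: AE_I2 divide_nonneg_nonneg less_imp_le[OF w0])
          also have "\<dots> = (\<integral>y. f y / M (r1 n) \<partial>\<mu> (r1 n))"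
            using less_imp_neq[OF w0] by (intro Bochner_Integration.integral_cong) (auto simp: field_simps)
          finally show ?thesis using r1(3)[of n] by simp
        qed
        have "(\<lambda>n. M (r1 (r2 n)) * (\<integral>z. ?F z \<partial>P (r2 n))) \<longlonglongrightarrow> m * (\<integral>z. ?F z \<partial>Q)"
          using LIMSEQ_subseq_LIMSEQ[OF r1(2) r2]
          by (intro tendsto_mult conv Fc Fb) (simp add: comp_def)
        then show "(\<lambda>n. \<integral>y. f y \<partial>\<mu> ((r1 \<circ> r2) n)) \<longlonglongrightarrow> (\<integral>y. f y \<partial>\<nu>)"
          by (simp only: * int\<nu>[OF fm] comp_def)
      qed
    qed
  qed
qed

section \<open>What a vague limit inherits\<close>

text \<open>
  Continuous radial cutoff that is \<open>1\<close> on \<open>ball z t\<close>, vanishes outside \<open>ball z r\<close> and is linear in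
  between.
\<close>
definition tent :: "'a::metric_space \<Rightarrow> real \<Rightarrow> real \<Rightarrow> 'a \<Rightarrow> real" where
  "tent z t r y = max 0 (min 1 ((r - dist z y) / (r - t)))"

lemma tent_props:
  assumes "t < r"
  shows "continuous_on UNIV (tent z t r)" "y \<notin> ball z r \<Longrightarrow> tent z t r y = 0"
    "indicator (ball z t) y \<le> tent z t r y" "tent z t r y \<le> indicator (ball z r) y"
proof -
  show "continuous_on UNIV (tent z t r)"
    unfolding tent_def using assms by (intro continuous_intros) auto
  have out: "tent z t r y = 0" if "y \<notin> ball z r" for y
  proof -
    have "(r - dist z y) / (r - t) \<le> 0" using that assms by (intro divide_nonpos_pos) auto
    then show ?thesis by (simp add: tent_def)
  qed
  then show "y \<notin> ball z r \<Longrightarrow> tent z t r y = 0" .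
  have "1 \<le> (r - dist z y) / (r - t)" if "dist z y < t"
    using that assms by (subst pos_le_divide_eq) auto
  then show "indicator (ball z t) y \<le> tent z t r y"
    by (auto simp: indicator_def tent_def)
  show "tent z t r y \<le> indicator (ball z r) y"
    using out[of y] by (auto simp: indicator_def tent_def)
qed

lemma tent_integral_bounds:
  fixes z :: "'a::euclidean_space"
  assumes M: "locally_finite_borel M" and tr: "t < r"
  shows "measure M (ball z t) \<le> (\<integral>y. tent z t r y \<partial>M)" "(\<integral>y. tent z t r y \<partial>M) \<le> measure M (ball z r)"
proof -
  have [simp]: "sets M = sets borel" "space M = UNIV" using locally_finite_borelD[OF M] by auto
  have i: "integrable M (tent z t r)"
    by (rule integrable_continuous_compact_support[OF M tent_props(1)[OF tr] compact_cball[of z r]])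
      (rule tent_props(2)[OF tr], auto)
  have b: "integrable M (indicator (ball z u) :: 'a \<Rightarrow> real)" for u
    using locally_finite_borel_ball[OF M] by (intro integrable_real_indicator) auto
  have "(\<integral>y. indicator (ball z t) y \<partial>M) \<le> (\<integral>y. tent z t r y \<partial>M)"
    by (intro Bochner_Integration.integral_mono b i tent_props(3)[OF tr])
  then show "measure M (ball z t) \<le> (\<integral>y. tent z t r y \<partial>M)" by simp
  have "(\<integral>y. tent z t r y \<partial>M) \<le> (\<integral>y. indicator (ball z r) y \<partial>M)"
    by (intro Bochner_Integration.integral_mono b i tent_props(4)[OF tr])
  then show "(\<integral>y. tent z t r y \<partial>M) \<le> measure M (ball z r)" by simp
qed

lemma emeasure_ball_eq_measure:
  fixes z :: "'a::euclidean_space"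
  assumes "locally_finite_borel M"
  shows "emeasure M (ball z r) = ennreal (measure M (ball z r))"
  using locally_finite_borel_ball[OF assms, of z r] by (intro emeasure_eq_ennreal_measure) auto

lemma vaguely_converges_tent:
  fixes z :: "'a::euclidean_space"
  assumes "vaguely_converges M \<nu>" "t < r"
  shows "(\<lambda>n. \<integral>y. tent z t r y \<partial>M n) \<longlonglongrightarrow> (\<integral>y. tent z t r y \<partial>\<nu>)"
proof -
  have "\<forall>y. y \<notin> cball z r \<longrightarrow> tent z t r y = 0"
    using tent_props(2)[OF assms(2), of _ z] by auto
  then show ?thesis
    using assms(1) tent_props(1)[OF assms(2), of z] compact_cball[of z r]
    unfolding vaguely_converges_def by blast
qed

text \<open>
  If the limit gave an open ball more mass than \<open>c\<close>, then so would it give a smaller concentric ball,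
  and a tent function between the two balls would detect this before the limit.
\<close>
lemma vague_limit_ball_le:
  fixes z :: "'a::euclidean_space"
  assumes M: "\<And>n. locally_finite_borel (M n)" and \<nu>: "locally_finite_borel \<nu>"
    and conv: "vaguely_converges M \<nu>" and c: "0 \<le> c" and le: "\<And>n. emeasure (M n) (ball z r) \<le> ennreal c"
  shows "emeasure \<nu> (ball z r) \<le> ennreal c"
proof (rule ccontr)
  assume "\<not> emeasure \<nu> (ball z r) \<le> ennreal c"
  then obtain t where t: "t < r" "ennreal c < emeasure \<nu> (ball z t)"
    using ball_lower_semicontinuous[OF locally_finite_borelD(1)[OF \<nu>], of "ennreal c" z r]
    unfolding not_le by blast
  have "(\<integral>y. tent z t r y \<partial>M n) \<le> c" for n
    using le[of n] tent_integral_bounds(2)[OF M t(1), of n z] c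
    by (simp add: emeasure_ball_eq_measure[OF M])
  then have "(\<integral>y. tent z t r y \<partial>\<nu>) \<le> c"
    by (intro LIMSEQ_le_const2[OF vaguely_converges_tent[OF conv t(1)]]) auto
  then have "measure \<nu> (ball z t) \<le> c"
    using tent_integral_bounds(1)[OF \<nu> t(1), of z] by simp
  then show False
    using t(2) by (simp add: emeasure_ball_eq_measure[OF \<nu>] ennreal_less_iff c)
qed

lemma vague_limit_support:
  fixes z :: "'a::euclidean_space"
  assumes M: "\<And>n. locally_finite_borel (M n)" and \<nu>: "locally_finite_borel \<nu>"
    and conv: "vaguely_converges M \<nu>" and z: "z \<in> closed_support \<nu>" and \<epsilon>: "0 < \<epsilon>"
  shows "\<forall>\<^sub>F n in sequentially. 0 < emeasure (M n) (ball z \<epsilon>)"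
proof -
  have te: "\<epsilon>/2 < \<epsilon>" using \<epsilon> by simp
  have "0 < emeasure \<nu> (ball z (\<epsilon>/2))" using z \<epsilon> by (auto simp: closed_support_def)
  then have "0 < measure \<nu> (ball z (\<epsilon>/2))" by (simp add: emeasure_ball_eq_measure[OF \<nu>])
  also have "\<dots> \<le> (\<integral>y. tent z (\<epsilon>/2) \<epsilon> y \<partial>\<nu>)" by (rule tent_integral_bounds(1)[OF \<nu> te])
  finally have "\<forall>\<^sub>F n in sequentially. 0 < (\<integral>y. tent z (\<epsilon>/2) \<epsilon> y \<partial>M n)"
    by (rule order_tendstoD(1)[OF vaguely_converges_tent[OF conv te]])
  then show ?thesis
  proof eventually_elim
    case (elim n)
    then have "0 < measure (M n) (ball z \<epsilon>)"
      using tent_integral_bounds(2)[OF M te, of n z] by linarith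
    then show ?case by (simp add: emeasure_ball_eq_measure[OF M])
  qed
qed

lemma vaguely_converges_vector:
  fixes f :: "'a::euclidean_space \<Rightarrow> 'b::euclidean_space"
  assumes M: "\<And>n. locally_finite_borel (M n)" and \<nu>: "locally_finite_borel \<nu>"
    and conv: "vaguely_converges M \<nu>"
    and f: "continuous_on UNIV f" and K: "compact K" "\<And>y. y \<notin> K \<Longrightarrow> f y = 0"
  shows "(\<lambda>n. \<integral>y. f y \<partial>M n) \<longlonglongrightarrow> (\<integral>y. f y \<partial>\<nu>)"
proof (subst tendsto_componentwise_iff, rule ballI)
  fix b :: 'b assume "b \<in> Basis"
  have i: "integrable N f" if "locally_finite_borel N" for N
    by (rule integrable_continuous_compact_support[OF that f K])
  have "(\<lambda>n. \<integral>y. f y \<bullet> b \<partial>M n) \<longlonglongrightarrow> (\<integral>y. f y \<bullet> b \<partial>\<nu>)"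
    using conv f K unfolding vaguely_converges_def
    by (elim allE[of _ "\<lambda>y. f y \<bullet> b"] impE) (auto intro!: continuous_intros exI[of _ K])
  then show "(\<lambda>n. (\<integral>y. f y \<partial>M n) \<bullet> b) \<longlonglongrightarrow> (\<integral>y. f y \<partial>\<nu>) \<bullet> b"
    by (simp add: integral_inner_left[OF i[OF M]] integral_inner_left[OF i[OF \<nu>]])
qed

text \<open>
  Moving the base point by less than \<open>\<epsilon>\<close> changes the truncated action by a multiple of \<open>\<epsilon>\<close>. So it is
  enough that near \<open>z\<close> there are base points, varying with \<open>n\<close>, at which the action of \<open>M n\<close> is small.
  Points in the support of a limit are approximated in just this sense.
\<close>
lemma vague_limit_action_zero:
  fixes z :: "'a::euclidean_space" and \<Omega> :: "'a \<Rightarrow> 'b::euclidean_space"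
  assumes M: "\<And>n. locally_finite_borel (M n)" and \<nu>: "locally_finite_borel \<nu>"
    and conv: "vaguely_converges M \<nu>"
    and h: "H-lipschitz_on {0..} h" and h1: "\<forall>t\<ge>1. h t = 0"
    and \<Omega>: "L-lipschitz_on UNIV \<Omega>" "\<Omega> 0 = 0" and r: "0 < r"
    and c: "\<And>n. measure (M n) (ball z (r + 1)) \<le> c"
    and near: "\<And>\<epsilon>. 0 < \<epsilon> \<Longrightarrow> \<epsilon> < 1 \<Longrightarrow>
      \<forall>\<^sub>F n in sequentially. \<exists>z'. dist z z' < \<epsilon> \<and> norm (\<integral>y. radial_cut h \<Omega> r (z' - y) \<partial>M n) \<le> \<epsilon>"
  shows "(\<integral>y. radial_cut h \<Omega> r (z - y) \<partial>\<nu>) = 0"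
proof -
  let ?I = "\<lambda>N z. \<integral>y. radial_cut h \<Omega> r (z - y) \<partial>N"
  have HL: "0 \<le> 2 * H * L"
    using lipschitz_on_nonneg[OF h] lipschitz_on_nonneg[OF \<Omega>(1)] by auto
  have c0: "0 \<le> c" using c[of 0] by (rule order_trans[rotated]) simp
  define k where "k = 1 + 2 * H * L * c"
  have k: "0 < k" unfolding k_def using HL c0 by (intro add_pos_nonneg) auto
  have lim: "(\<lambda>n. ?I (M n) z) \<longlonglongrightarrow> ?I \<nu> z"
  proof (rule vaguely_converges_vector[OF M \<nu> conv _ compact_cball[of z r]])
    show "continuous_on UNIV (\<lambda>y. radial_cut h \<Omega> r (z - y))"
      by (intro continuous_on_compose2[OF radial_cut_continuous[OF h h1 \<Omega> r]] continuous_intros) auto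
    show "radial_cut h \<Omega> r (z - y) = 0" if "y \<notin> cball z r" for y
      using that by (intro radial_cut_eq_0[where h=h, OF h1 r]) (auto simp: dist_norm)
  qed
  have bound: "norm (?I \<nu> z) \<le> \<epsilon> * k" if \<epsilon>: "0 < \<epsilon>" "\<epsilon> < 1" for \<epsilon>
  proof (rule tendsto_upperbound[OF tendsto_norm[OF lim]])
    show "\<forall>\<^sub>F n in sequentially. norm (?I (M n) z) \<le> \<epsilon> * k"
      using near[OF \<epsilon>]
    proof eventually_elim
      case (elim n)
      then obtain z' where z': "dist z z' < \<epsilon>" "norm (?I (M n) z') \<le> \<epsilon>" by blast
      have "norm (?I (M n) z - ?I (M n) z') \<le> 2 * H * L * dist z z' * measure (M n) (ball z (r + 1))"
        using z'(1) \<epsilon> by (intro radial_integral_diff_le[OF M h h1 \<Omega> r]) auto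
      also have "\<dots> \<le> 2 * H * L * \<epsilon> * c"
        using HL z'(1) c[of n] \<epsilon> lipschitz_on_nonneg[OF h] lipschitz_on_nonneg[OF \<Omega>(1)]
        by (intro mult_mono[OF mult_left_mono[OF _ HL]]) auto
      finally have "norm (?I (M n) z - ?I (M n) z') \<le> 2 * H * L * \<epsilon> * c" .
      then show ?case
        using z'(2) norm_triangle_sub[of "?I (M n) z" "?I (M n) z'"] by (simp add: k_def algebra_simps)
    qed
  qed simp
  have "norm (?I \<nu> z) \<le> 0 + e" if e: "0 < e" for e
  proof -
    define \<epsilon> where "\<epsilon> = min (1/2) (e / k)"
    have "0 < \<epsilon>" "\<epsilon> < 1" "\<epsilon> \<le> e / k" using e k by (auto simp: \<epsilon>_def)
    then show ?thesis using bound[of \<epsilon>] k by (auto simp: pos_le_divide_eq)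
  qed
  then have "norm (?I \<nu> z) \<le> 0" by (rule field_le_epsilon)
  then show ?thesis by simp
qed

text \<open>
  As the parameter \<open>1 / (m + 2)\<close> tends to zero the profiles tend to \<open>1\<close> at every point of \<open>[0, 1)\<close>. They
  are bounded by \<open>1\<close>, so dominated convergence applies. Countably many parameters suffice, which is
  what permits a uniform choice of exceptional null sets later on.
\<close>
lemma radial_cuts_zero_imp_ball_zero:
  fixes z :: "'a::euclidean_space" and \<Omega> :: "'a \<Rightarrow> 'b::euclidean_space"
  assumes \<nu>: "locally_finite_borel \<nu>" and \<eta>: "cutoff_family \<eta>"
    and \<Omega>: "L-lipschitz_on UNIV \<Omega>" "\<Omega> 0 = 0" and r: "0 < r"
    and zero: "\<And>m::nat. (\<integral>y. radial_cut (\<eta> (1 / (real m + 2))) \<Omega> r (z - y) \<partial>\<nu>) = 0"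
  shows "(LINT y:ball z r|\<nu>. \<Omega> (z - y)) = 0"
proof -
  have [simp]: "sets \<nu> = sets borel" "space \<nu> = UNIV" using locally_finite_borelD[OF \<nu>] by auto
  have L0: "0 \<le> L" using lipschitz_on_nonneg[OF \<Omega>(1)] .
  define \<tau> :: "nat \<Rightarrow> real" where "\<tau> m = 1 / (real m + 2)" for m
  have \<tau>: "0 < \<tau> m" "\<tau> m < 1" for m by (auto simp: \<tau>_def field_simps)
  note cut = cutoff_familyD[OF \<eta> \<tau>]
  have \<Omega>c: "continuous_on UNIV (\<lambda>y. \<Omega> (z - y))"
    by (intro continuous_on_compose2[OF lipschitz_on_continuous_on[OF \<Omega>(1)]] continuous_intros) auto
  have \<Omega>m: "(\<lambda>y. \<Omega> (z - y)) \<in> borel_measurable \<nu>"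
    using borel_measurable_continuous_onI[OF \<Omega>c] locally_finite_borelD(1)[OF \<nu>] measurable_cong_sets by blast
  have "(\<lambda>m. \<integral>y. radial_cut (\<eta> (\<tau> m)) \<Omega> r (z - y) \<partial>\<nu>) \<longlonglongrightarrow> (\<integral>y. indicator (ball z r) y *\<^sub>R \<Omega> (z - y) \<partial>\<nu>)"
  proof (rule integral_dominated_convergence)
    show "(\<lambda>y. indicator (ball z r) y *\<^sub>R \<Omega> (z - y)) \<in> borel_measurable \<nu>"
      by (rule borel_measurable_scaleR[OF borel_measurable_indicator \<Omega>m]) simp
    show "(\<lambda>y. radial_cut (\<eta> (\<tau> m)) \<Omega> r (z - y)) \<in> borel_measurable \<nu>" for m
      by (rule borel_measurable_integrable) (rule radial_cut_integrable[OF \<nu> cut(1) cut(3) \<Omega> r])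
    show "integrable \<nu> (\<lambda>y. L * r * indicator (ball z r) y)"
      using locally_finite_borel_ball[OF \<nu>] by (intro integrable_mult_right integrable_real_indicator) auto
    show "AE y in \<nu>. (\<lambda>m. radial_cut (\<eta> (\<tau> m)) \<Omega> r (z - y)) \<longlonglongrightarrow> indicator (ball z r) y *\<^sub>R \<Omega> (z - y)"
    proof (rule AE_I2)
      fix y
      show "(\<lambda>m. radial_cut (\<eta> (\<tau> m)) \<Omega> r (z - y)) \<longlonglongrightarrow> indicator (ball z r) y *\<^sub>R \<Omega> (z - y)"
      proof (cases "y \<in> ball z r")
        case True
        then have t: "norm (z - y) / r < 1" using r by (simp add: dist_norm)
        have "\<tau> \<longlonglongrightarrow> 0"
        proof -
          have "\<tau> = (\<lambda>m. 1 / real (m + 2))" by (simp add: \<tau>_def fun_eq_iff)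
          then show ?thesis
            using LIMSEQ_ignore_initial_segment[OF lim_1_over_n[where 'a=real], of 2] by simp
        qed
        then have "\<forall>\<^sub>F m in sequentially. \<tau> m < 1 - norm (z - y) / r"
          using t by (intro order_tendstoD(2)) auto
        then have "\<forall>\<^sub>F m in sequentially. radial_cut (\<eta> (\<tau> m)) \<Omega> r (z - y) = \<Omega> (z - y)"
        proof eventually_elim
          case (elim m)
          then have "\<eta> (\<tau> m) (norm (z - y) / r) = 1" using r by (intro cut(2)) auto
          then show ?case by (simp add: radial_cut_def)
        qed
        then show ?thesis using True by (simp add: tendsto_eventually)
      next
        case False
        then show ?thesis
          using radial_cut_eq_0[where h="\<eta> (\<tau> _)" and \<Omega>=\<Omega> and z="z - y", OF cut(3) r] by (simp add: dist_norm)
      qed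
    qed
    show "AE y in \<nu>. norm (radial_cut (\<eta> (\<tau> m)) \<Omega> r (z - y)) \<le> L * r * indicator (ball z r) y" for m
    proof (rule AE_I2)
      fix y
      show "norm (radial_cut (\<eta> (\<tau> m)) \<Omega> r (z - y)) \<le> L * r * indicator (ball z r) y"
      proof (cases "y \<in> ball z r")
        case True
        then have t: "norm (z - y) \<le> r" by (simp add: dist_norm)
        have "norm (radial_cut (\<eta> (\<tau> m)) \<Omega> r (z - y)) \<le> 1 * (L * norm (z - y))"
          unfolding radial_cut_def norm_scaleR real_norm_def
          using r by (intro mult_mono cut(4) kernel_norm_le[OF \<Omega>]) auto
        also have "\<dots> \<le> L * r" using t L0 by (simp add: mult_left_mono)
        finally show ?thesis using True by simp
      next
        case False
        then show ?thesis
          using radial_cut_eq_0[where h="\<eta> (\<tau> m)" and \<Omega>=\<Omega> and z="z - y", OF cut(3) r] by (simp add: dist_norm)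
      qed
    qed
  qed
  moreover have "(\<integral>y. radial_cut (\<eta> (\<tau> m)) \<Omega> r (z - y) \<partial>\<nu>) = 0" for m
    using zero[of m] by (simp add: \<tau>_def)
  ultimately show ?thesis
    by (simp add: set_lebesgue_integral_def LIMSEQ_const_iff)
qed

section \<open>Affine images of measures\<close>

text \<open>
  Blowing up at a point and undoing a blow-up are both push-forwards of this form.
\<close>
definition affine_image :: "real \<Rightarrow> 'a::euclidean_space \<Rightarrow> real \<Rightarrow> 'a measure \<Rightarrow> 'a measure" where
  "affine_image c v t M = density (distr M borel (\<lambda>y. v + t *\<^sub>R y)) (\<lambda>_. ennreal c)"

lemma affine_image_sets [simp]: "sets (affine_image c v t M) = sets borel"
  by (simp add: affine_image_def)

lemma affine_measurable:
  fixes v :: "'a::euclidean_space"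
  assumes "sets M = sets borel"
  shows "(\<lambda>y. v + t *\<^sub>R y) \<in> measurable M borel"
proof -
  have "continuous_on UNIV (\<lambda>y. v + t *\<^sub>R y)" by (intro continuous_intros)
  then have "(\<lambda>y. v + t *\<^sub>R y) \<in> borel_measurable borel" by (rule borel_measurable_continuous_onI)
  then show ?thesis using assms measurable_cong_sets by blast
qed

lemma affine_vimage_ball:
  fixes v :: "'a::euclidean_space"
  assumes "0 < t"
  shows "v + t *\<^sub>R y \<in> ball z R \<longleftrightarrow> y \<in> ball ((z - v) /\<^sub>R t) (R / t)"
proof -
  have "z - (v + t *\<^sub>R y) = t *\<^sub>R ((z - v) /\<^sub>R t - y)"
    using assms by (simp add: algebra_simps)
  then have "norm (z - (v + t *\<^sub>R y)) = t * norm ((z - v) /\<^sub>R t - y)"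
    using assms by simp
  then show ?thesis using assms by (simp add: dist_norm pos_less_divide_eq mult.commute)
qed

lemma emeasure_affine_image_ball:
  fixes v :: "'a::euclidean_space"
  assumes M: "sets M = sets borel" and t: "0 < t"
  shows "emeasure (affine_image c v t M) (ball z R) = ennreal c * emeasure M (ball ((z - v) /\<^sub>R t) (R / t))"
proof -
  have "space M = UNIV" using sets_eq_imp_space_eq[OF M] by simp
  then have "(\<lambda>y. v + t *\<^sub>R y) -` ball z R \<inter> space M = ball ((z - v) /\<^sub>R t) (R / t)"
    using affine_vimage_ball[OF t, of v _ z R] by auto
  then show ?thesis
    unfolding affine_image_def
    by (simp add: emeasure_density_const emeasure_distr[OF affine_measurable[OF M]])
qed

lemma affine_image_integral:
  fixes f :: "'a::euclidean_space \<Rightarrow> 'b::{banach, second_countable_topology}"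
  assumes M: "sets M = sets borel" and f: "f \<in> borel_measurable borel" and c: "0 \<le> c"
  shows "(\<integral>y. f y \<partial>affine_image c v t M) = c *\<^sub>R (\<integral>y. f (v + t *\<^sub>R y) \<partial>M)"
proof -
  have "(\<integral>y. f y \<partial>affine_image c v t M) = (\<integral>y. c *\<^sub>R f y \<partial>distr M borel (\<lambda>y. v + t *\<^sub>R y))"
    unfolding affine_image_def using c f by (intro integral_density) auto
  also have "\<dots> = c *\<^sub>R (\<integral>y. f y \<partial>distr M borel (\<lambda>y. v + t *\<^sub>R y))"
    by simp
  also have "(\<integral>y. f y \<partial>distr M borel (\<lambda>y. v + t *\<^sub>R y)) = (\<integral>y. f (v + t *\<^sub>R y) \<partial>M)"
    by (rule integral_distr[OF affine_measurable[OF M] f])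
  finally show ?thesis .
qed

lemma affine_image_locally_finite:
  assumes M: "locally_finite_borel M" and t: "0 < t"
  shows "locally_finite_borel (affine_image c v t M)"
  unfolding locally_finite_borel_def
proof (intro conjI allI)
  fix x :: 'a
  have "emeasure (affine_image c v t M) (ball x 1) < \<infinity>"
    using locally_finite_borel_ball[OF M]
    by (simp add: emeasure_affine_image_ball[OF locally_finite_borelD(1)[OF M] t] ennreal_mult_less_top)
  then show "\<exists>U. open U \<and> x \<in> U \<and> emeasure (affine_image c v t M) U < \<infinity>"
    by (intro exI[of _ "ball x 1"]) auto
qed simp

lemma closed_support_affine_image:
  fixes v :: "'a::euclidean_space"
  assumes M: "sets M = sets borel" and t: "0 < t" and x: "x \<in> closed_support (affine_image c v t M)"
  shows "(x - v) /\<^sub>R t \<in> closed_support M"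
  unfolding closed_support_def
proof (intro CollectI allI impI, elim conjE)
  fix U assume U: "open U" "(x - v) /\<^sub>R t \<in> U"
  then obtain e where e: "0 < e" "ball ((x - v) /\<^sub>R t) e \<subseteq> U"
    by (auto simp: open_contains_ball)
  have "0 < emeasure (affine_image c v t M) (ball x (t * e))"
    using x e(1) t by (auto simp: closed_support_def)
  also have "\<dots> = ennreal c * emeasure M (ball ((x - v) /\<^sub>R t) e)"
    using t by (simp add: emeasure_affine_image_ball[OF M t])
  finally have "0 < emeasure M (ball ((x - v) /\<^sub>R t) e)"
    by (auto simp: zero_less_iff_neq_zero)
  also have "\<dots> \<le> emeasure M U" using e(2) U(1) M by (intro emeasure_mono) auto
  finally show "0 < emeasure M U" .
qed

text \<open>
  Homogeneity pulls the dilation factor out of the kernel, and balls correspond to balls.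
\<close>
lemma symmetric_points_affine_image:
  fixes v :: "'a::euclidean_space" and \<Omega> :: "'a \<Rightarrow> 'b::euclidean_space"
  assumes M: "sets M = sets borel" and t: "0 < t" and c: "0 \<le> c"
    and \<Omega>: "continuous_on UNIV \<Omega>" "one_homogeneous \<Omega>" and z: "(x - v) /\<^sub>R t \<in> symmetric_points \<Omega> M"
  shows "x \<in> symmetric_points \<Omega> (affine_image c v t M)"
  unfolding symmetric_points_def
proof (intro CollectI allI impI)
  fix R :: real assume R: "0 < R"
  have "continuous_on UNIV (\<lambda>y. \<Omega> (x - y))"
    by (intro continuous_on_compose2[OF \<Omega>(1)] continuous_intros) auto
  then have \<Omega>m: "(\<lambda>y. \<Omega> (x - y)) \<in> borel_measurable borel" by (rule borel_measurable_continuous_onI)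
  have hom: "\<Omega> (x - (v + t *\<^sub>R y)) = t *\<^sub>R \<Omega> ((x - v) /\<^sub>R t - y)" for y
  proof -
    have "x - (v + t *\<^sub>R y) = t *\<^sub>R ((x - v) /\<^sub>R t - y)" using t by (simp add: algebra_simps)
    then show ?thesis using \<Omega>(2) t by (simp add: one_homogeneous_def)
  qed
  have "(LINT y:ball x R|affine_image c v t M. \<Omega> (x - y))
      = c *\<^sub>R (\<integral>y. indicator (ball x R) (v + t *\<^sub>R y) *\<^sub>R \<Omega> (x - (v + t *\<^sub>R y)) \<partial>M)"
    unfolding set_lebesgue_integral_def
    by (rule affine_image_integral[OF M _ c]) (rule borel_measurable_scaleR[OF borel_measurable_indicator \<Omega>m], simp)
  also have "(\<integral>y. indicator (ball x R) (v + t *\<^sub>R y) *\<^sub>R \<Omega> (x - (v + t *\<^sub>R y)) \<partial>M)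
      = (\<integral>y. t *\<^sub>R (indicator (ball ((x - v) /\<^sub>R t) (R / t)) y *\<^sub>R \<Omega> ((x - v) /\<^sub>R t - y)) \<partial>M)"
    by (rule Bochner_Integration.integral_cong[OF refl])
      (use affine_vimage_ball[OF t, of v _ x R] in \<open>simp add: hom indicator_def\<close>)
  also have "\<dots> = t *\<^sub>R (LINT y:ball ((x - v) /\<^sub>R t) (R / t)|M. \<Omega> ((x - v) /\<^sub>R t - y))"
    by (simp only: set_lebesgue_integral_def integral_scaleR_right)
  also have "\<dots> = 0" using z R t by (simp add: symmetric_points_def)
  finally show "(LINT y:ball x R|affine_image c v t M. \<Omega> (x - y)) = 0" by simp
qed

section \<open>Blow-ups of a restricted measure\<close>

lemma radial_cut_scale:
  assumes "one_homogeneous \<Omega>" "0 < t"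
  shows "radial_cut h \<Omega> (t * r) (t *\<^sub>R z) = t *\<^sub>R radial_cut h \<Omega> r z"
  using assms by (simp add: radial_cut_def one_homogeneous_def)

text \<open>
  A small ball that meets \<open>F\<close> is contained in a ball of twice the radius centred in \<open>F\<close>; for a large ball
  the finite total mass of \<open>F\<close> is a bound. Thus restriction to \<open>F\<close> turns a growth bound at the points
  of \<open>F\<close> and at small scales into one at all points and all scales.
\<close>
lemma restricted_growth:
  fixes F :: "'a::euclidean_space set"
  assumes \<mu>: "locally_finite_borel \<mu>" and F: "compact F" and \<delta>: "0 < \<delta>" and C: "0 \<le> C" and s: "0 \<le> s"
    and growth: "\<And>x r. x \<in> F \<Longrightarrow> 0 < r \<Longrightarrow> r < \<delta> \<Longrightarrow> emeasure \<mu> (ball x r) \<le> ennreal (C * r powr s)"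
    and r: "0 < r"
  shows "emeasure (density \<mu> (indicator F)) (ball z r)
    \<le> ennreal ((C * 2 powr s + measure \<mu> F * (2 / \<delta>) powr s) * r powr s)"
proof -
  have sets [simp]: "sets \<mu> = sets borel" using locally_finite_borelD[OF \<mu>] by auto
  have Fb [simp]: "F \<in> sets borel" using F by (simp add: borel_compact)
  have Ff: "emeasure \<mu> F = ennreal (measure \<mu> F)"
    using locally_finite_borel_compact[OF \<mu> F] by (intro emeasure_eq_ennreal_measure) auto
  have eq: "emeasure (density \<mu> (indicator F)) (ball z r) = emeasure \<mu> (F \<inter> ball z r)"
    by (rule emeasure_restricted) auto
  show ?thesis
  proof (cases "r < \<delta> / 2")
    case True
    show ?thesis
    proof (cases "F \<inter> ball z r = {}")
      case False
      then obtain w where w: "w \<in> F" "dist z w < r" by auto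
      have "F \<inter> ball z r \<subseteq> ball w (2 * r)"
      proof
        fix y assume "y \<in> F \<inter> ball z r"
        then have "dist z y < r" by simp
        then show "y \<in> ball w (2 * r)" using w(2) dist_triangle3[of w y z] by simp
      qed
      then have "emeasure \<mu> (F \<inter> ball z r) \<le> emeasure \<mu> (ball w (2 * r))"
        by (rule emeasure_mono) simp
      also have "\<dots> \<le> ennreal (C * (2 * r) powr s)"
        using True r by (intro growth w) auto
      also have "\<dots> \<le> ennreal ((C * 2 powr s + measure \<mu> F * (2 / \<delta>) powr s) * r powr s)"
        using r \<delta> by (intro ennreal_leI) (simp add: powr_mult algebra_simps)
      finally show ?thesis unfolding eq .
    qed (simp add: eq)
  next
    case False
    have "1 \<le> (2 / \<delta>) * r" using False \<delta> by (simp add: field_simps)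
    then have "1 \<le> ((2 / \<delta>) * r) powr s" using s by (rule ge_one_powr_ge_zero)
    then have "1 \<le> (2 / \<delta>) powr s * r powr s" using r \<delta> by (subst (asm) powr_mult) auto
    then have "measure \<mu> F * 1 \<le> measure \<mu> F * ((2 / \<delta>) powr s * r powr s)"
      by (intro mult_left_mono) auto
    moreover have "0 \<le> C * 2 powr s * r powr s" using C by simp
    ultimately have le: "measure \<mu> F \<le> (C * 2 powr s + measure \<mu> F * (2 / \<delta>) powr s) * r powr s"
      by (simp add: algebra_simps)
    have "emeasure \<mu> (F \<inter> ball z r) \<le> emeasure \<mu> F" by (rule emeasure_mono) auto
    then show ?thesis
      unfolding eq Ff using ennreal_leI[OF le] by (rule order_trans)
  qed
qed

lemma restricted_integral:
  fixes f :: "'a::euclidean_space \<Rightarrow> 'b::euclidean_space"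
  assumes \<mu>: "locally_finite_borel \<mu>" and F: "F \<in> sets borel" and f: "f \<in> borel_measurable borel"
  shows "(\<integral>y. f y \<partial>density \<mu> (indicator F)) = (\<integral>y. indicator F y *\<^sub>R f y \<partial>\<mu>)"
proof -
  have sets: "sets \<mu> = sets borel" using locally_finite_borelD[OF \<mu>] by auto
  have "f \<in> borel_measurable \<mu>" using f sets measurable_cong_sets by blast
  moreover have "indicat_real F \<in> borel_measurable \<mu>" by (rule borel_measurable_indicator) (simp add: F sets)
  moreover have "indicator F = (\<lambda>y. ennreal (indicat_real F y))" by (auto simp: fun_eq_iff indicator_def)
  ultimately show ?thesis
    by (simp add: integral_density)
qed

lemma restricted_locally_finite:
  assumes \<mu>: "locally_finite_borel \<mu>" and F: "F \<in> sets borel"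
  shows "locally_finite_borel (density \<mu> (indicator F))"
  unfolding locally_finite_borel_def
proof (intro conjI allI)
  have sets: "sets \<mu> = sets borel" using locally_finite_borelD[OF \<mu>] by auto
  then show "sets (density \<mu> (indicator F)) = sets borel" by simp
  fix x
  obtain U where U: "open U" "x \<in> U" "emeasure \<mu> U < \<infinity>"
    using \<mu> by (auto simp: locally_finite_borel_def)
  have "emeasure (density \<mu> (indicator F)) U = emeasure \<mu> (F \<inter> U)"
    using U(1) F by (intro emeasure_restricted) (auto simp: sets)
  also have "\<dots> \<le> emeasure \<mu> U" using U(1) by (intro emeasure_mono) (auto simp: sets)
  also note U(3)
  finally show "\<exists>U. open U \<and> x \<in> U \<and> emeasure (density \<mu> (indicator F)) U < \<infinity>"
    using U by blast
qed

lemma restricted_integral_diff_le: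
  fixes f :: "'a::euclidean_space \<Rightarrow> 'b::euclidean_space"
  assumes \<mu>: "locally_finite_borel \<mu>" and F: "F \<in> sets borel" and f: "continuous_on UNIV f"
    and f0: "\<And>y. y \<notin> ball x r \<Longrightarrow> f y = 0" and b: "\<And>y. norm (f y) \<le> b"
  shows "norm ((\<integral>y. f y \<partial>\<mu>) - (\<integral>y. f y \<partial>density \<mu> (indicator F))) \<le> b * measure \<mu> (ball x r - F)"
proof -
  have sets [simp]: "sets \<mu> = sets borel" using locally_finite_borelD[OF \<mu>] by auto
  have b0: "0 \<le> b" using b[of 0] norm_ge_zero[of "f 0"] by linarith
  have i: "integrable \<mu> f"
    by (rule integrable_continuous_compact_support[OF \<mu> f compact_cball[of x r]]) (use f0 in auto)
  have iF: "integrable \<mu> (\<lambda>y. indicator F y *\<^sub>R f y)"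
    using i F by (intro integrable_mult_indicator) auto
  have "(\<integral>y. f y \<partial>\<mu>) - (\<integral>y. f y \<partial>density \<mu> (indicator F)) = (\<integral>y. f y - indicator F y *\<^sub>R f y \<partial>\<mu>)"
    using i iF by (simp add: restricted_integral[OF \<mu> F borel_measurable_continuous_onI[OF f]])
  also have "norm \<dots> \<le> (\<integral>y. b * indicator (ball x r - F) y \<partial>\<mu>)"
  proof (rule Bochner_Integration.integral_norm_bound_integral)
    show "integrable \<mu> (\<lambda>y. f y - indicator F y *\<^sub>R f y)" using i iF by simp
    have "emeasure \<mu> (ball x r - F) \<le> emeasure \<mu> (ball x r)" by (rule emeasure_mono) auto
    also have "\<dots> < \<infinity>" by (rule locally_finite_borel_ball[OF \<mu>])
    finally show "integrable \<mu> (\<lambda>y. b * indicator (ball x r - F) y)"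
      using F by (intro integrable_mult_right integrable_real_indicator) auto
    show "norm (f y - indicator F y *\<^sub>R f y) \<le> b * indicator (ball x r - F) y" for y
      using b[of y] b0 f0[of y] by (auto simp: indicator_def)
  qed
  also have "\<dots> = b * measure \<mu> (ball x r - F)" using locally_finite_borelD(2)[OF \<mu>] by simp
  finally show ?thesis .
qed

text \<open>
  The rescaled measure \<open>A \<mapsto> \<kappa> (x + r A) / r\<^sup>s\<close>.
\<close>
definition blowup :: "real \<Rightarrow> 'a::euclidean_space \<Rightarrow> real \<Rightarrow> 'a measure \<Rightarrow> 'a measure" where
  "blowup s x r \<kappa> = affine_image (r powr - s) (- (x /\<^sub>R r)) (inverse r) \<kappa>"

lemma blowup_integral:
  fixes f :: "'a::euclidean_space \<Rightarrow> 'b::{banach, second_countable_topology}"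
  assumes "sets \<kappa> = sets borel" "f \<in> borel_measurable borel"
  shows "(\<integral>y. f y \<partial>blowup s x r \<kappa>) = r powr - s *\<^sub>R (\<integral>y. f ((y - x) /\<^sub>R r) \<partial>\<kappa>)"
  unfolding blowup_def by (subst affine_image_integral[OF assms]) (simp_all add: algebra_simps)

lemma emeasure_blowup_ball:
  fixes x :: "'a::euclidean_space"
  assumes "sets \<kappa> = sets borel" "0 < r"
  shows "emeasure (blowup s x r \<kappa>) (ball z R) = ennreal (r powr - s) * emeasure \<kappa> (ball (x + r *\<^sub>R z) (r * R))"
  unfolding blowup_def using assms
  by (subst emeasure_affine_image_ball) (simp_all add: algebra_simps field_simps)

lemma blowup_growth:
  fixes x :: "'a::euclidean_space"
  assumes \<kappa>: "sets \<kappa> = sets borel" and C: "0 \<le> C"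
    and growth: "\<And>z R. 0 < R \<Longrightarrow> emeasure \<kappa> (ball z R) \<le> ennreal (C * R powr s)" and r: "0 < r" and R: "0 < R"
  shows "emeasure (blowup s x r \<kappa>) (ball z R) \<le> ennreal (C * R powr s)"
proof -
  have "emeasure (blowup s x r \<kappa>) (ball z R) \<le> ennreal (r powr - s) * ennreal (C * (r * R) powr s)"
    unfolding emeasure_blowup_ball[OF \<kappa> r] using r R by (intro mult_left_mono growth) auto
  also have "\<dots> = ennreal (r powr - s * (C * (r * R) powr s))"
    by (rule ennreal_mult'[symmetric]) simp
  also have "r powr - s * (C * (r * R) powr s) = C * R powr s"
    using r R by (simp add: powr_mult powr_minus field_simps)
  finally show ?thesis .
qed

text \<open>
  By homogeneity, the action of the blow-up at scale \<open>R\<close> and base point \<open>z\<close> is, up to the normalizing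
  factor, the action of the restricted measure at scale \<open>r R\<close> and base point \<open>x + r z\<close>. This differs from
  the action of \<open>\<mu>\<close> by the contribution of the complement of \<open>F\<close>, where the kernel is at most \<open>H L r R\<close>.
\<close>
lemma blowup_action_le:
  fixes x :: "'a::euclidean_space" and \<Omega> :: "'a \<Rightarrow> 'b::euclidean_space"
  assumes \<mu>: "locally_finite_borel \<mu>" and F: "F \<in> sets borel"
    and h: "H-lipschitz_on {0..} h" and h1: "\<forall>t\<ge>1. h t = 0"
    and \<Omega>: "L-lipschitz_on UNIV \<Omega>" "\<Omega> 0 = 0" "one_homogeneous \<Omega>"
    and r: "0 < r" and R: "0 < R" and z: "norm z + R \<le> \<rho>"
    and act: "norm (\<integral>y. radial_cut h \<Omega> (r * R) ((x + r *\<^sub>R z) - y) \<partial>\<mu>) \<le> \<epsilon>1 * (r * R) powr (s + 1)"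
    and dens: "emeasure \<mu> (ball x (r * \<rho>) - F) \<le> ennreal (\<epsilon>2 * (r * \<rho>) powr s)" and \<epsilon>2: "0 \<le> \<epsilon>2"
  shows "norm (\<integral>y. radial_cut h \<Omega> R (z - y) \<partial>blowup s x r (density \<mu> (indicator F)))
    \<le> \<epsilon>1 * R powr (s + 1) + H * L * R * \<epsilon>2 * \<rho> powr s"
proof -
  let ?\<kappa> = "density \<mu> (indicator F)"
  let ?x = "x + r *\<^sub>R z"
  let ?f = "\<lambda>y. radial_cut h \<Omega> (r * R) (?x - y)"
  have sets [simp]: "sets \<mu> = sets borel" using locally_finite_borelD[OF \<mu>] by auto
  have rR: "0 < r * R" using r R by simp
  have \<rho>: "0 < \<rho>" using z R norm_ge_zero[of z] by linarith
  have HL: "0 \<le> H * L" using lipschitz_on_nonneg[OF h] lipschitz_on_nonneg[OF \<Omega>(1)] by simp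
  have rp: "r powr - (s + 1) = inverse (r powr s * r)"
  proof -
    have "r powr (s + 1) = r powr s * r" using r by (simp add: powr_add)
    then show ?thesis by (simp only: powr_minus)
  qed
  have fc: "continuous_on UNIV ?f"
    by (intro continuous_on_compose2[OF radial_cut_continuous[OF h h1 \<Omega>(1,2) rR]] continuous_intros) auto
  have rc: "continuous_on UNIV (\<lambda>y. radial_cut h \<Omega> R (z - y))"
    by (intro continuous_on_compose2[OF radial_cut_continuous[OF h h1 \<Omega>(1,2) R]] continuous_intros) auto
  have eq: "radial_cut h \<Omega> R (z - (y - x) /\<^sub>R r) = inverse r *\<^sub>R ?f y" for y
  proof -
    have "?x - y = r *\<^sub>R (z - (y - x) /\<^sub>R r)" using r by (simp add: algebra_simps)
    then show ?thesis using radial_cut_scale[OF \<Omega>(3) r, of h R "z - (y - x) /\<^sub>R r"] r by simp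
  qed
  have "(\<integral>y. radial_cut h \<Omega> R (z - y) \<partial>blowup s x r ?\<kappa>) = r powr - s *\<^sub>R (\<integral>y. inverse r *\<^sub>R ?f y \<partial>?\<kappa>)"
    by (subst blowup_integral) (simp_all add: eq borel_measurable_continuous_onI[OF rc])
  also have "\<dots> = (r powr - s * inverse r) *\<^sub>R (\<integral>y. ?f y \<partial>?\<kappa>)" by simp
  also have "r powr - s * inverse r = r powr - (s + 1)"
    unfolding rp by (simp add: powr_minus)
  finally have "norm (\<integral>y. radial_cut h \<Omega> R (z - y) \<partial>blowup s x r ?\<kappa>) = r powr - (s + 1) * norm (\<integral>y. ?f y \<partial>?\<kappa>)"
    by simp
  also have "\<dots> \<le> r powr - (s + 1) * (\<epsilon>1 * (r * R) powr (s + 1) + H * L * (r * R) * (\<epsilon>2 * (r * \<rho>) powr s))"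
  proof (rule mult_left_mono)
    have "norm ((\<integral>y. ?f y \<partial>\<mu>) - (\<integral>y. ?f y \<partial>?\<kappa>)) \<le> H * L * (r * R) * measure \<mu> (ball x (r * \<rho>) - F)"
    proof (rule restricted_integral_diff_le[OF \<mu> F fc])
      show "norm (?f y) \<le> H * L * (r * R)" for y by (rule radial_cut_norm_le[OF h h1 \<Omega>(1,2) rR])
      fix y assume y: "y \<notin> ball x (r * \<rho>)"
      have "r * R + r * norm z \<le> r * \<rho>" using mult_left_mono[OF z, of r] r by (simp add: algebra_simps)
      also have "\<dots> \<le> norm (x - y)" using y by (simp add: dist_norm)
      also have "\<dots> \<le> norm (?x - y) + norm (r *\<^sub>R z)"
        using norm_triangle_ineq4[of "?x - y" "r *\<^sub>R z"] by (simp add: algebra_simps)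
      finally have "r * R \<le> norm (?x - y)" using r by simp
      then show "?f y = 0" by (intro radial_cut_eq_0 h1 rR)
    qed
    also have "\<dots> \<le> H * L * (r * R) * (\<epsilon>2 * (r * \<rho>) powr s)"
    proof (rule mult_left_mono)
      show "measure \<mu> (ball x (r * \<rho>) - F) \<le> \<epsilon>2 * (r * \<rho>) powr s"
        unfolding measure_def by (rule enn2real_leI[OF _ dens]) (use \<epsilon>2 in simp)
    qed (use HL rR in simp)
    finally have "norm ((\<integral>y. ?f y \<partial>\<mu>) - (\<integral>y. ?f y \<partial>?\<kappa>)) \<le> H * L * (r * R) * (\<epsilon>2 * (r * \<rho>) powr s)" .
    then show "norm (\<integral>y. ?f y \<partial>?\<kappa>) \<le> \<epsilon>1 * (r * R) powr (s + 1) + H * L * (r * R) * (\<epsilon>2 * (r * \<rho>) powr s)"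
      using act norm_triangle_sub[of "\<integral>y. ?f y \<partial>?\<kappa>" "\<integral>y. ?f y \<partial>\<mu>"] by (simp add: norm_minus_commute)
  qed simp
  also have "\<dots> = \<epsilon>1 * R powr (s + 1) + H * L * R * \<epsilon>2 * \<rho> powr s"
    unfolding rp using r R \<rho> by (simp add: powr_mult powr_add field_simps)
  finally show ?thesis .
qed

text \<open>
  Compactness gives a limit with the same growth constant as the blow-ups. If \<open>z\<close> lies in its support,
  then every ball about \<open>z\<close> eventually has positive mass for the blow-ups, and hence contains a rescaled
  point of \<open>F\<close>. There the action is small by uniformity, and it stays small when \<open>\<mu>\<close> is replaced by its
  restriction, because the complement of \<open>F\<close> has density zero at \<open>x\<close>. The origin is approximated by
  itself, since it corresponds to \<open>x\<close>.
\<close>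
lemma blowup_limit_symmetric:
  fixes x :: "'a::euclidean_space" and \<Omega> :: "'a \<Rightarrow> 'b::euclidean_space"
  assumes \<mu>: "locally_finite_borel \<mu>" and F: "compact F" and s: "0 \<le> s"
    and \<delta>: "0 < \<delta>" and C: "0 \<le> C"
    and growth: "\<And>x r. x \<in> F \<Longrightarrow> 0 < r \<Longrightarrow> r < \<delta> \<Longrightarrow> emeasure \<mu> (ball x r) \<le> ennreal (C * r powr s)"
    and \<eta>: "cutoff_family \<eta>"
    and \<Omega>: "L-lipschitz_on UNIV \<Omega>" "\<Omega> 0 = 0" "one_homogeneous \<Omega>"
    and act: "\<And>(m::nat) \<epsilon>. 0 < \<epsilon> \<Longrightarrow> \<exists>d>0. \<forall>z\<in>F. \<forall>r\<in>{0<..<d}.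
      norm (\<integral>y. radial_cut (\<eta> (1 / (real m + 2))) \<Omega> r (z - y) \<partial>\<mu>) \<le> \<epsilon> * r powr (s + 1)"
    and x: "x \<in> F"
    and dens: "\<And>\<epsilon>. 0 < \<epsilon> \<Longrightarrow> \<forall>\<^sub>F r in at_right 0. emeasure \<mu> (ball x r - F) \<le> ennreal (\<epsilon> * r powr s)"
    and r: "\<And>n. 0 < r n" "r \<longlonglongrightarrow> 0"
  obtains \<sigma> \<nu> C' where "strict_mono (\<sigma> :: nat \<Rightarrow> nat)" "locally_finite_borel \<nu>" "0 \<le> C'"
    "\<And>n z R. 0 < R \<Longrightarrow> emeasure (blowup s x (r n) (density \<mu> (indicator F))) (ball z R) \<le> ennreal (C' * R powr s)"
    "\<And>z R. 0 < R \<Longrightarrow> emeasure \<nu> (ball z R) \<le> ennreal (C' * R powr s)"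
    "symmetric_measure \<Omega> \<nu>" "0 \<in> symmetric_points \<Omega> \<nu>"
    "vaguely_converges (\<lambda>n. blowup s x (r (\<sigma> n)) (density \<mu> (indicator F))) \<nu>"
proof -
  have Fb: "F \<in> sets borel" using F by (simp add: borel_compact)
  define \<kappa> where "\<kappa> = density \<mu> (indicator F)"
  have \<kappa>: "locally_finite_borel \<kappa>" unfolding \<kappa>_def by (rule restricted_locally_finite[OF \<mu> Fb])
  have \<kappa>s: "sets \<kappa> = sets borel" by (rule locally_finite_borelD[OF \<kappa>])
  define C' where "C' = C * 2 powr s + measure \<mu> F * (2 / \<delta>) powr s"
  have C': "0 \<le> C'" using C by (simp add: C'_def)
  have \<kappa>g: "emeasure \<kappa> (ball z R) \<le> ennreal (C' * R powr s)" if "0 < R" for z R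
    unfolding \<kappa>_def C'_def by (rule restricted_growth[OF \<mu> F \<delta> C s growth that])
  define M where "M n = blowup s x (r n) \<kappa>" for n
  have Mlf: "locally_finite_borel (M n)" for n
    unfolding M_def blowup_def using r(1) by (intro affine_image_locally_finite[OF \<kappa>]) simp
  have Mg: "emeasure (M n) (ball z R) \<le> ennreal (C' * R powr s)" if "0 < R" for n z R
    unfolding M_def by (rule blowup_growth[OF \<kappa>s C' \<kappa>g r(1) that])
  obtain \<sigma> \<nu> where \<sigma>: "strict_mono (\<sigma> :: nat \<Rightarrow> nat)" and \<nu>: "locally_finite_borel \<nu>"
    and conv: "vaguely_converges (\<lambda>n. M (\<sigma> n)) \<nu>"
    using vague_sequential_compactness[of M C' s] locally_finite_borelD(1)[OF Mlf] C' s Mg by metis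
  have \<nu>g: "emeasure \<nu> (ball z R) \<le> ennreal (C' * R powr s)" if "0 < R" for z R
    using C' by (intro vague_limit_ball_le[OF Mlf \<nu> conv] Mg[OF that]) simp
  have rs: "filterlim (\<lambda>n. r (\<sigma> n)) (at_right 0) sequentially"
    using LIMSEQ_subseq_LIMSEQ[OF r(2) \<sigma>] r(1)
    by (intro tendsto_imp_filterlim_at_right always_eventually allI) (simp_all add: comp_def)
  have sym: "z \<in> symmetric_points \<Omega> \<nu>"
    if near: "\<And>\<epsilon>. 0 < \<epsilon> \<Longrightarrow> \<forall>\<^sub>F n in sequentially. \<exists>z'. dist z z' < \<epsilon> \<and> x + r (\<sigma> n) *\<^sub>R z' \<in> F" for z
    unfolding symmetric_points_def
  proof (intro CollectI allI impI)
    fix R :: real assume R: "0 < R"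
    show "(LINT y:ball z R|\<nu>. \<Omega> (z - y)) = 0"
    proof (rule radial_cuts_zero_imp_ball_zero[OF \<nu> \<eta> \<Omega>(1,2) R])
      fix m :: nat
      define \<tau> :: real where "\<tau> = 1 / (real m + 2)"
      have \<tau>: "0 < \<tau>" "\<tau> < 1" by (auto simp: \<tau>_def field_simps)
      note cut = cutoff_familyD[OF \<eta> \<tau>]
      have HL: "0 \<le> 1 / \<tau> * L" using \<tau> lipschitz_on_nonneg[OF \<Omega>(1)] by simp
      have "(\<integral>y. radial_cut (\<eta> \<tau>) \<Omega> R (z - y) \<partial>\<nu>) = 0"
      proof (rule vague_limit_action_zero[OF Mlf \<nu> conv cut(1) cut(3) \<Omega>(1,2) R])
        show "measure (M (\<sigma> n)) (ball z (R + 1)) \<le> C' * (R + 1) powr s" for n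
          unfolding measure_def using C' R by (intro enn2real_leI Mg) auto
        fix \<epsilon> :: real assume \<epsilon>: "0 < \<epsilon>" "\<epsilon> < 1"
        define \<rho> where "\<rho> = norm z + 1 + R"
        have \<rho>: "0 < \<rho>" using R by (simp add: \<rho>_def add_nonneg_pos add_pos_nonneg)
        \<comment> \<open>The tolerances are such that each of the two terms of \<open>blowup_action_le\<close> is at most \<open>\<epsilon> / 2\<close>.
          The radius \<open>\<rho>\<close> leaves room for every \<open>z'\<close> within distance \<open>1\<close> of \<open>z\<close>.\<close>
        define \<epsilon>1 where "\<epsilon>1 = \<epsilon> / 2 / R powr (s + 1)"
        define K where "K = 1 / \<tau> * L * R * \<rho> powr s"
        have K: "0 \<le> K" unfolding K_def using HL R by (intro mult_nonneg_nonneg[OF mult_nonneg_nonneg[OF HL]]) auto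
        define \<epsilon>2 where "\<epsilon>2 = \<epsilon> / 2 / (K + 1)"
        have \<epsilon>12: "0 < \<epsilon>1" "0 < \<epsilon>2" using \<epsilon> R K by (auto simp: \<epsilon>1_def \<epsilon>2_def)
        obtain d where d: "0 < d" "\<forall>z\<in>F. \<forall>r\<in>{0<..<d}.
            norm (\<integral>y. radial_cut (\<eta> \<tau>) \<Omega> r (z - y) \<partial>\<mu>) \<le> \<epsilon>1 * r powr (s + 1)"
          using act[OF \<epsilon>12(1), of m, folded \<tau>_def] by (elim exE conjE) (rule that)
        have "\<forall>\<^sub>F t in at_right 0. t * R < d"
          unfolding eventually_at_right_field using R d(1)
          by (intro exI[of _ "d / R"]) (auto simp: pos_less_divide_eq)
        then have e1: "\<forall>\<^sub>F n in sequentially. r (\<sigma> n) * R < d"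
          by (rule eventually_compose_filterlim[OF _ rs])
        obtain b where b: "0 < b" "\<And>t. 0 < t \<Longrightarrow> t < b \<Longrightarrow> emeasure \<mu> (ball x t - F) \<le> ennreal (\<epsilon>2 * t powr s)"
          using dens[OF \<epsilon>12(2)] unfolding eventually_at_right_field by blast
        have "\<forall>\<^sub>F t in at_right 0. emeasure \<mu> (ball x (t * \<rho>) - F) \<le> ennreal (\<epsilon>2 * (t * \<rho>) powr s)"
          unfolding eventually_at_right_field using \<rho> b
          by (intro exI[of _ "b / \<rho>"]) (auto simp: pos_less_divide_eq)
        then have e2: "\<forall>\<^sub>F n in sequentially. emeasure \<mu> (ball x (r (\<sigma> n) * \<rho>) - F) \<le> ennreal (\<epsilon>2 * (r (\<sigma> n) * \<rho>) powr s)"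
          by (rule eventually_compose_filterlim[OF _ rs])
        show "\<forall>\<^sub>F n in sequentially. \<exists>z'. dist z z' < \<epsilon> \<and> norm (\<integral>y. radial_cut (\<eta> \<tau>) \<Omega> R (z' - y) \<partial>M (\<sigma> n)) \<le> \<epsilon>"
          using near[OF \<epsilon>(1)] e1 e2
        proof eventually_elim
          case (elim n)
          then obtain z' where z': "dist z z' < \<epsilon>" "x + r (\<sigma> n) *\<^sub>R z' \<in> F" by blast
          have nz: "norm z' + R \<le> \<rho>"
            using z'(1) \<epsilon>(2) norm_triangle_sub[of z' z] by (simp add: \<rho>_def dist_norm norm_minus_commute)
          have "norm (\<integral>y. radial_cut (\<eta> \<tau>) \<Omega> R (z' - y) \<partial>M (\<sigma> n))
              \<le> \<epsilon>1 * R powr (s + 1) + 1 / \<tau> * L * R * \<epsilon>2 * \<rho> powr s"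
            unfolding M_def \<kappa>_def
          proof (rule blowup_action_le[OF \<mu> Fb cut(1) cut(3) \<Omega> r(1) R nz _ elim(3)])
            have "r (\<sigma> n) * R \<in> {0<..<d}" using elim(2) r(1) R by simp
            then show "norm (\<integral>y. radial_cut (\<eta> \<tau>) \<Omega> (r (\<sigma> n) * R) (x + r (\<sigma> n) *\<^sub>R z' - y) \<partial>\<mu>)
                \<le> \<epsilon>1 * (r (\<sigma> n) * R) powr (s + 1)"
              using d(2) z'(2) by blast
          qed (use less_imp_le[OF \<epsilon>12(2)] in auto)
          also have "\<epsilon>1 * R powr (s + 1) = \<epsilon> / 2" using R by (simp add: \<epsilon>1_def)
          also have "1 / \<tau> * L * R * \<epsilon>2 * \<rho> powr s = K * \<epsilon>2" by (simp add: K_def)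
          also have "K * \<epsilon>2 \<le> (K + 1) * \<epsilon>2" using \<epsilon>12 by (intro mult_right_mono) auto
          also have "(K + 1) * \<epsilon>2 = \<epsilon> / 2"
          proof -
            have "K + 1 \<noteq> 0" using K by simp
            from iffD1[OF nonzero_eq_divide_eq[OF this] \<epsilon>2_def] show ?thesis by (simp only: mult.commute)
          qed
          finally show ?case using z'(1) by auto
        qed
      qed
      then show "(\<integral>y. radial_cut (\<eta> (1 / (real m + 2))) \<Omega> R (z - y) \<partial>\<nu>) = 0" by (simp add: \<tau>_def)
    qed
  qed
  have "symmetric_measure \<Omega> \<nu>"
    unfolding symmetric_measure_def
  proof
    fix z assume z: "z \<in> closed_support \<nu>"
    show "z \<in> symmetric_points \<Omega> \<nu>"
    proof (rule sym)
      fix \<epsilon> :: real assume \<epsilon>: "0 < \<epsilon>"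
      show "\<forall>\<^sub>F n in sequentially. \<exists>z'. dist z z' < \<epsilon> \<and> x + r (\<sigma> n) *\<^sub>R z' \<in> F"
        using vague_limit_support[OF Mlf \<nu> conv z \<epsilon>]
      proof eventually_elim
        case (elim n)
        let ?r = "r (\<sigma> n)"
        have "0 < emeasure \<kappa> (ball (x + ?r *\<^sub>R z) (?r * \<epsilon>))"
          using elim unfolding M_def emeasure_blowup_ball[OF \<kappa>s r(1)] by (auto simp: zero_less_iff_neq_zero)
        also have "\<dots> = emeasure \<mu> (F \<inter> ball (x + ?r *\<^sub>R z) (?r * \<epsilon>))"
          unfolding \<kappa>_def by (rule emeasure_restricted) (auto simp: Fb locally_finite_borelD[OF \<mu>])
        finally have "F \<inter> ball (x + ?r *\<^sub>R z) (?r * \<epsilon>) \<noteq> {}" by auto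
        then obtain w where w: "w \<in> F" "dist (x + ?r *\<^sub>R z) w < ?r * \<epsilon>" by auto
        have eq: "x + ?r *\<^sub>R ((w - x) /\<^sub>R ?r) = w" using r(1)[of "\<sigma> n"] by simp
        have "x + ?r *\<^sub>R z - w = ?r *\<^sub>R (z - (w - x) /\<^sub>R ?r)"
          using r(1)[of "\<sigma> n"] by (simp add: algebra_simps)
        then have "dist (x + ?r *\<^sub>R z) w = ?r * dist z ((w - x) /\<^sub>R ?r)"
          using r(1)[of "\<sigma> n"] by (simp add: dist_norm)
        then have "dist z ((w - x) /\<^sub>R ?r) < \<epsilon>" using w(2) r(1)[of "\<sigma> n"] by simp
        then show ?case using w(1) eq by (intro exI[of _ "(w - x) /\<^sub>R ?r"]) simp
      qed
    qed
  qed
  moreover have "0 \<in> symmetric_points \<Omega> \<nu>"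
    by (rule sym, rule always_eventually) (auto intro!: exI[of _ 0] simp: x)
  ultimately show ?thesis
    using that[OF \<sigma> \<nu> C' _ \<nu>g] Mg conv unfolding M_def \<kappa>_def by blast
qed

section \<open>Transport numbers along a blow-up sequence\<close>

lemma smooth_cutoffD:
  assumes "smooth_cutoff \<phi>"
  shows "continuous_on {0..} \<phi>" "\<And>t. 0 \<le> t \<Longrightarrow> 0 \<le> \<phi> t" "\<And>t. 0 \<le> t \<Longrightarrow> \<phi> t \<le> 1"
    "\<forall>t\<in>{0..3}. \<phi> t = 1" "\<And>t. 4 \<le> t \<Longrightarrow> \<phi> t = 0"
proof -
  obtain D :: "nat \<Rightarrow> real \<Rightarrow> real" where D: "\<And>t. 0 \<le> t \<Longrightarrow> D 0 t = \<phi> t"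
    "\<And>k t. 0 \<le> t \<Longrightarrow> (D k has_real_derivative D (Suc k) t) (at t within {0..})"
    using assms unfolding smooth_cutoff_def smooth_on_half_line_def by blast
  have "continuous_on {0..} (D 0)"
    unfolding continuous_on_eq_continuous_within
    using D(2)[of _ 0] by (auto intro: DERIV_continuous)
  then show "continuous_on {0..} \<phi>"
    by (rule continuous_on_eq) (use D(1) in auto)
  show "\<And>t. 0 \<le> t \<Longrightarrow> 0 \<le> \<phi> t" "\<And>t. 0 \<le> t \<Longrightarrow> \<phi> t \<le> 1" "\<forall>t\<in>{0..3}. \<phi> t = 1"
    using assms by (auto simp: smooth_cutoff_def)
  fix t :: real assume t: "4 \<le> t"
  have sub: "{t\<in>{0..}. \<phi> t \<noteq> 0} \<subseteq> {0..<4}"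
    by (rule order_trans[OF closure_subset]) (use assms in \<open>simp add: smooth_cutoff_def\<close>)
  show "\<phi> t = 0"
  proof (rule ccontr)
    assume "\<phi> t \<noteq> 0"
    then have "t \<in> {t\<in>{0..}. \<phi> t \<noteq> 0}" using t by simp
    then have "t \<in> {0..<4}" by (rule subsetD[OF sub])
    then show False using t by simp
  qed
qed

text \<open>
  The test functions vary with \<open>n\<close>, so vague convergence alone is not enough. By Arzela and Ascoli a
  subsequence converges uniformly to a limit \<open>G\<close>; replacing the test functions by \<open>G\<close> costs an error
  that is small uniformly in the measure, and for \<open>G\<close> vague convergence applies.
\<close>
lemma lipschitz_family_uniform_convergence:
  fixes g :: "nat \<Rightarrow> 'a::euclidean_space \<Rightarrow> real"
  assumes M: "\<And>n. locally_finite_borel (M n)" and \<nu>: "locally_finite_borel \<nu>"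
    and conv: "vaguely_converges M \<nu>"
    and c: "\<And>n. measure (M n) (ball 0 4) \<le> c" "measure \<nu> (ball 0 4) \<le> c"
    and \<psi>: "continuous_on UNIV \<psi>" "\<And>y. \<bar>\<psi> y\<bar> \<le> 1"
    and g: "\<And>n. 1-lipschitz_on UNIV (g n)" "\<And>n y. y \<notin> ball 0 4 \<Longrightarrow> g n y = 0" "\<And>n y. \<bar>g n y\<bar> \<le> b"
  obtains k where "strict_mono (k :: nat \<Rightarrow> nat)"
    "(\<lambda>n. (\<integral>y. \<psi> y * g (k n) y \<partial>M (k n)) - (\<integral>y. \<psi> y * g (k n) y \<partial>\<nu>)) \<longlonglongrightarrow> 0"
proof -
  let ?S = "cball (0::'a) 4"
  obtain g0 k where k: "strict_mono (k :: nat \<Rightarrow> nat)"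
    and lim: "\<And>e. 0 < e \<Longrightarrow> \<exists>N. \<forall>n x. N \<le> n \<and> x \<in> ?S \<longrightarrow> norm (g (k n) x - g0 x) < e"
  proof (rule Arzela_Ascoli[of ?S g b])
    show "norm (g n x) \<le> b" for n x using g(3) by simp
    show "\<exists>d>0. \<forall>n y. y \<in> ?S \<and> norm (x - y) < d \<longrightarrow> norm (g n x - g n y) < e" if "0 < e" for x and e :: real
      using that lipschitz_onD[OF g(1), of x] by (intro exI[of _ e]) (auto simp: dist_norm intro: le_less_trans)
  qed (auto intro: compact_cball)
  define G where "G y = (if y \<in> ?S then g0 y else 0)" for y
  have lim': "\<exists>N. \<forall>n\<ge>N. \<forall>y. \<bar>g (k n) y - G y\<bar> < e" if e: "0 < e" for e
  proof -
    obtain N where N: "\<And>n x. N \<le> n \<Longrightarrow> x \<in> ?S \<Longrightarrow> norm (g (k n) x - g0 x) < e"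
      using lim[OF e] by blast
    have "\<bar>g (k n) y - G y\<bar> < e" if "N \<le> n" for n y
      using N[OF that, of y] g(2)[of y "k n"] e by (cases "y \<in> ?S") (auto simp: G_def)
    then show ?thesis by blast
  qed
  have "uniform_limit UNIV (\<lambda>n. g (k n)) G sequentially"
    unfolding uniform_limit_iff eventually_sequentially dist_real_def using lim' by blast
  then have Gc: "continuous_on UNIV G"
    by (rule uniform_limit_theorem[rotated])
      (auto intro!: always_eventually lipschitz_on_continuous_on[OF g(1)])
  have G0: "G y = 0" if "y \<notin> ?S" for y using that by (simp add: G_def)
  have g0: "g n y = 0" if "y \<notin> ?S" for n y using that by (intro g(2)) auto
  have int: "integrable N (\<lambda>y. \<psi> y * f y)"
    if "locally_finite_borel N" "continuous_on UNIV f" "\<And>y. y \<notin> ?S \<Longrightarrow> f y = 0" for N and f :: "'a \<Rightarrow> real"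
    by (rule integrable_continuous_compact_support[OF that(1) continuous_on_mult[OF \<psi>(1) that(2)] compact_cball[of 0 4]])
      (use that(3) in simp)
  have gc: "continuous_on UNIV (g n)" for n by (rule lipschitz_on_continuous_on[OF g(1)])
  have Glim: "(\<lambda>n. \<integral>y. \<psi> y * G y \<partial>M (k n)) \<longlonglongrightarrow> (\<integral>y. \<psi> y * G y \<partial>\<nu>)"
  proof -
    have "(\<lambda>n. \<integral>y. \<psi> y * G y \<partial>M n) \<longlonglongrightarrow> (\<integral>y. \<psi> y * G y \<partial>\<nu>)"
      by (rule vaguely_converges_vector[OF M \<nu> conv continuous_on_mult[OF \<psi>(1) Gc] compact_cball[of 0 4]])
        (use G0 in simp)
    from LIMSEQ_subseq_LIMSEQ[OF this k] show ?thesis by (simp add: comp_def)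
  qed
  have Gout: "G y = 0" if y: "y \<notin> ball 0 4" for y
  proof -
    have "\<bar>G y\<bar> \<le> 0 + e" if e: "0 < e" for e
    proof -
      obtain N where "\<forall>n\<ge>N. \<forall>y. \<bar>g (k n) y - G y\<bar> < e" using lim'[OF e] by blast
      then have "\<bar>g (k N) y - G y\<bar> < e" by blast
      then show ?thesis using g(2)[OF y] by simp
    qed
    then have "\<bar>G y\<bar> \<le> 0" by (rule field_le_epsilon)
    then show ?thesis by simp
  qed
  have c0: "0 \<le> c" using c(2) by (rule order_trans[rotated]) simp
  have diff: "\<bar>(\<integral>y. \<psi> y * g (k n) y \<partial>N) - (\<integral>y. \<psi> y * G y \<partial>N)\<bar> \<le> e * c"
    if N: "locally_finite_borel N" "measure N (ball 0 4) \<le> c" and e: "\<And>y. \<bar>g (k n) y - G y\<bar> < e" for N n e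
  proof -
    have e0: "0 \<le> e" using e[of 0] by linarith
    have "(\<integral>y. \<psi> y * g (k n) y \<partial>N) - (\<integral>y. \<psi> y * G y \<partial>N) = (\<integral>y. \<psi> y * g (k n) y - \<psi> y * G y \<partial>N)"
      by (rule Bochner_Integration.integral_diff[symmetric]) (intro int N gc Gc g0 G0; assumption)+
    also have "\<bar>\<dots>\<bar> \<le> (\<integral>y. e * indicator (ball 0 4) y \<partial>N)"
      unfolding real_norm_def[symmetric]
    proof (rule Bochner_Integration.integral_norm_bound_integral)
      show "integrable N (\<lambda>y. \<psi> y * g (k n) y - \<psi> y * G y)"
        by (rule Bochner_Integration.integrable_diff) (intro int N gc Gc g0 G0; assumption)+
      show "integrable N (\<lambda>y. e * indicator (ball 0 4) y)"
        using locally_finite_borel_ball[OF N(1)] locally_finite_borelD[OF N(1)]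
        by (intro integrable_mult_right integrable_real_indicator) auto
      fix y
      show "norm (\<psi> y * g (k n) y - \<psi> y * G y) \<le> e * indicator (ball 0 4) y"
      proof (cases "y \<in> ball 0 4")
        case True
        have "norm (\<psi> y * g (k n) y - \<psi> y * G y) = \<bar>\<psi> y\<bar> * \<bar>g (k n) y - G y\<bar>"
          by (simp add: abs_mult[symmetric] right_diff_distrib)
        also have "\<dots> \<le> 1 * e" using \<psi>(2)[of y] e[of y] by (intro mult_mono) auto
        finally show ?thesis using True by simp
      next
        case False
        then show ?thesis using g(2)[OF False] Gout[OF False] e0 by simp
      qed
    qed
    also have "\<dots> = e * measure N (ball 0 4)" using locally_finite_borelD[OF N(1)] by simp
    also have "\<dots> \<le> e * c" using N(2) e0 by (rule mult_left_mono)
    finally show ?thesis .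
  qed
  have "(\<lambda>n. (\<integral>y. \<psi> y * g (k n) y \<partial>M (k n)) - (\<integral>y. \<psi> y * g (k n) y \<partial>\<nu>)) \<longlonglongrightarrow> 0"
  proof (rule LIMSEQ_I)
    fix \<epsilon> :: real assume \<epsilon>: "0 < \<epsilon>"
    define e where "e = \<epsilon> / 3 / (c + 1)"
    have e: "0 < e" using \<epsilon> c0 by (simp add: e_def)
    have "e * c \<le> e * (c + 1)" using e by (intro mult_left_mono) auto
    also have "\<dots> = \<epsilon> / 3"
      by (rule iffD1[OF nonzero_eq_divide_eq e_def]) (use c0 in simp)
    finally have ec: "e * c \<le> \<epsilon> / 3" .
    obtain N1 where N1: "\<And>n y. N1 \<le> n \<Longrightarrow> \<bar>g (k n) y - G y\<bar> < e" using lim'[OF e] by blast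
    obtain N2 where N2: "\<And>n. N2 \<le> n \<Longrightarrow> norm ((\<integral>y. \<psi> y * G y \<partial>M (k n)) - (\<integral>y. \<psi> y * G y \<partial>\<nu>)) < \<epsilon> / 3"
      using LIMSEQ_D[OF Glim, of "\<epsilon> / 3"] \<epsilon> by auto
    have "norm ((\<integral>y. \<psi> y * g (k n) y \<partial>M (k n)) - (\<integral>y. \<psi> y * g (k n) y \<partial>\<nu>) - 0) < \<epsilon>" if n: "max N1 N2 \<le> n" for n
    proof -
      have "N1 \<le> n" "N2 \<le> n" using n by auto
      then show ?thesis
        using diff[OF M[of "k n"] c(1)[of "k n"] N1[OF \<open>N1 \<le> n\<close>]] diff[OF \<nu> c(2) N1[OF \<open>N1 \<le> n\<close>]] N2[of n] ec
        unfolding real_norm_def by linarith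
    qed
    then show "\<exists>no. \<forall>n\<ge>no. norm ((\<integral>y. \<psi> y * g (k n) y \<partial>M (k n)) - (\<integral>y. \<psi> y * g (k n) y \<partial>\<nu>) - 0) < \<epsilon>"
      by blast
  qed
  then show ?thesis using that[OF k] by blast
qed

text \<open>
  All terms are brought to unit scale. Write \<open>X\<close>, \<open>B\<close> for the integrals of \<open>\<phi> f\<close> and of \<open>\<phi>\<close> against the
  blow-up and \<open>Y\<close>, \<open>A\<close> for those against \<open>\<nu>\<close>. A test function is bounded by \<open>8\<close>, because it vanishes at
  distance \<open>4 r\<close> from \<open>x\<close>. Replacing \<open>\<mu>\<close> by its restriction therefore changes \<open>X\<close> by at most \<open>8 D\<close> and \<open>B\<close>
  by at most \<open>D\<close>. The normalizing constant cancels the factor \<open>a\<close> and turns \<open>Y\<close> into \<open>B' Y / A\<close>, where \<open>B'\<close> is the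
  counterpart of \<open>B\<close> for \<open>\<mu>\<close>; since \<open>\<bar>Y\<bar> \<le> 8 A\<close>, this differs from \<open>Y\<close> by at most \<open>8 \<bar>A - B'\<bar>\<close>, that is
  by at most \<open>8 \<bar>A - B\<bar> + 8 D\<close>.
\<close>
lemma transport_term_le:
  fixes \<mu> \<nu> :: "'a::euclidean_space measure"
  assumes \<mu>: "locally_finite_borel \<mu>" and F: "F \<in> sets borel" and \<phi>: "smooth_cutoff \<phi>"
    and r: "0 < r" and \<nu>: "locally_finite_borel \<nu>" and a: "0 < a"
    and f: "f \<in> Lip0 (ball x (4 * r))" "(1 / r)-lipschitz_on UNIV f"
    and D: "measure \<mu> (ball x (4 * r) - F) \<le> D * r powr s"
  shows "\<bar>1 / r powr s * ((\<integral>y. \<phi> (norm (y - x) / r) * f y \<partial>\<mu>)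
      - normalizing_const \<phi> \<mu> (affine_image a x r \<nu>) x r * (\<integral>y. \<phi> (norm (y - x) / r) * f y \<partial>affine_image a x r \<nu>))\<bar>
    \<le> \<bar>(\<integral>y. \<phi> (norm y) * f (x + r *\<^sub>R y) \<partial>blowup s x r (density \<mu> (indicator F)))
        - (\<integral>y. \<phi> (norm y) * f (x + r *\<^sub>R y) \<partial>\<nu>)\<bar>
      + 8 * \<bar>(\<integral>y. \<phi> (norm y) \<partial>blowup s x r (density \<mu> (indicator F))) - (\<integral>y. \<phi> (norm y) \<partial>\<nu>)\<bar> + 16 * D"
proof -
  note cut = smooth_cutoffD[OF \<phi>]
  have fc: "continuous_on UNIV f" by (rule lipschitz_on_continuous_on[OF f(2)])
  have f0: "f y = 0" if "y \<notin> ball x (4 * r)" for y using f(1) that by (auto simp: Lip0_def)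
  have f8: "\<bar>f y\<bar> \<le> 8" for y
  proof (cases "y \<in> ball x (4 * r)")
    case True
    \<comment> \<open>Any point at distance \<open>4 * r\<close> from \<open>x\<close> will do: it is a zero of \<open>f\<close> within \<open>8 * r\<close> of \<open>y\<close>.\<close>
    obtain e :: 'a where "e \<in> Basis" using nonempty_Basis by blast
    then have e: "norm e = 1" by simp
    let ?p = "x + (4 * r) *\<^sub>R e"
    have xp: "dist x ?p = 4 * r" using e r by (simp add: dist_norm)
    have "dist y ?p \<le> dist x y + dist x ?p" using dist_triangle3[of y ?p x] by simp
    also have "\<dots> \<le> 8 * r" using True xp by simp
    finally have d: "dist y ?p \<le> 8 * r" .
    have "f ?p = 0" by (rule f0) (simp add: xp)
    then have "\<bar>f y\<bar> \<le> 1 / r * dist y ?p" using lipschitz_onD[OF f(2), of y ?p] by (simp add: dist_real_def)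
    also have "\<dots> \<le> 1 / r * (8 * r)" using d r by (intro mult_left_mono) auto
    finally show ?thesis using r by simp
  qed (simp add: f0)
  have \<psi>c: "continuous_on UNIV (\<lambda>y::'a. \<phi> (norm y))"
    by (rule continuous_on_compose2[OF cut(1)]) (auto intro: continuous_intros)
  have \<phi>c: "continuous_on UNIV (\<lambda>y. \<phi> (norm (y - x) / r))"
    by (rule continuous_on_compose2[OF cut(1)]) (use r in \<open>auto intro!: continuous_intros\<close>)
  have \<psi>01: "0 \<le> \<phi> (norm y)" "\<phi> (norm y) \<le> 1" for y :: 'a using cut(2,3) by auto
  have \<phi>01: "0 \<le> \<phi> (norm (y - x) / r)" "\<phi> (norm (y - x) / r) \<le> 1" for y using cut(2,3) r by auto
  have \<psi>0: "\<phi> (norm y) = 0" if "y \<notin> ball 0 4" for y :: 'a using that by (intro cut(5)) simp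
  have \<phi>0: "\<phi> (norm (y - x) / r) = 0" if "y \<notin> ball x (4 * r)" for y
    using that r by (intro cut(5)) (simp add: dist_norm norm_minus_commute pos_le_divide_eq)
  define g where "g y = f (x + r *\<^sub>R y)" for y
  have gc: "continuous_on UNIV g"
    unfolding g_def by (intro continuous_on_compose2[OF fc] continuous_intros) auto
  have g8: "\<bar>g y\<bar> \<le> 8" for y unfolding g_def by (rule f8)
  define \<kappa> where "\<kappa> = density \<mu> (indicator F)"
  have \<kappa>s: "sets \<kappa> = sets borel" by (simp add: \<kappa>_def locally_finite_borelD[OF \<mu>])
  define M where "M = blowup s x r \<kappa>"
  define N where "N = affine_image a x r \<nu>"
  define q where "q = 1 / r powr s"
  have q: "0 < q" "q = r powr - s" using r by (auto simp: q_def powr_minus divide_inverse)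
  have unscale: "norm ((y - x) /\<^sub>R r) = norm (y - x) / r" "x + r *\<^sub>R ((y - x) /\<^sub>R r) = y" for y
    using r by (simp_all add: divide_inverse mult.commute)
  have fwd: "norm (x + r *\<^sub>R y - x) / r = norm y" for y using r by simp
  let ?X1 = "\<integral>y. \<phi> (norm (y - x) / r) * f y \<partial>\<mu>" and ?B1 = "\<integral>y. \<phi> (norm (y - x) / r) \<partial>\<mu>"
  let ?X = "\<integral>y. \<phi> (norm y) * g y \<partial>M" and ?Y = "\<integral>y. \<phi> (norm y) * g y \<partial>\<nu>"
  let ?B = "\<integral>y. \<phi> (norm y) \<partial>M" and ?A = "\<integral>y. \<phi> (norm y) \<partial>\<nu>"
  have X: "?X = q * (\<integral>y. \<phi> (norm (y - x) / r) * f y \<partial>\<kappa>)"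
    unfolding M_def
    by (subst blowup_integral[OF \<kappa>s borel_measurable_continuous_onI[OF continuous_on_mult[OF \<psi>c gc]]])
      (simp only: g_def unscale q(2) real_scaleR_def)
  have B: "?B = q * (\<integral>y. \<phi> (norm (y - x) / r) \<partial>\<kappa>)"
    unfolding M_def
    by (subst blowup_integral[OF \<kappa>s borel_measurable_continuous_onI[OF \<psi>c]])
      (simp only: unscale q(2) real_scaleR_def)
  have qD: "q * measure \<mu> (ball x (4 * r) - F) \<le> D"
    using mult_left_mono[OF D, of q] q(1) r by (simp add: q_def)
  have XX: "\<bar>q * ?X1 - ?X\<bar> \<le> 8 * D"
  proof -
    have "norm (?X1 - (\<integral>y. \<phi> (norm (y - x) / r) * f y \<partial>\<kappa>)) \<le> 8 * measure \<mu> (ball x (4 * r) - F)"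
      unfolding \<kappa>_def
    proof (rule restricted_integral_diff_le[OF \<mu> F continuous_on_mult[OF \<phi>c fc]])
      show "norm (\<phi> (norm (y - x) / r) * f y) \<le> 8" for y
        using mult_mono[OF \<phi>01(2)[of y] f8[of y]] \<phi>01(1)[of y] by (simp add: abs_mult)
    qed (simp add: f0)
    then have "q * norm (?X1 - (\<integral>y. \<phi> (norm (y - x) / r) * f y \<partial>\<kappa>)) \<le> q * (8 * measure \<mu> (ball x (4 * r) - F))"
      using q(1) by (intro mult_left_mono) auto
    moreover have "\<bar>q * ?X1 - ?X\<bar> = q * norm (?X1 - (\<integral>y. \<phi> (norm (y - x) / r) * f y \<partial>\<kappa>))"
      unfolding X using q(1) by (simp add: right_diff_distrib[symmetric] abs_mult)
    ultimately show ?thesis using qD by linarith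
  qed
  have BB: "\<bar>q * ?B1 - ?B\<bar> \<le> D"
  proof -
    have "norm (?B1 - (\<integral>y. \<phi> (norm (y - x) / r) \<partial>\<kappa>)) \<le> 1 * measure \<mu> (ball x (4 * r) - F)"
      unfolding \<kappa>_def
      by (rule restricted_integral_diff_le[OF \<mu> F \<phi>c]) (use \<phi>0 \<phi>01 in simp_all)
    then have "q * norm (?B1 - (\<integral>y. \<phi> (norm (y - x) / r) \<partial>\<kappa>)) \<le> q * measure \<mu> (ball x (4 * r) - F)"
      using q(1) by (intro mult_left_mono) auto
    moreover have "\<bar>q * ?B1 - ?B\<bar> = q * norm (?B1 - (\<integral>y. \<phi> (norm (y - x) / r) \<partial>\<kappa>))"
      unfolding B using q(1) by (simp add: right_diff_distrib[symmetric] abs_mult)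
    ultimately show ?thesis using qD by linarith
  qed
  have Nf: "(\<integral>y. \<phi> (norm (y - x) / r) * f y \<partial>N) = a * ?Y"
    unfolding N_def using a
    by (subst affine_image_integral[OF locally_finite_borelD(1)[OF \<nu>] borel_measurable_continuous_onI[OF continuous_on_mult[OF \<phi>c fc]]])
      (simp_all only: fwd g_def real_scaleR_def less_imp_le)
  have NA: "cutoff_mass \<phi> N x r = a * ?A"
    unfolding N_def cutoff_mass_def using a
    by (subst affine_image_integral[OF locally_finite_borelD(1)[OF \<nu>] borel_measurable_continuous_onI[OF \<phi>c]])
      (simp_all only: fwd real_scaleR_def less_imp_le)
  have i\<psi>: "integrable \<nu> (\<lambda>y. \<phi> (norm y))"
    by (rule integrable_continuous_compact_support[OF \<nu> \<psi>c compact_cball[of 0 4]]) (auto intro!: \<psi>0)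
  have i\<psi>g: "integrable \<nu> (\<lambda>y. \<phi> (norm y) * g y)"
    by (rule integrable_continuous_compact_support[OF \<nu> continuous_on_mult[OF \<psi>c gc] compact_cball[of 0 4]])
      (auto intro!: \<psi>0)
  have A0: "0 \<le> ?A" by (intro Bochner_Integration.integral_nonneg \<psi>01)
  have Y8: "\<bar>?Y\<bar> \<le> 8 * ?A"
  proof -
    have "norm ?Y \<le> (\<integral>y. 8 * \<phi> (norm y) \<partial>\<nu>)"
    proof (rule Bochner_Integration.integral_norm_bound_integral[OF i\<psi>g integrable_mult_right[OF i\<psi>]])
      show "norm (\<phi> (norm y) * g y) \<le> 8 * \<phi> (norm y)" for y
        using mult_left_mono[OF g8[of y] \<psi>01(1)[of y]] \<psi>01(1)[of y] by (simp add: abs_mult mult.commute)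
    qed
    then show ?thesis by simp
  qed
  let ?T = "q * (?X1 - normalizing_const \<phi> \<mu> N x r * (\<integral>y. \<phi> (norm (y - x) / r) * f y \<partial>N))"
  have "\<bar>?T\<bar> \<le> \<bar>?X - ?Y\<bar> + 8 * \<bar>?B - ?A\<bar> + 16 * D"
  proof (cases "?A = 0")
    case True
    then have "?Y = 0" using Y8 by simp
    moreover have "normalizing_const \<phi> \<mu> N x r = 0" using True by (simp add: normalizing_const_def NA)
    ultimately have "\<bar>?T\<bar> = \<bar>(q * ?X1 - ?X) + (?X - ?Y)\<bar>" by simp
    also have "\<dots> \<le> 8 * D + \<bar>?X - ?Y\<bar>"
      by (rule order_trans[OF abs_triangle_ineq add_right_mono[OF XX]])
    finally show ?thesis
      using order_trans[OF abs_ge_zero BB] abs_ge_zero[of "?B - ?A"] by argo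
  next
    case False
    then have A: "0 < ?A" using A0 by simp
    have "normalizing_const \<phi> \<mu> N x r * (\<integral>y. \<phi> (norm (y - x) / r) * f y \<partial>N) = ?B1 / ?A * ?Y"
      using A a by (simp add: normalizing_const_def NA Nf) (simp add: cutoff_mass_def)
    then have T: "?T = (q * ?X1 - ?X) + (?X - ?Y) + (?A - q * ?B1) * (?Y / ?A)"
      using A by (simp add: field_simps)
    have third: "\<bar>(?A - q * ?B1) * (?Y / ?A)\<bar> \<le> (\<bar>?B - ?A\<bar> + D) * 8"
      unfolding abs_mult
    proof (rule mult_mono)
      show "\<bar>?A - q * ?B1\<bar> \<le> \<bar>?B - ?A\<bar> + D" using BB by linarith
      show "\<bar>?Y / ?A\<bar> \<le> 8" using Y8 A by (simp add: abs_divide pos_divide_le_eq)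
    qed (use BB in linarith)+
    have "\<bar>t1 + t2 + t3\<bar> \<le> \<bar>t1\<bar> + \<bar>t2\<bar> + \<bar>t3\<bar>" for t1 t2 t3 :: real by linarith
    then show ?thesis unfolding T
      by (rule order_trans) (use XX third in argo)
  qed
  then show ?thesis unfolding q_def M_def N_def \<kappa>_def g_def .
qed

text \<open>
  Otherwise the transport numbers stay above some \<open>e > 0\<close> along a sequence of radii tending to zero.
  The blow-up limit \<open>\<nu>\<close> along a subsequence, carried back to the actual scale, is an admissible
  competitor, so for each radius some test function witnesses a value above \<open>e\<close>. At unit scale these
  test functions form a compact family, and along a further subsequence all the terms of
  \<open>transport_term_le\<close> tend to zero.
\<close>
lemma transport_tendsto_zero_at_good_point:
  fixes x :: "'a::euclidean_space" and \<Omega> :: "'a \<Rightarrow> 'b::euclidean_space"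
  assumes \<mu>: "locally_finite_borel \<mu>" and F: "compact F" and s: "0 \<le> s"
    and \<delta>: "0 < \<delta>" and C: "0 \<le> C"
    and growth: "\<And>x r. x \<in> F \<Longrightarrow> 0 < r \<Longrightarrow> r < \<delta> \<Longrightarrow> emeasure \<mu> (ball x r) \<le> ennreal (C * r powr s)"
    and \<eta>: "cutoff_family \<eta>" and \<phi>: "smooth_cutoff \<phi>"
    and \<Omega>: "L-lipschitz_on UNIV \<Omega>" "\<Omega> 0 = 0" "one_homogeneous \<Omega>"
    and act: "\<And>(m::nat) \<epsilon>. 0 < \<epsilon> \<Longrightarrow> \<exists>d>0. \<forall>z\<in>F. \<forall>r\<in>{0<..<d}.
      norm (\<integral>y. radial_cut (\<eta> (1 / (real m + 2))) \<Omega> r (z - y) \<partial>\<mu>) \<le> \<epsilon> * r powr (s + 1)"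
    and x: "x \<in> F"
    and dens: "\<And>\<epsilon>. 0 < \<epsilon> \<Longrightarrow> \<forall>\<^sub>F r in at_right 0. emeasure \<mu> (ball x r - F) \<le> ennreal (\<epsilon> * r powr s)"
  shows "((\<lambda>r. transport_number \<phi> \<mu> \<Omega> s x r) \<longlongrightarrow> 0) (at_right 0)"
proof (rule ccontr)
  assume "\<not> ?thesis"
  then obtain a where a: "0 < a" "\<not> (\<forall>\<^sub>F r in at_right 0. transport_number \<phi> \<mu> \<Omega> s x r < a)"
    by (auto simp: order_tendsto_iff)
  have "\<exists>r>0. r < inverse (real (Suc n)) \<and> a \<le> transport_number \<phi> \<mu> \<Omega> s x r" for n
  proof (rule ccontr)
    assume *: "\<not> (\<exists>r>0. r < inverse (real (Suc n)) \<and> a \<le> transport_number \<phi> \<mu> \<Omega> s x r)"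
    have "\<forall>\<^sub>F r in at_right 0. transport_number \<phi> \<mu> \<Omega> s x r < a"
      unfolding eventually_at_right_field
      using * by (intro exI[of _ "inverse (real (Suc n))"]) (auto simp: not_le)
    then show False using a(2) by simp
  qed
  then obtain r where r: "\<And>n. 0 < r n" "\<And>n. r n < inverse (real (Suc n))"
    "\<And>n. a \<le> transport_number \<phi> \<mu> \<Omega> s x (r n)" by metis
  have r0: "r \<longlonglongrightarrow> 0"
    by (rule tendsto_sandwich[OF always_eventually always_eventually tendsto_const LIMSEQ_inverse_real_of_nat])
      (use r in \<open>auto intro: less_imp_le\<close>)
  obtain \<sigma> \<nu> C' where \<sigma>: "strict_mono (\<sigma> :: nat \<Rightarrow> nat)" and \<nu>: "locally_finite_borel \<nu>" and C': "0 \<le> C'"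
    and Mg: "\<And>n z R. 0 < R \<Longrightarrow> emeasure (blowup s x (r n) (density \<mu> (indicator F))) (ball z R) \<le> ennreal (C' * R powr s)"
    and \<nu>g: "\<And>z R. 0 < R \<Longrightarrow> emeasure \<nu> (ball z R) \<le> ennreal (C' * R powr s)"
    and sym: "symmetric_measure \<Omega> \<nu>" "0 \<in> symmetric_points \<Omega> \<nu>"
    and conv: "vaguely_converges (\<lambda>n. blowup s x (r (\<sigma> n)) (density \<mu> (indicator F))) \<nu>"
    by (rule blowup_limit_symmetric[OF \<mu> F s \<delta> C growth \<eta> \<Omega> act x dens r(1) r0]) (assumption | rule that)+
  have Fb: "F \<in> sets borel" using F by (simp add: borel_compact)
  note cut = smooth_cutoffD[OF \<phi>]
  define \<rho> where "\<rho> n = r (\<sigma> n)" for n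
  have \<rho>: "0 < \<rho> n" for n using r(1) by (simp add: \<rho>_def)
  have \<rho>r: "filterlim \<rho> (at_right 0) sequentially"
    using LIMSEQ_subseq_LIMSEQ[OF r0 \<sigma>] \<rho>
    by (intro tendsto_imp_filterlim_at_right always_eventually allI) (simp_all add: comp_def \<rho>_def[abs_def])
  define M where "M n = blowup s x (\<rho> n) (density \<mu> (indicator F))" for n
  have Mlf: "locally_finite_borel (M n)" for n
    unfolding M_def blowup_def using \<rho>
    by (intro affine_image_locally_finite restricted_locally_finite[OF \<mu> Fb]) simp
  have convM: "vaguely_converges M \<nu>" using conv by (simp add: M_def[abs_def] \<rho>_def)
  \<comment> \<open>The factor brings the growth constant of the competitor below \<open>1\<close>. The summand \<open>1\<close> covers
    the case \<open>C' = 0\<close>.\<close>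
  define b where "b n = \<rho> n powr s / (C' + 1)" for n
  have b: "0 < b n" for n using \<rho>[of n] C' by (simp add: b_def)
  define N where "N n = affine_image (b n) x (\<rho> n) \<nu>" for n
  have \<nu>s: "sets \<nu> = sets borel" by (rule locally_finite_borelD[OF \<nu>])
  have \<Omega>c: "continuous_on UNIV \<Omega>" by (rule lipschitz_on_continuous_on[OF \<Omega>(1)])
  have N: "N n \<in> symmetric_measures_at s \<Omega> x" for n
  proof -
    have "emeasure (N n) (ball z R) \<le> ennreal (R powr s)" if R: "0 < R" for z R
    proof -
      have "emeasure (N n) (ball z R) \<le> ennreal (b n) * ennreal (C' * (R / \<rho> n) powr s)"
        unfolding N_def emeasure_affine_image_ball[OF \<nu>s \<rho>]
        using R \<rho>[of n] by (intro mult_left_mono \<nu>g) auto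
      also have "\<dots> = ennreal (b n * (C' * (R / \<rho> n) powr s))"
        using b[of n] by (intro ennreal_mult'[symmetric]) simp
      also have "b n * (C' * (R / \<rho> n) powr s) = C' / (C' + 1) * R powr s"
        using \<rho>[of n] R by (simp add: b_def powr_divide)
      also have "\<dots> \<le> 1 * R powr s" using C' by (intro mult_right_mono) auto
      finally show ?thesis by (simp add: ennreal_leI)
    qed
    moreover have "locally_finite_borel (N n)"
      unfolding N_def by (rule affine_image_locally_finite[OF \<nu> \<rho>])
    moreover have "symmetric_measure \<Omega> (N n)"
      unfolding symmetric_measure_def
    proof
      fix z assume "z \<in> closed_support (N n)"
      then have "(z - x) /\<^sub>R \<rho> n \<in> closed_support \<nu>"
        unfolding N_def by (rule closed_support_affine_image[OF \<nu>s \<rho>])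
      then have "(z - x) /\<^sub>R \<rho> n \<in> symmetric_points \<Omega> \<nu>" using sym(1) by (auto simp: symmetric_measure_def)
      then show "z \<in> symmetric_points \<Omega> (N n)"
        unfolding N_def by (rule symmetric_points_affine_image[OF \<nu>s \<rho> less_imp_le[OF b] \<Omega>c \<Omega>(3)])
    qed
    moreover have "x \<in> symmetric_points \<Omega> (N n)"
      unfolding N_def
      by (rule symmetric_points_affine_image[OF \<nu>s \<rho> less_imp_le[OF b] \<Omega>c \<Omega>(3)]) (use sym(2) in simp)
    ultimately show ?thesis
      by (auto simp: symmetric_measures_at_def symmetric_measures_def growth_measures_def)
  qed
  obtain a' where a': "0 < a'" "a' < a" using dense[OF a(1)] by blast
  define e where "e = enn2real a'"
  have "a' < top" using a'(2) top_greatest by (rule less_le_trans)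
  then have e': "a' = ennreal e" by (simp add: e_def)
  have e: "0 < e" using a'(1) e' by simp
  define T where "T n f = 1 / \<rho> n powr s * ((\<integral>y. \<phi> (norm (y - x) / \<rho> n) * f y \<partial>\<mu>)
      - normalizing_const \<phi> \<mu> (N n) x (\<rho> n) * (\<integral>y. \<phi> (norm (y - x) / \<rho> n) * f y \<partial>N n))" for n f
  have "\<exists>f. f \<in> Lip0 (ball x (4 * \<rho> n)) \<and> (1 / \<rho> n)-lipschitz_on UNIV f \<and> e < \<bar>T n f\<bar>" for n
  proof -
    have "ennreal e < transport_number \<phi> \<mu> \<Omega> s x (\<rho> n)"
      using a'(2) r(3)[of "\<sigma> n"] unfolding e' \<rho>_def by (rule less_le_trans)
    also have "\<dots> \<le> (SUP f\<in>{f \<in> Lip0 (ball x (4 * \<rho> n)). (1 / \<rho> n)-lipschitz_on UNIV f}. ennreal \<bar>T n f\<bar>)"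
      unfolding transport_number_def T_def by (rule INF_lower[OF N])
    finally obtain f where "f \<in> Lip0 (ball x (4 * \<rho> n))" "(1 / \<rho> n)-lipschitz_on UNIV f" "ennreal e < ennreal \<bar>T n f\<bar>"
      unfolding less_SUP_iff by blast
    then show ?thesis using e by (auto simp: ennreal_less_iff)
  qed
  then obtain f where f: "\<And>n. f n \<in> Lip0 (ball x (4 * \<rho> n))" "\<And>n. (1 / \<rho> n)-lipschitz_on UNIV (f n)" "\<And>n. e < \<bar>T n (f n)\<bar>"
    by metis
  define g where "g n y = f n (x + \<rho> n *\<^sub>R y)" for n y
  have glip: "1-lipschitz_on UNIV (g n)" for n
  proof (rule lipschitz_onI)
    fix y z
    have "dist (g n y) (g n z) \<le> 1 / \<rho> n * dist (x + \<rho> n *\<^sub>R y) (x + \<rho> n *\<^sub>R z)"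
      unfolding g_def by (rule lipschitz_onD[OF f(2)]) auto
    also have "dist (x + \<rho> n *\<^sub>R y) (x + \<rho> n *\<^sub>R z) = \<rho> n * dist y z"
      using \<rho>[of n] by (simp add: dist_norm scaleR_diff_right[symmetric])
    finally show "dist (g n y) (g n z) \<le> 1 * dist y z" using \<rho>[of n] by simp
  qed simp
  have g0: "g n y = 0" if "y \<notin> ball 0 4" for n y
  proof -
    have "x + \<rho> n *\<^sub>R y \<notin> ball x (4 * \<rho> n)" using that \<rho>[of n] by (simp add: dist_norm)
    then show ?thesis using f(1)[of n] by (auto simp: Lip0_def g_def)
  qed
  have g8: "\<bar>g n y\<bar> \<le> 8" for n y
  proof (cases "y \<in> ball 0 4")
    case True
    obtain v :: 'a where "v \<in> Basis" using nonempty_Basis by blast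
    then have v: "norm (4 *\<^sub>R v) = 4" by simp
    have "\<bar>g n y\<bar> \<le> dist y (4 *\<^sub>R v)"
      using lipschitz_onD[OF glip[of n], of y "4 *\<^sub>R v"] g0[of "4 *\<^sub>R v" n] v by (simp add: dist_real_def)
    also have "\<dots> \<le> norm y + norm (4 *\<^sub>R v)" unfolding dist_norm by (rule norm_triangle_ineq4)
    finally show ?thesis using True v by simp
  qed (simp add: g0)
  have \<psi>c: "continuous_on UNIV (\<lambda>y::'a. \<phi> (norm y))"
    by (rule continuous_on_compose2[OF cut(1)]) (auto intro: continuous_intros)
  have Mc: "measure (M n) (ball 0 4) \<le> C' * 4 powr s" for n
    unfolding measure_def M_def \<rho>_def using C' by (intro enn2real_leI Mg) auto
  have \<nu>c: "measure \<nu> (ball 0 4) \<le> C' * 4 powr s"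
    unfolding measure_def using C' by (intro enn2real_leI \<nu>g) auto
  obtain k where k: "strict_mono (k :: nat \<Rightarrow> nat)"
    "(\<lambda>n. (\<integral>y. \<phi> (norm y) * g (k n) y \<partial>M (k n)) - (\<integral>y. \<phi> (norm y) * g (k n) y \<partial>\<nu>)) \<longlonglongrightarrow> 0"
    by (rule lipschitz_family_uniform_convergence[OF Mlf \<nu> convM Mc \<nu>c \<psi>c _ glip g0 g8])
      (use cut(2,3) in auto)
  define D where "D n = measure \<mu> (ball x (4 * \<rho> n) - F) / \<rho> n powr s" for n
  have D0: "D \<longlonglongrightarrow> 0"
  proof (rule LIMSEQ_I)
    fix \<epsilon> :: real assume \<epsilon>: "0 < \<epsilon>"
    define \<epsilon>' where "\<epsilon>' = \<epsilon> / 2 / 4 powr s"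
    have \<epsilon>': "0 < \<epsilon>'" using \<epsilon> by (simp add: \<epsilon>'_def)
    obtain d where d: "0 < d" "\<And>t. 0 < t \<Longrightarrow> t < d \<Longrightarrow> emeasure \<mu> (ball x t - F) \<le> ennreal (\<epsilon>' * t powr s)"
      using dens[OF \<epsilon>'] unfolding eventually_at_right_field by blast
    have "\<forall>\<^sub>F t in at_right 0. t < d / 4"
      unfolding eventually_at_right_field using d(1) by (intro exI[of _ "d / 4"]) auto
    then have "\<forall>\<^sub>F n in sequentially. \<rho> n < d / 4" by (rule eventually_compose_filterlim[OF _ \<rho>r])
    then obtain n0 where n0: "\<And>n. n0 \<le> n \<Longrightarrow> \<rho> n < d / 4" by (auto simp: eventually_sequentially)
    have "norm (D n - 0) < \<epsilon>" if n: "n0 \<le> n" for n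
    proof -
      have "measure \<mu> (ball x (4 * \<rho> n) - F) \<le> \<epsilon>' * (4 * \<rho> n) powr s"
        unfolding measure_def using n0[OF n] \<rho>[of n] \<epsilon>' by (intro enn2real_leI d(2)) auto
      also have "\<dots> = \<epsilon> / 2 * \<rho> n powr s" using \<rho>[of n] by (simp add: \<epsilon>'_def powr_mult)
      finally have "D n \<le> \<epsilon> / 2" using \<rho>[of n] by (simp add: D_def pos_divide_le_eq)
      moreover have "0 \<le> D n" by (simp add: D_def)
      ultimately show ?thesis using \<epsilon> by simp
    qed
    then show "\<exists>no. \<forall>n\<ge>no. norm (D n - 0) < \<epsilon>" by blast
  qed
  have B0: "(\<lambda>n. (\<integral>y. \<phi> (norm y) \<partial>M n) - (\<integral>y. \<phi> (norm y) \<partial>\<nu>)) \<longlonglongrightarrow> 0"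
  proof (rule LIM_zero)
    show "(\<lambda>n. \<integral>y. \<phi> (norm y) \<partial>M n) \<longlonglongrightarrow> (\<integral>y. \<phi> (norm y) \<partial>\<nu>)"
      by (rule vaguely_converges_vector[OF Mlf \<nu> convM \<psi>c compact_cball[of 0 4]]) (auto intro!: cut(5))
  qed
  let ?E = "\<lambda>n. \<bar>(\<integral>y. \<phi> (norm y) * g (k n) y \<partial>M (k n)) - (\<integral>y. \<phi> (norm y) * g (k n) y \<partial>\<nu>)\<bar>
      + 8 * \<bar>(\<integral>y. \<phi> (norm y) \<partial>M (k n)) - (\<integral>y. \<phi> (norm y) \<partial>\<nu>)\<bar> + 16 * D (k n)"
  have "?E \<longlonglongrightarrow> \<bar>0\<bar> + 8 * \<bar>0\<bar> + 16 * 0"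
    using LIMSEQ_subseq_LIMSEQ[OF B0 k(1)] LIMSEQ_subseq_LIMSEQ[OF D0 k(1)]
    by (intro tendsto_intros k(2)) (simp_all add: comp_def)
  then have "?E \<longlonglongrightarrow> 0" by simp
  then have "\<forall>\<^sub>F n in sequentially. ?E n < e" using e by (rule order_tendstoD(2))
  then obtain n where n: "?E n < e" using eventually_happens'[OF sequentially_bot] by blast
  have "\<bar>T (k n) (f (k n))\<bar> \<le> ?E n"
    unfolding T_def N_def M_def g_def
    by (rule transport_term_le[OF \<mu> Fb \<phi> \<rho> \<nu> b f(1,2)]) (use \<rho>[of "k n"] in \<open>simp add: D_def\<close>)
  then show False using f(3)[of "k n"] n by linarith
qed

section \<open>The equivalence\<close>

lemma upper_density_finite_imp_growth:
  fixes x :: "'a::metric_space"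
  assumes "upper_density \<mu> s x < \<infinity>"
  shows "\<exists>i::nat. \<forall>r\<in>{0<..<inverse (real (Suc i))}. emeasure \<mu> (ball x r) \<le> ennreal (real i * r powr s)"
proof -
  obtain n :: nat where n: "upper_density \<mu> s x < of_nat n"
    using assms ennreal_Ex_less_of_nat by (auto simp: less_top)
  then have "\<forall>\<^sub>F r in at_right 0. emeasure \<mu> (ball x r) / ennreal (r powr s) < of_nat n"
    unfolding upper_density_def by (rule Limsup_lessD)
  then obtain d where d: "0 < d" "\<And>r. 0 < r \<Longrightarrow> r < d \<Longrightarrow> emeasure \<mu> (ball x r) / ennreal (r powr s) < of_nat n"
    unfolding eventually_at_right_field by blast
  obtain j where j: "inverse (real (Suc j)) < d" using reals_Archimedean[OF d(1)] by blast
  define i where "i = max n j"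
  have ij: "inverse (real (Suc i)) \<le> inverse (real (Suc j))"
    by (rule le_imp_inverse_le) (simp_all add: i_def)
  have "emeasure \<mu> (ball x r) \<le> ennreal (real i * r powr s)" if r: "0 < r" "r < inverse (real (Suc i))" for r
  proof -
    have rs: "0 < r powr s" using r by simp
    have lt: "emeasure \<mu> (ball x r) / ennreal (r powr s) < of_nat n"
      using r ij j by (intro d(2)) linarith+
    have "emeasure \<mu> (ball x r) = emeasure \<mu> (ball x r) / ennreal (r powr s) * ennreal (r powr s)"
      unfolding ennreal_divide_times using rs by (simp add: divide_ennreal)
    also have "\<dots> \<le> of_nat n * ennreal (r powr s)"
      using lt by (intro mult_right_mono) auto
    also have "\<dots> \<le> of_nat i * ennreal (r powr s)"
      by (intro mult_right_mono) (auto simp: i_def)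
    also have "\<dots> = ennreal (real i * r powr s)"
      by (simp add: ennreal_mult ennreal_of_nat_eq_real_of_nat)
    finally show ?thesis .
  qed
  then show ?thesis by (intro exI[of _ i]) auto
qed

text \<open>
  Condition \<open>0\<close> of the countable family is the growth bound with constant \<open>i\<close> below radius \<open>1 / (i + 1)\<close>;
  condition \<open>Suc q\<close>, where \<open>q\<close> encodes a pair \<open>(m, j)\<close>, says that below that radius the
  action with parameter \<open>1 / (m + 2)\<close>, divided by \<open>r\<close> to the power \<open>s + 1\<close>, is at most \<open>1 / (j + 1)\<close>.
\<close>
theorem action_imp_transport_vanishing:
  fixes \<Omega> :: "'a::euclidean_space \<Rightarrow> 'b::euclidean_space" and \<mu> :: "'a measure"
  assumes \<mu>: "locally_finite_borel \<mu>" and s: "0 \<le> s"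
    and \<eta>: "cutoff_family \<eta>" and \<phi>: "smooth_cutoff \<phi>"
    and \<Omega>: "L-lipschitz_on UNIV \<Omega>" "\<Omega> 0 = 0" "one_homogeneous \<Omega>"
    and dens: "AE x in \<mu>. upper_density \<mu> s x < \<infinity>"
    and act: "small_local_action \<eta> s \<Omega> \<mu>"
  shows "AE x in \<mu>. ((\<lambda>r. transport_number \<phi> \<mu> \<Omega> s x r) \<longlongrightarrow> 0) (at_right 0)"
proof -
  have sets: "sets \<mu> = sets borel" by (rule locally_finite_borelD[OF \<mu>])
  define \<tau> :: "nat \<Rightarrow> real" where "\<tau> m = 1 / (real m + 2)" for m
  have \<tau>: "0 < \<tau> m" "\<tau> m < 1" for m by (auto simp: \<tau>_def field_simps)
  note cut = cutoff_familyD[OF \<eta> \<tau>]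
  define I where "I m r x = (\<integral>y. radial_cut (\<eta> (\<tau> m)) \<Omega> r (x - y) \<partial>\<mu>)" for m r x
  define G where "G i = {x. \<forall>r\<in>{0<..<inverse (real (Suc i))}. emeasure \<mu> (ball x r) \<le> ennreal (real i * r powr s)}" for i
  define E where "E m j i = {x. \<forall>r\<in>{0<..<inverse (real (Suc i))}.
      norm (I m r x) \<le> inverse (real (Suc j)) * r powr (s + 1)}" for m j i :: nat
  define A where "A p i = (case p of 0 \<Rightarrow> G i | Suc q \<Rightarrow> E (fst (prod_decode q)) (snd (prod_decode q)) i)" for p i
  have inv: "inverse (real (Suc i')) \<le> inverse (real (Suc i))" if "i \<le> i'" for i i'
    using that by (intro le_imp_inverse_le) auto
  have lt: "r < inverse (real (Suc i))" if "r < inverse (real (Suc (Suc i)))" for r i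
    by (rule less_le_trans[OF that inv]) simp
  have closed: "closed (A p i)" for p i
    unfolding A_def G_def E_def I_def
    by (auto split: nat.split intro!: closed_ball_measure_le[OF sets]
          closed_radial_integral_le[OF \<mu> cut(1) cut(3) \<Omega>(1,2)])
  have inc: "incseq (A p)" for p
  proof (rule incseq_SucI)
    fix i
    have "G i \<subseteq> G (Suc i)"
    proof
      fix x assume x: "x \<in> G i"
      have "emeasure \<mu> (ball x r) \<le> ennreal (real (Suc i) * r powr s)" if r: "r \<in> {0<..<inverse (real (Suc (Suc i)))}" for r
      proof -
        have "r \<in> {0<..<inverse (real (Suc i))}" using r lt[of r i] unfolding greaterThanLessThan_iff by blast
        then have "emeasure \<mu> (ball x r) \<le> ennreal (real i * r powr s)" using x unfolding G_def by blast
        also have "\<dots> \<le> ennreal (real (Suc i) * r powr s)" by (intro ennreal_leI mult_right_mono) auto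
        finally show ?thesis .
      qed
      then show "x \<in> G (Suc i)" unfolding G_def by blast
    qed
    moreover have "E m j i \<subseteq> E m j (Suc i)" for m j
    proof -
      have "{0<..<inverse (real (Suc (Suc i)))} \<subseteq> {0<..<inverse (real (Suc i))}"
        using lt[of _ i] by (simp only: subset_iff greaterThanLessThan_iff) blast
      then show ?thesis unfolding E_def by blast
    qed
    ultimately show "A p i \<subseteq> A p (Suc i)" unfolding A_def by (auto split: nat.split)
  qed
  have aeE: "AE x in \<mu>. \<forall>m. ((\<lambda>r. (1 / r powr (s + 1)) *\<^sub>R I m r x) \<longlongrightarrow> 0) (at_right 0)"
    unfolding AE_all_countable
  proof
    fix m
    have "\<tau> m \<in> {0<..<1}" using \<tau> by simp
    then show "AE x in \<mu>. ((\<lambda>r. (1 / r powr (s + 1)) *\<^sub>R I m r x) \<longlongrightarrow> 0) (at_right 0)"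
      using act unfolding small_local_action_def I_def radial_cut_def by blast
  qed
  have exhaust: "AE x in \<mu>. \<forall>p. \<exists>i. x \<in> A p i"
    using dens aeE
  proof eventually_elim
    case (elim x)
    show ?case
    proof
      fix p
      show "\<exists>i. x \<in> A p i"
      proof (cases p)
        case 0
        then show ?thesis using upper_density_finite_imp_growth[OF elim(1)] by (simp add: A_def G_def)
      next
        case (Suc q)
        define m where "m = fst (prod_decode q)"
        define j where "j = snd (prod_decode q)"
        have "\<forall>\<^sub>F r in at_right 0. norm ((1 / r powr (s + 1)) *\<^sub>R I m r x) < inverse (real (Suc j))"
          using elim(2) tendstoD[of "\<lambda>r. (1 / r powr (s + 1)) *\<^sub>R I m r x" 0 "at_right 0" "inverse (real (Suc j))"]
          by (simp add: dist_norm)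
        then obtain d where d: "0 < d" "\<And>r. 0 < r \<Longrightarrow> r < d \<Longrightarrow> norm ((1 / r powr (s + 1)) *\<^sub>R I m r x) < inverse (real (Suc j))"
          unfolding eventually_at_right_field by blast
        obtain i where i: "inverse (real (Suc i)) < d" using reals_Archimedean[OF d(1)] by blast
        have "norm (I m r x) \<le> inverse (real (Suc j)) * r powr (s + 1)" if "r \<in> {0<..<inverse (real (Suc i))}" for r
        proof -
          have r: "0 < r" "r < d" using that i by auto
          have "norm (I m r x) / r powr (s + 1) < inverse (real (Suc j))" using d(2)[OF r] by (simp del: of_nat_Suc)
          then show ?thesis using r by (simp add: pos_divide_less_eq del: of_nat_Suc)
        qed
        then have "x \<in> E m j i" unfolding E_def by blast
        then show ?thesis using Suc by (auto simp: A_def m_def j_def)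
      qed
    qed
  qed
  show ?thesis
  proof (rule AE_exhaust_by_compact[OF \<mu> closed inc exhaust])
    fix F :: "'a set" and i assume F: "compact F" "F \<subseteq> (\<Inter>p. A p (i p))"
    let ?\<delta> = "inverse (real (Suc (i 0)))"
    have FA: "F \<subseteq> A p (i p)" for p using F(2) by blast
    have growth: "emeasure \<mu> (ball x r) \<le> ennreal (real (i 0) * r powr s)" if "x \<in> F" "0 < r" "r < ?\<delta>" for x r
      using FA[of 0] that unfolding A_def G_def by auto
    have act': "\<exists>d>0. \<forall>z\<in>F. \<forall>r\<in>{0<..<d}.
        norm (\<integral>y. radial_cut (\<eta> (1 / (real m + 2))) \<Omega> r (z - y) \<partial>\<mu>) \<le> \<epsilon> * r powr (s + 1)"
      if \<epsilon>: "0 < \<epsilon>" for m \<epsilon>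
    proof -
      obtain j where j: "inverse (real (Suc j)) < \<epsilon>" using reals_Archimedean[OF \<epsilon>] by blast
      let ?p = "Suc (prod_encode (m, j))"
      have "F \<subseteq> E m j (i ?p)" using FA[of ?p] by (simp add: A_def)
      then have "norm (I m r z) \<le> \<epsilon> * r powr (s + 1)" if "z \<in> F" "r \<in> {0<..<inverse (real (Suc (i ?p)))}" for z r
        using that mult_right_mono[OF less_imp_le[OF j], of "r powr (s + 1)"] unfolding E_def
        by (blast intro: order_trans powr_ge_zero)
      then show ?thesis unfolding I_def \<tau>_def
        by (intro exI[of _ "inverse (real (Suc (i ?p)))"]) auto
    qed
    have "AE x in \<mu>. x \<in> F \<longrightarrow>
      (\<forall>\<epsilon>>0. \<forall>\<^sub>F r in at_right 0. emeasure \<mu> (ball x r - F) \<le> ennreal (\<epsilon> * r powr s))"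
      by (rule complement_density_zero[OF \<mu> F(1) _ _ growth]) auto
    then show "AE x in \<mu>. x \<in> F \<longrightarrow> ((\<lambda>r. transport_number \<phi> \<mu> \<Omega> s x r) \<longlongrightarrow> 0) (at_right 0)"
    proof eventually_elim
      case (elim x)
      show ?case
      proof
        assume x: "x \<in> F"
        show "((\<lambda>r. transport_number \<phi> \<mu> \<Omega> s x r) \<longlongrightarrow> 0) (at_right 0)"
          by (rule transport_tendsto_zero_at_good_point[OF \<mu> F(1) s _ _ growth \<eta> \<phi> \<Omega> act' x])
            (use elim x in auto)
      qed
    qed
  qed
qed

theorem transport_vanishing_imp_action:
  fixes \<Omega> :: "'a::euclidean_space \<Rightarrow> 'b::euclidean_space" and \<mu> :: "'a measure"
  assumes \<mu>: "locally_finite_borel \<mu>" and \<eta>: "cutoff_family \<eta>" and \<phi>: "\<forall>t\<in>{0..3}. \<phi> t = 1"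
    and \<Omega>: "L-lipschitz_on UNIV \<Omega>" "\<Omega> 0 = 0"
    and lim: "AE x in \<mu>. ((\<lambda>r. transport_number \<phi> \<mu> \<Omega> s x r) \<longlongrightarrow> 0) (at_right 0)"
  shows "small_local_action \<eta> s \<Omega> \<mu>"
  unfolding small_local_action_def
proof
  fix \<tau> :: real assume "\<tau> \<in> {0<..<1}"
  then have \<tau>: "0 < \<tau>" "\<tau> < 1" by auto
  note cut = cutoff_familyD[OF \<eta> \<tau>]
  show "AE x in \<mu>. ((\<lambda>r. (1 / r powr (s + 1)) *\<^sub>R
      (\<integral>y. \<eta> \<tau> (norm (x - y) / r) *\<^sub>R \<Omega> (x - y) \<partial>\<mu>)) \<longlongrightarrow> 0) (at_right 0)"
    using lim
  proof eventually_elim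
    case (elim x)
    show ?case
      using transport_vanishing_imp_action_vanishing[where \<phi>=\<phi>, OF \<mu> \<phi> cut(1) cut(3) \<Omega> elim]
      unfolding radial_cut_def .
  qed
qed

theorem theorem1p4:
  fixes \<Omega> :: "real ^ 'd \<Rightarrow> real ^ 'N"
    and \<mu> :: "(real ^ 'd) measure"
    and s :: real
    and \<eta> :: "real \<Rightarrow> real \<Rightarrow> real"
    and \<phi> :: "real \<Rightarrow> real"
  assumes "CARD('d) \<ge> 2"
    and "0 < s" and "s < real CARD('d)"
    and "cutoff_family \<eta>"
    and "smooth_cutoff \<phi>"
    and "\<exists>L. L-lipschitz_on UNIV \<Omega>"
    and "\<And>x. \<Omega> (- x) = - \<Omega> x"
    and "one_homogeneous \<Omega>"
    and "locally_finite_borel \<mu>"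
    and "AE x in \<mu>. upper_density \<mu> s x < \<infinity>"
  shows "small_local_action \<eta> s \<Omega> \<mu> \<longleftrightarrow>
         (AE x in \<mu>. ((\<lambda>r. transport_number \<phi> \<mu> \<Omega> s x r) \<longlongrightarrow> 0) (at_right 0))"
proof -
  obtain L where L: "L-lipschitz_on UNIV \<Omega>" using assms(6) by blast
  have \<Omega>0: "\<Omega> 0 = 0" by (rule odd_kernel_0) (rule assms(7))
  show ?thesis
    using action_imp_transport_vanishing[OF assms(9) less_imp_le[OF assms(2)] assms(4,5) L \<Omega>0 assms(8,10)]
      transport_vanishing_imp_action[OF assms(9,4) smooth_cutoffD(4)[OF assms(5)] L \<Omega>0]
    by blast
qed

end
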